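(* Let $f_1:E_1\to O$ and $f_2:E_2\to O$ be two regular fibrations over a polyhedron $O$, with lifting functions $L_{f_1}$, $L_{f_2}$, let $r_o\in O$, and let $F^i_{r_o}=f_i^{-1}(r_o)$ ($i=1,2$). Suppose $O=O_1\cup O_2$, where $O_1$ and $O_2$ are subpolyhedra of $O$ with $r_o\in O_3:=O_1\cap O_2$, such that: (i) $O_1$ is contractible in $O$ to $r_o$ leaving $r_o$ fixed, i.e. there is a continuous $R_1:O_1\times I\to O$ with $R_1(x,0)=x$, $R_1(x,1)=r_o$ for all $x\in O_1$, and $R_1(r_o,t)=r_o$ for all $t\in I$; (ii) $O_2$ is contractible to $r_o$, i.e. there is a continuous $R_2:O_2\times I\to O_2$ with $R_2(x,0)=x$ and $R_2(x,1)=r_o$ for all $x\in O_2$; (iii) $O_3$ is a subpolyhedron of $O$. Then $f_1$ and $f_2$ are fiber homotopy equivalent if and only if their $Lf$-functions are conjugate, i.e. if and only if there is a homotopy equivalence $g:F^1_{r_o}\to F^2_{r_o}$ with homotopy inverse $\overleftarrow{g}$ such that $$\Theta_{L_{f_1}}\simeq \overleftarrow{g}\circ\Theta_{L_{f_2}}\circ(\mathrm{id}_{\Omega(O,r_o)}\times g)$$ as maps $\Omega(O,r_o)\times F^1_{r_o}\to F^1_{r_o}$.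
   Context: All spaces are Hausdorff; "map" means continuous map; $I=[0,1]$; $X^I$ is the space of paths in $X$ (compact-open topology); $\widetilde{e}$ is the constant path at $e$; $\Omega(O,r_o)\subset O^I$ is the loop space at $r_o$; $\simeq$ means homotopic. A fibration is a Hurewicz fibration. For $f:E\to O$ put $\bigtriangleup f=\{(e,\alpha)\in E\times O^I: f(e)=\alpha(0)\}$. A lifting function for $f$ is a map $L_f:\bigtriangleup f\to E^I$ with $L_f(e,\alpha)(0)=e$ and $f\circ L_f(e,\alpha)=\alpha$ for all $(e,\alpha)\in\bigtriangleup f$; it is regular if $L_f(e,f\circ\widetilde{e})=\widetilde{e}$ for all $e\in E$. A fibration is regular if it has a regular lifting function. The $Lf$-function of $f$ induced by a lifting function $L_f$ is the map $\Theta_{L_f}:\Omega(O,r_o)\times F_{r_o}\to F_{r_o}$, $\Theta_{L_f}(\alpha,e)=L_f(e,\alpha)(1)$, where $F_{r_o}=f^{-1}(r_o)$. A fiber map from $f_1:E_1\to O$ to $f_2:E_2\to O$ is a map $h:E_1\to E_2$ with $f_2\circ h=f_1$. Two fiber maps are fiber homotopic if they are joined by a homotopy through fiber maps. $f_1,f_2$ are fiber homotopy equivalent if there are fiber maps $h:E_1\to E_2$, $k:E_2\to E_1$ with $k\circ h$ and $h\circ k$ fiber homotopic to the identities. For a simplicial complex $K$, $/K/$ is the set of functions $\beta$ from the vertices of $K$ to $I$ such that $\{v:\beta(v)\neq 0\}$ is a simplex and $\sum_v\beta(v)=1$, with the metric $d(\alpha,\beta)=\left(\sum_v(\alpha(v)-\beta(v))^2\right)^{1/2}$.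 A polyhedron is a space $O$ with a homeomorphism $f:/K/\to O$ for some simplicial complex $K$; a closed subspace $A\subset O$ is a subpolyhedron if $A=f(/L/)$ for some subcomplex $L\subset K$. Every simplicial complex is assumed to be such that each vertex belongs to only finitely many simplexes (so polyhedra are absolute neighborhood retracts). *)

theory Defs
  imports "HOL-Analysis.Analysis"
begin

text \<open>Spaces are values of type \<^typ>\<open>'a topology\<close>; a path is a function on \<^typ>\<open>real\<close> that is
  \<^const>\<open>undefined\<close> outside \<open>{0..1}\<close>, so that two paths are equal iff they agree on \<open>{0..1}\<close>.\<close>

abbreviation unit_interval :: "real topology"
  where "unit_interval \<equiv> top_of_set {0..1}"

subsection \<open>Path spaces and loop spaces\<close>

definition paths :: "'a topology \<Rightarrow> (real \<Rightarrow> 'a) set"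
  where "paths X = {\<alpha> \<in> extensional {0..1}. continuous_map unit_interval X \<alpha>}"

definition path_space :: "'a topology \<Rightarrow> (real \<Rightarrow> 'a) topology"
  where "path_space X =
    topology_generated_by
      {{\<alpha> \<in> paths X. \<alpha> ` C \<subseteq> U} | C U. compactin unit_interval C \<and> openin X U}"

definition const_path :: "'a \<Rightarrow> real \<Rightarrow> 'a"
  where "const_path x = (\<lambda>t\<in>{0..1}. x)"

definition loop_space :: "'a topology \<Rightarrow> 'a \<Rightarrow> (real \<Rightarrow> 'a) topology"
  where "loop_space X r = subtopology (path_space X) {\<alpha>. \<alpha> 0 = r \<and> \<alpha> 1 = r}"

subsection \<open>Fibrations and lifting functions\<close>

definition fibre :: "'e topology \<Rightarrow> ('e \<Rightarrow> 'b) \<Rightarrow> 'b \<Rightarrow> 'e topology"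
  where "fibre E f r = subtopology E {e. f e = r}"

definition lifting_domain ::
    "'e topology \<Rightarrow> 'b topology \<Rightarrow> ('e \<Rightarrow> 'b) \<Rightarrow> ('e \<times> (real \<Rightarrow> 'b)) topology"
  where "lifting_domain E X f =
    subtopology (prod_topology E (path_space X)) {(e, \<alpha>). f e = \<alpha> 0}"

definition lifting_function ::
    "'e topology \<Rightarrow> 'b topology \<Rightarrow> ('e \<Rightarrow> 'b) \<Rightarrow> ('e \<times> (real \<Rightarrow> 'b) \<Rightarrow> real \<Rightarrow> 'e) \<Rightarrow> bool"
  where "lifting_function E X f L \<longleftrightarrow>
    continuous_map (lifting_domain E X f) (path_space E) L \<and>
    (\<forall>(e, \<alpha>) \<in> topspace (lifting_domain E X f).
       L (e, \<alpha>) 0 = e \<and> (\<forall>t\<in>{0..1}. f (L (e, \<alpha>) t) = \<alpha> t))"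

definition regular_lifting_function ::
    "'e topology \<Rightarrow> 'b topology \<Rightarrow> ('e \<Rightarrow> 'b) \<Rightarrow> ('e \<times> (real \<Rightarrow> 'b) \<Rightarrow> real \<Rightarrow> 'e) \<Rightarrow> bool"
  where "regular_lifting_function E X f L \<longleftrightarrow>
    lifting_function E X f L \<and>
    (\<forall>e \<in> topspace E. L (e, const_path (f e)) = const_path e)"

definition homotopy_lifting_property ::
    "'z topology \<Rightarrow> 'e topology \<Rightarrow> 'b topology \<Rightarrow> ('e \<Rightarrow> 'b) \<Rightarrow> bool"
  where "homotopy_lifting_property Z E X f \<longleftrightarrow>
    (\<forall>g H. continuous_map Z E g \<and> continuous_map (prod_topology Z unit_interval) X H \<and>
           (\<forall>z \<in> topspace Z. H (z, 0) = f (g z)) \<longrightarrow>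
       (\<exists>G. continuous_map (prod_topology Z unit_interval) E G \<and>
            (\<forall>z \<in> topspace Z. G (z, 0) = g z \<and> (\<forall>t\<in>{0..1}. f (G (z, t)) = H (z, t)))))"

text \<open>A formula cannot quantify over spaces of all types, so the test spaces \<open>Z\<close> range over the
  Hausdorff topologies on one type. That type carries \<^term>\<open>lifting_domain E X f\<close>, the universal
  test space, so nothing is lost: see \<open>hurewicz_fibration_iff_lifting_function\<close> and
  \<open>hurewicz_fibration_imp_homotopy_lifting_property\<close> below.\<close>

definition hurewicz_fibration :: "'e topology \<Rightarrow> 'b topology \<Rightarrow> ('e \<Rightarrow> 'b) \<Rightarrow> bool"
  where "hurewicz_fibration E X f \<longleftrightarrow>
    continuous_map E X f \<and>
    (\<forall>Z :: ('e \<times> (real \<Rightarrow> 'b)) topology.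
       Hausdorff_space Z \<longrightarrow> homotopy_lifting_property Z E X f)"

definition regular_fibration :: "'e topology \<Rightarrow> 'b topology \<Rightarrow> ('e \<Rightarrow> 'b) \<Rightarrow> bool"
  where "regular_fibration E X f \<longleftrightarrow>
    hurewicz_fibration E X f \<and> (\<exists>L. regular_lifting_function E X f L)"

subsection \<open>Lf-functions and their conjugacy\<close>

definition Lf_function ::
    "('e \<times> (real \<Rightarrow> 'b) \<Rightarrow> real \<Rightarrow> 'e) \<Rightarrow> (real \<Rightarrow> 'b) \<times> 'e \<Rightarrow> 'e"
  where "Lf_function L = (\<lambda>(\<alpha>, e). L (e, \<alpha>) 1)"

definition homotopy_inverses ::
    "'a topology \<Rightarrow> 'b topology \<Rightarrow> ('a \<Rightarrow> 'b) \<Rightarrow> ('b \<Rightarrow> 'a) \<Rightarrow> bool"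
  where "homotopy_inverses X Y g g' \<longleftrightarrow>
    continuous_map X Y g \<and> continuous_map Y X g' \<and>
    homotopic_with (\<lambda>_. True) X X (g' \<circ> g) id \<and>
    homotopic_with (\<lambda>_. True) Y Y (g \<circ> g') id"

definition Lf_conjugate ::
    "'b topology \<Rightarrow> 'b \<Rightarrow>
     'e1 topology \<Rightarrow> ('e1 \<Rightarrow> 'b) \<Rightarrow> ('e1 \<times> (real \<Rightarrow> 'b) \<Rightarrow> real \<Rightarrow> 'e1) \<Rightarrow>
     'e2 topology \<Rightarrow> ('e2 \<Rightarrow> 'b) \<Rightarrow> ('e2 \<times> (real \<Rightarrow> 'b) \<Rightarrow> real \<Rightarrow> 'e2) \<Rightarrow> bool"
  where "Lf_conjugate X r E1 f1 L1 E2 f2 L2 \<longleftrightarrow>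
    (\<exists>g g'. homotopy_inverses (fibre E1 f1 r) (fibre E2 f2 r) g g' \<and>
       homotopic_with (\<lambda>_. True)
         (prod_topology (loop_space X r) (fibre E1 f1 r)) (fibre E1 f1 r)
         (Lf_function L1) (g' \<circ> Lf_function L2 \<circ> map_prod id g))"

subsection \<open>Fiber homotopy equivalence\<close>

definition over_base :: "'e1 topology \<Rightarrow> ('e1 \<Rightarrow> 'b) \<Rightarrow> ('e2 \<Rightarrow> 'b) \<Rightarrow> ('e1 \<Rightarrow> 'e2) \<Rightarrow> bool"
  where "over_base E1 f1 f2 h \<longleftrightarrow> (\<forall>e \<in> topspace E1. f2 (h e) = f1 e)"

definition fiber_map ::
    "'e1 topology \<Rightarrow> ('e1 \<Rightarrow> 'b) \<Rightarrow> 'e2 topology \<Rightarrow> ('e2 \<Rightarrow> 'b) \<Rightarrow> ('e1 \<Rightarrow> 'e2) \<Rightarrow> bool"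
  where "fiber_map E1 f1 E2 f2 h \<longleftrightarrow> continuous_map E1 E2 h \<and> over_base E1 f1 f2 h"

definition fiber_homotopic ::
    "'e1 topology \<Rightarrow> ('e1 \<Rightarrow> 'b) \<Rightarrow> 'e2 topology \<Rightarrow> ('e2 \<Rightarrow> 'b) \<Rightarrow> ('e1 \<Rightarrow> 'e2) \<Rightarrow> ('e1 \<Rightarrow> 'e2) \<Rightarrow> bool"
  where "fiber_homotopic E1 f1 E2 f2 h k \<longleftrightarrow> homotopic_with (over_base E1 f1 f2) E1 E2 h k"

definition fiber_homotopy_equivalent ::
    "'e1 topology \<Rightarrow> ('e1 \<Rightarrow> 'b) \<Rightarrow> 'e2 topology \<Rightarrow> ('e2 \<Rightarrow> 'b) \<Rightarrow> bool"
  where "fiber_homotopy_equivalent E1 f1 E2 f2 \<longleftrightarrow>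
    (\<exists>h k. fiber_map E1 f1 E2 f2 h \<and> fiber_map E2 f2 E1 f1 k \<and>
       fiber_homotopic E1 f1 E1 f1 (k \<circ> h) id \<and>
       fiber_homotopic E2 f2 E2 f2 (h \<circ> k) id)"

subsection \<open>Polyhedra\<close>

text \<open>The vertices of a simplicial complex \<open>K\<close> are the elements of \<open>\<Union>K\<close>; a simplex is identified
  with its set of vertices.\<close>

definition abstract_simplicial_complex :: "'v set set \<Rightarrow> bool"
  where "abstract_simplicial_complex K \<longleftrightarrow>
    (\<forall>s \<in> K. finite s \<and> s \<noteq> {} \<and> (\<forall>t. t \<subseteq> s \<and> t \<noteq> {} \<longrightarrow> t \<in> K)) \<and>
    (\<forall>v \<in> \<Union>K. finite {s \<in> K. v \<in> s})"

definition subcomplex :: "'v set set \<Rightarrow> 'v set set \<Rightarrow> bool"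
  where "subcomplex L K \<longleftrightarrow> abstract_simplicial_complex L \<and> L \<subseteq> K"

text \<open>Functions on the vertices of \<open>K\<close> are extended by zero to the whole type. This makes the points
  of a subcomplex points of \<open>K\<close>. All sums range over the finitely many vertices with a nonzero
  contribution.\<close>

definition realization :: "'v set set \<Rightarrow> ('v \<Rightarrow> real) set"
  where "realization K =
    {\<beta>. range \<beta> \<subseteq> {0..1} \<and> {v. \<beta> v \<noteq> 0} \<in> K \<and> (\<Sum>v | \<beta> v \<noteq> 0. \<beta> v) = 1}"

definition realization_dist :: "('v \<Rightarrow> real) \<Rightarrow> ('v \<Rightarrow> real) \<Rightarrow> real"
  where "realization_dist \<alpha> \<beta> = sqrt (\<Sum>v | \<alpha> v \<noteq> 0 \<or> \<beta> v \<noteq> 0. (\<alpha> v - \<beta> v)\<^sup>2)"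

definition realization_topology :: "'v set set \<Rightarrow> ('v \<Rightarrow> real) topology"
  where "realization_topology K = Metric_space.mtopology (realization K) realization_dist"

text \<open>A polyhedron carries its triangulation \<open>(K, \<phi>)\<close> as part of its structure, and its subpolyhedra
  are the images of subcomplexes of that \<open>K\<close>.\<close>

definition topological_polyhedron :: "'b topology \<Rightarrow> 'v set set \<Rightarrow> (('v \<Rightarrow> real) \<Rightarrow> 'b) \<Rightarrow> bool"
  where "topological_polyhedron X K \<phi> \<longleftrightarrow>
    abstract_simplicial_complex K \<and> homeomorphic_map (realization_topology K) X \<phi>"

definition subpolyhedron ::
    "'b topology \<Rightarrow> 'v set set \<Rightarrow> (('v \<Rightarrow> real) \<Rightarrow> 'b) \<Rightarrow> 'b set \<Rightarrow> bool"
  where "subpolyhedron X K \<phi> A \<longleftrightarrow>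
    closedin X A \<and> (\<exists>L. subcomplex L K \<and> A = \<phi> ` realization L)"

subsection \<open>Basic facts about the definitions\<close>

lemma Metric_space_realization:
  assumes K: "abstract_simplicial_complex K"
  shows "Metric_space (realization K) realization_dist"
proof
  have fin: "finite {v. \<alpha> v \<noteq> 0}" if "\<alpha> \<in> realization K" for \<alpha> :: "'a \<Rightarrow> real"
    using that K by (auto simp: realization_def abstract_simplicial_complex_def)
  have L2: "realization_dist \<alpha> \<beta> = L2_set (\<lambda>v. \<alpha> v - \<beta> v) S"
    if "finite S" "{v. \<alpha> v \<noteq> 0} \<union> {v. \<beta> v \<noteq> 0} \<subseteq> S" for \<alpha> \<beta> :: "'a \<Rightarrow> real" and S
    unfolding realization_dist_def L2_set_def using that
    by (intro arg_cong[where f=sqrt] sum.mono_neutral_left) auto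
  fix \<alpha> \<beta> :: "'a \<Rightarrow> real"
  show "0 \<le> realization_dist \<alpha> \<beta>"
    by (simp add: realization_dist_def sum_nonneg)
  show "realization_dist \<alpha> \<beta> = realization_dist \<beta> \<alpha>"
    by (simp add: realization_dist_def power2_commute disj_commute)
  assume a: "\<alpha> \<in> realization K" and b: "\<beta> \<in> realization K"
  define S where "S = {v. \<alpha> v \<noteq> 0} \<union> {v. \<beta> v \<noteq> 0}"
  have "finite S" using fin a b by (simp add: S_def)
  then have "realization_dist \<alpha> \<beta> = L2_set (\<lambda>v. \<alpha> v - \<beta> v) S"
    by (rule L2) (simp add: S_def)
  then have "realization_dist \<alpha> \<beta> = 0 \<longleftrightarrow> (\<forall>v\<in>S. \<alpha> v - \<beta> v = 0)"
    by (simp only: L2_set_eq_0_iff[OF \<open>finite S\<close>])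
  also have "\<dots> \<longleftrightarrow> \<alpha> = \<beta>"
  proof
    assume *: "\<forall>v\<in>S. \<alpha> v - \<beta> v = 0"
    show "\<alpha> = \<beta>"
    proof
      fix v show "\<alpha> v = \<beta> v"
      proof (cases "v \<in> S")
        case True
        with * have "\<alpha> v - \<beta> v = 0" by blast
        then show ?thesis by simp
      qed (simp add: S_def)
    qed
  qed simp
  finally show "realization_dist \<alpha> \<beta> = 0 \<longleftrightarrow> \<alpha> = \<beta>" .
  fix \<gamma> :: "'a \<Rightarrow> real"
  assume c: "\<gamma> \<in> realization K"
  define T where "T = S \<union> {v. \<gamma> v \<noteq> 0}"
  have T: "finite T" using fin c \<open>finite S\<close> by (simp add: T_def)
  have "L2_set (\<lambda>v. (\<alpha> v - \<beta> v) + (\<beta> v - \<gamma> v)) T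
      \<le> L2_set (\<lambda>v. \<alpha> v - \<beta> v) T + L2_set (\<lambda>v. \<beta> v - \<gamma> v) T"
    by (rule L2_set_triangle_ineq)
  then show "realization_dist \<alpha> \<gamma> \<le> realization_dist \<alpha> \<beta> + realization_dist \<beta> \<gamma>"
    using L2[OF T, of \<alpha> \<beta>] L2[OF T, of \<beta> \<gamma>] L2[OF T, of \<alpha> \<gamma>]
    by (simp add: T_def S_def subset_iff)
qed

lemma topspace_path_space [simp]: "topspace (path_space X) = paths X"
proof -
  have "paths X \<in> {{\<alpha> \<in> paths X. \<alpha> ` C \<subseteq> U} | C U. compactin unit_interval C \<and> openin X U}"
    by (intro CollectI exI[of _ "{}"]) auto
  then show ?thesis
    unfolding path_space_def topology_generated_by_topspace by blast
qed

lemma continuous_map_into_path_space: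
  assumes H: "continuous_map (prod_topology Z unit_interval) X H"
  shows "continuous_map Z (path_space X) (\<lambda>z. \<lambda>t\<in>{0..1}. H (z, t))"
proof -
  let ?h = "\<lambda>z. \<lambda>t\<in>{0..1}. H (z, t)"
  have path: "?h z \<in> paths X" if "z \<in> topspace Z" for z
  proof -
    have "continuous_map unit_interval (prod_topology Z unit_interval) (\<lambda>t. (z, t))"
      using that by (intro continuous_map_pairedI) auto
    from continuous_map_compose[OF this H] have "continuous_map unit_interval X (\<lambda>t. H (z, t))"
      by (simp add: o_def)
    then have "continuous_map unit_interval X (?h z)"
      by (rule continuous_map_eq) auto
    then show ?thesis by (simp add: paths_def)
  qed
  show ?thesis
    unfolding path_space_def
  proof (rule continuous_on_generated_topo)
    fix W assume "W \<in> {{\<alpha> \<in> paths X. \<alpha> ` C \<subseteq> U} | C U. compactin unit_interval C \<and> openin X U}"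
    then obtain C U where W: "W = {\<alpha> \<in> paths X. \<alpha> ` C \<subseteq> U}"
      and C: "compactin unit_interval C" and U: "openin X U" by blast
    have C01: "C \<subseteq> {0..1}" using compactin_subset_topspace[OF C] by simp
    define V where "V = {p \<in> topspace (prod_topology Z unit_interval). H p \<in> U}"
    have V: "openin (prod_topology Z unit_interval) V"
      unfolding V_def using H U by (rule openin_continuous_map_preimage)
    have eq: "?h -` W \<inter> topspace Z = {z \<in> topspace Z. {z} \<times> C \<subseteq> V}"
      using path C01 by (auto simp: W V_def image_subset_iff subset_iff)
    show "openin Z (?h -` W \<inter> topspace Z)"
    proof (subst openin_subopen, intro ballI)
      fix z assume "z \<in> ?h -` W \<inter> topspace Z"
      then have z: "z \<in> topspace Z" "{z} \<times> C \<subseteq> V" unfolding eq by auto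
      obtain A B where "openin Z A" "openin unit_interval B" "{z} \<subseteq> A" "C \<subseteq> B" "A \<times> B \<subseteq> V"
        using Wallace_theorem_prod_topology[of Z "{z}" unit_interval C V] C V z by auto
      then show "\<exists>T. openin Z T \<and> z \<in> T \<and> T \<subseteq> ?h -` W \<inter> topspace Z"
        unfolding eq by (intro exI[of _ A]) (use openin_subset in fastforce)
    qed
  next
    show "?h ` topspace Z
      \<subseteq> \<Union> {{\<alpha> \<in> paths X. \<alpha> ` C \<subseteq> U} | C U. compactin unit_interval C \<and> openin X U}"
      using path topspace_path_space[of X]
      unfolding path_space_def topology_generated_by_topspace by blast
  qed
qed

lemma continuous_map_path_eval:
  "continuous_map (prod_topology (path_space X) unit_interval) X (\<lambda>(\<alpha>, t). \<alpha> t)"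
  unfolding continuous_map_def
proof (intro conjI allI impI)
  show "(\<lambda>(\<alpha>, t). \<alpha> t) \<in> topspace (prod_topology (path_space X) unit_interval) \<rightarrow> topspace X"
    by (auto simp: paths_def continuous_map_def)
  fix U assume U: "openin X U"
  let ?P = "{p \<in> topspace (prod_topology (path_space X) unit_interval). (case p of (\<alpha>, t) \<Rightarrow> \<alpha> t) \<in> U}"
  show "openin (prod_topology (path_space X) unit_interval) ?P"
  proof (subst openin_subopen, clarsimp)
    fix \<alpha> and t :: real
    assume \<alpha>: "\<alpha> \<in> paths X" and t: "0 \<le> t" "t \<le> 1" and "\<alpha> t \<in> U"
    have "openin unit_interval {s \<in> topspace unit_interval. \<alpha> s \<in> U}"
      using \<alpha> U by (intro openin_continuous_map_preimage) (auto simp: paths_def)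
    then obtain T where "open T" and T: "{s \<in> {0..1}. \<alpha> s \<in> U} = {0..1} \<inter> T"
      by (auto simp: openin_open)
    then obtain \<epsilon> where "\<epsilon> > 0" and \<epsilon>: "cball t \<epsilon> \<subseteq> T"
      using t \<open>\<alpha> t \<in> U\<close> by (metis (mono_tags, lifting) Int_iff atLeastAtMost_iff mem_Collect_eq open_contains_cball)
    define C where "C = {0..1} \<inter> cball t \<epsilon>"
    have C: "compactin unit_interval C"
      unfolding C_def compactin_subtopology by (auto intro: compact_Int)
    define A where "A = {\<beta> \<in> paths X. \<beta> ` C \<subseteq> U}"
    define B where "B = {0..1} \<inter> ball t \<epsilon>"
    have "openin (path_space X) A"
      unfolding path_space_def A_def using C U by (intro topology_generated_by_Basis) blast
    moreover have "openin unit_interval B"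
      by (auto simp: B_def openin_open)
    ultimately have "openin (prod_topology (path_space X) unit_interval) (A \<times> B)"
      by (simp add: openin_prod_Times_iff)
    moreover have "(\<alpha>, t) \<in> A \<times> B"
      using \<alpha> t \<epsilon> T \<open>\<epsilon> > 0\<close> by (auto simp: A_def B_def C_def)
    moreover have "A \<times> B \<subseteq> paths X \<times> {0..1} \<inter> {p. (case p of (\<alpha>, t) \<Rightarrow> \<alpha> t) \<in> U}"
      by (auto simp: A_def B_def C_def image_subset_iff)
    ultimately show "\<exists>T. openin (prod_topology (path_space X) unit_interval) T \<and> (\<alpha>, t) \<in> T \<and>
           T \<subseteq> {p. p \<in> paths X \<times> {0..1} \<and> (case p of (\<alpha>, t) \<Rightarrow> \<alpha> t) \<in> U}"
      by blast
  qed
qed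

lemma lifting_function_imp_homotopy_lifting_property:
  assumes L: "lifting_function E X f L"
  shows "homotopy_lifting_property Z E X f"
  unfolding homotopy_lifting_property_def
proof (intro allI impI, elim conjE)
  fix g H
  assume g: "continuous_map Z E g" and H: "continuous_map (prod_topology Z unit_interval) X H"
    and eq: "\<forall>z \<in> topspace Z. H (z, 0) = f (g z)"
  let ?h = "\<lambda>z. \<lambda>t\<in>{0..1}. H (z, t)"
  have h: "continuous_map Z (path_space X) ?h"
    using H by (rule continuous_map_into_path_space)
  have d: "continuous_map Z (lifting_domain E X f) (\<lambda>z. (g z, ?h z))"
    unfolding lifting_domain_def continuous_map_in_subtopology
    using g h eq by (auto intro!: continuous_map_pairedI)
  have Ld: "continuous_map Z (path_space E) (\<lambda>z. L (g z, ?h z))"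
    using continuous_map_compose[OF d, of "path_space E" L] L
    by (simp add: lifting_function_def o_def)
  have "continuous_map (prod_topology Z unit_interval) (prod_topology (path_space E) unit_interval)
          (\<lambda>p. (L (g (fst p), ?h (fst p)), snd p))"
    using continuous_map_compose[OF continuous_map_fst[of Z unit_interval] Ld]
    by (intro continuous_map_pairedI continuous_map_snd) (simp add: o_def)
  from continuous_map_compose[OF this continuous_map_path_eval]
  have "continuous_map (prod_topology Z unit_interval) E
          (\<lambda>p. L (g (fst p), ?h (fst p)) (snd p))"
    by (simp add: o_def)
  moreover have "L (g z, ?h z) 0 = g z \<and> (\<forall>t\<in>{0..1}. f (L (g z, ?h z) t) = H (z, t))"
    if "z \<in> topspace Z" for z
  proof -
    have "(g z, ?h z) \<in> topspace (lifting_domain E X f)"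
      using d that by (auto simp: continuous_map_def)
    then show ?thesis using L by (fastforce simp: lifting_function_def)
  qed
  ultimately show "\<exists>G. continuous_map (prod_topology Z unit_interval) E G \<and>
      (\<forall>z \<in> topspace Z. G (z, 0) = g z \<and> (\<forall>t\<in>{0..1}. f (G (z, t)) = H (z, t)))"
    by (intro exI[of _ "\<lambda>p. L (g (fst p), ?h (fst p)) (snd p)"]) simp
qed

lemma Hausdorff_space_path_space:
  assumes "Hausdorff_space X"
  shows "Hausdorff_space (path_space X)"
  unfolding Hausdorff_space_def
proof (intro allI impI, elim conjE)
  fix \<alpha> \<beta> assume "\<alpha> \<in> topspace (path_space X)" "\<beta> \<in> topspace (path_space X)" "\<alpha> \<noteq> \<beta>"
  then have \<alpha>: "\<alpha> \<in> paths X" and \<beta>: "\<beta> \<in> paths X" by auto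
  then obtain t where t: "t \<in> {0..1}" "\<alpha> t \<noteq> \<beta> t"
    using \<open>\<alpha> \<noteq> \<beta>\<close> by (metis (no_types, lifting) extensionalityI mem_Collect_eq paths_def)
  moreover have "\<alpha> t \<in> topspace X" "\<beta> t \<in> topspace X"
    using \<alpha> \<beta> t by (auto simp: paths_def continuous_map_def)
  ultimately obtain U V where UV: "openin X U" "openin X V" "\<alpha> t \<in> U" "\<beta> t \<in> V" "disjnt U V"
    using assms unfolding Hausdorff_space_def by metis
  have "compactin unit_interval {t}" using t by simp
  then have "openin (path_space X) {\<gamma> \<in> paths X. \<gamma> ` {t} \<subseteq> W}" if "openin X W" for W
    unfolding path_space_def using that by (intro topology_generated_by_Basis) blast
  with UV \<alpha> \<beta> show "\<exists>U V. openin (path_space X) U \<and> openin (path_space X) V \<and>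
      \<alpha> \<in> U \<and> \<beta> \<in> V \<and> disjnt U V"
    by (intro exI[of _ "{\<gamma> \<in> paths X. \<gamma> ` {t} \<subseteq> U}"] exI[of _ "{\<gamma> \<in> paths X. \<gamma> ` {t} \<subseteq> V}"])
       (auto simp: disjnt_iff)
qed

lemma hurewicz_fibration_iff_lifting_function:
  assumes "Hausdorff_space E" "Hausdorff_space X"
  shows "hurewicz_fibration E X f \<longleftrightarrow>
    continuous_map E X f \<and> (\<exists>L. lifting_function E X f L)"
proof
  assume fib: "hurewicz_fibration E X f"
  let ?D = "lifting_domain E X f"
  have "Hausdorff_space ?D"
    unfolding lifting_domain_def using assms
    by (intro Hausdorff_space_subtopology)
       (simp add: Hausdorff_space_prod_topology Hausdorff_space_path_space)
  then have hlp: "homotopy_lifting_property ?D E X f"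
    using fib by (simp add: hurewicz_fibration_def)
  have fst: "continuous_map ?D E fst" and snd: "continuous_map ?D (path_space X) snd"
    unfolding lifting_domain_def
    by (auto intro: continuous_map_from_subtopology continuous_map_fst continuous_map_snd)
  have "continuous_map (prod_topology ?D unit_interval) (prod_topology (path_space X) unit_interval)
          (\<lambda>p. (snd (fst p), snd p))"
    using continuous_map_compose[OF continuous_map_fst[of ?D unit_interval] snd]
    by (intro continuous_map_pairedI continuous_map_snd) (simp add: o_def)
  from continuous_map_compose[OF this continuous_map_path_eval]
  have "continuous_map (prod_topology ?D unit_interval) X (\<lambda>p. snd (fst p) (snd p))"
    by (simp add: o_def)
  moreover have "\<forall>z \<in> topspace ?D. snd z 0 = f (fst z)"
    by (auto simp: lifting_domain_def)
  ultimately obtain G where G: "continuous_map (prod_topology ?D unit_interval) E G"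
    and G0: "\<And>z. z \<in> topspace ?D \<Longrightarrow> G (z, 0) = fst z"
    and Gt: "\<And>z t. z \<in> topspace ?D \<Longrightarrow> t \<in> {0..1} \<Longrightarrow> f (G (z, t)) = snd z t"
    using hlp[unfolded homotopy_lifting_property_def, rule_format,
        of fst "\<lambda>p. snd (fst p) (snd p)"] fst by auto
  have "lifting_function E X f (\<lambda>z. \<lambda>t\<in>{0..1}. G (z, t))"
    unfolding lifting_function_def
    using continuous_map_into_path_space[OF G] G0 Gt by auto
  then show "continuous_map E X f \<and> (\<exists>L. lifting_function E X f L)"
    using fib by (auto simp: hurewicz_fibration_def)
next
  assume "continuous_map E X f \<and> (\<exists>L. lifting_function E X f L)"
  then show "hurewicz_fibration E X f"
    unfolding hurewicz_fibration_def
    using lifting_function_imp_homotopy_lifting_property by blast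
qed

lemma hurewicz_fibration_imp_homotopy_lifting_property:
  assumes "Hausdorff_space E" "Hausdorff_space X" "hurewicz_fibration E X f"
  shows "homotopy_lifting_property Z E X f"
  using assms hurewicz_fibration_iff_lifting_function lifting_function_imp_homotopy_lifting_property
  by blast

end

theory Submission
  imports Defs
begin

text \<open>
  Transport along paths carries the fibres of a fibration into one another: \<open>transport L e \<gamma>\<close> is the
  end of the lift of \<open>\<gamma>\<close> that starts at \<open>e\<close>, and the \<open>Lf\<close>-function is transport around loops.
  Everything rests on one remark (\<open>lift_ends_homotopic\<close>): two lifts of the same path with the same
  start have vertically homotopic ends, continuously in all data. So, up to vertical homotopy,
  transport does not depend on the lifting function, is compatible with concatenation, and transport
  along the reversed path is an inverse.

  Let \<open>h\<close> and \<open>k\<close> be inverse fiber homotopy equivalences. If \<open>e\<close> lies over \<open>r\<close>, then \<open>k\<close> maps the lift of a loop that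
  starts at \<open>h e\<close> to a lift of the same loop that starts at \<open>k (h e)\<close>, a point joined to \<open>e\<close> inside
  the fibre. Hence the restrictions of \<open>h\<close> and \<open>k\<close> to the fibres over \<open>r\<close> conjugate the
  \<open>Lf\<close>-functions.

  Conversely, let \<open>g\<close> and \<open>g'\<close> conjugate the \<open>Lf\<close>-functions. A contraction \<open>R\<close> of a piece of the base
  to \<open>r\<close> spreads \<open>g\<close> to a fiber map over that piece: transport to the fibre over \<open>r\<close> along the tracks of \<open>R\<close>,
  apply \<open>g\<close>, transport back (\<open>spread\<close>). Spreading \<open>g'\<close> inverts this up to vertical homotopy. Over
  \<open>X1 \<inter> X2\<close> the two contractions give two spreads of \<open>g\<close>; they differ by transport around the loop
  that goes out along a track of \<open>R2\<close> and returns along a track of \<open>R1\<close>, and since \<open>g\<close> commutes with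
  such transports up to homotopy, the two spreads are vertically homotopic
  (\<open>spread_independent_of_contraction\<close>). Subpolyhedra are cofibred, so this homotopy extends over
  \<open>X1\<close> (\<open>vertical_homotopy_extension\<close>) and the two spreads, one of them deformed, fit together to a
  fiber map \<open>h\<close> over \<open>X\<close>; in the same way \<open>g'\<close> gives \<open>k\<close>.

  The composites \<open>k \<circ> h\<close> and \<open>h \<circ> k\<close> are vertically homotopic to the identity over \<open>X1\<close> and over
  \<open>X2\<close>, but the two homotopies may disagree over \<open>X1 \<inter> X2\<close>, where together they form a loop of
  self-maps based at the identity. Such a map still has a left inverse: glue the identity over \<open>X2\<close>
  to a map over \<open>X1\<close> that undoes this loop (\<open>locally_id_left_inverse\<close>). The left inverse is
  of the same kind, so both composites are invertible up to vertical homotopy, and hence so is \<open>h\<close>.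
\<close>

section \<open>Continuity of composite maps\<close>

lemma continuous_map_comp:
  "continuous_map X Y f \<Longrightarrow> continuous_map Y Z g \<Longrightarrow> continuous_map X Z (\<lambda>x. g (f x))"
  using continuous_map_compose[of X Y f Z g] by (simp add: o_def)

lemma continuous_map_fst_comp:
  "continuous_map T (prod_topology A B) g \<Longrightarrow> continuous_map T A (\<lambda>x. fst (g x))"
  by (rule continuous_map_comp[OF _ continuous_map_fst])

lemma continuous_map_snd_comp:
  "continuous_map T (prod_topology A B) g \<Longrightarrow> continuous_map T B (\<lambda>x. snd (g x))"
  by (rule continuous_map_comp[OF _ continuous_map_snd])

lemma continuous_map_real_fst_comp:
  "continuous_map T (prod_topology unit_interval B) g \<Longrightarrow> continuous_map T euclideanreal (\<lambda>x. fst (g x))"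
  by (rule continuous_map_into_fulltopology[OF continuous_map_fst_comp])

lemma continuous_map_real_snd_comp:
  "continuous_map T (prod_topology A unit_interval) g \<Longrightarrow> continuous_map T euclideanreal (\<lambda>x. snd (g x))"
  by (rule continuous_map_into_fulltopology[OF continuous_map_snd_comp])

lemma continuous_map_unit_intervalI:
  "continuous_map T euclideanreal g \<Longrightarrow> (\<And>x. x \<in> topspace T \<Longrightarrow> 0 \<le> g x \<and> g x \<le> 1) \<Longrightarrow>
   continuous_map T unit_interval g"
  by (auto simp: continuous_map_in_subtopology)

lemma continuous_map_real_constant: "continuous_map T euclideanreal (\<lambda>x. c)" by simp

text \<open>
  These rules take precedence over the general projection rules below: a real-valued projection stems
  from a factor that carries the topology of the unit interval.
\<close>
lemmas continuous_map_real_intros =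
  continuous_map_real_fst_comp continuous_map_real_snd_comp
  continuous_map_real_mult continuous_map_real_max continuous_map_diff
  continuous_map_real_mult_left continuous_map_real_constant

lemmas continuous_map_proj_intros =
  continuous_map_fst_comp continuous_map_snd_comp continuous_map_id[unfolded id_def] continuous_map_pairedI

lemma mult_unit_interval:
  fixes s t :: real
  assumes "0 \<le> s" "s \<le> 1" "0 \<le> t" "t \<le> 1"
  shows "0 \<le> s * t" "s * t \<le> 1"
  using assms by (auto simp: mult_le_one)

section \<open>Homotopies over a map to the base\<close>

text \<open>
  A vertical homotopy is used throughout as a fiber homotopy whose source is an arbitrary space over
  the base: \<open>fiber_homotopic Z \<pi> E f a b\<close> says that \<open>a\<close> and \<open>b\<close> are homotopic through lifts of \<open>\<pi>\<close>.
\<close>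
lemma fiber_homotopicI:
  assumes "continuous_map (prod_topology unit_interval Z) E H"
    and "\<And>z. z \<in> topspace Z \<Longrightarrow> H (0, z) = a z" "\<And>z. z \<in> topspace Z \<Longrightarrow> H (1, z) = b z"
    and "\<And>t z. t \<in> {0..1} \<Longrightarrow> z \<in> topspace Z \<Longrightarrow> f (H (t, z)) = \<pi> z"
  shows "fiber_homotopic Z \<pi> E f a b"
  unfolding fiber_homotopic_def
  using assms by (subst homotopic_with) (auto simp: over_base_def intro!: exI[of _ H])

lemma fiber_homotopicE:
  assumes "fiber_homotopic Z \<pi> E f a b"
  obtains H where "continuous_map (prod_topology unit_interval Z) E H"
    and "\<And>z. H (0, z) = a z" "\<And>z. H (1, z) = b z"
    and "\<And>t z. t \<in> {0..1} \<Longrightarrow> z \<in> topspace Z \<Longrightarrow> f (H (t, z)) = \<pi> z"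
proof -
  from assms obtain H where "continuous_map (prod_topology unit_interval Z) E H"
    "\<forall>z. H (0, z) = a z" "\<forall>z. H (1, z) = b z"
    "\<forall>t \<in> {0..1}. over_base Z \<pi> f (\<lambda>z. H (t, z))"
    unfolding fiber_homotopic_def homotopic_with_def by blast
  then show ?thesis by (intro that[of H]) (auto simp: over_base_def)
qed

lemma fiber_homotopic_imp_fiber_map:
  assumes "fiber_homotopic Z \<pi> E f a b"
  shows "fiber_map Z \<pi> E f a" "fiber_map Z \<pi> E f b"
  using homotopic_with_imp_continuous_maps[OF assms[unfolded fiber_homotopic_def]]
    homotopic_with_imp_property[OF assms[unfolded fiber_homotopic_def]]
  by (auto simp: fiber_map_def)

lemma fiber_homotopic_eq:
  assumes "fiber_map Z \<pi> E f a" "\<And>z. z \<in> topspace Z \<Longrightarrow> a z = b z"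
  shows "fiber_homotopic Z \<pi> E f a b"
  using assms unfolding fiber_homotopic_def fiber_map_def
  by (intro homotopic_with_equal) (auto simp: over_base_def)

lemma fiber_homotopic_sym: "fiber_homotopic Z \<pi> E f a b \<Longrightarrow> fiber_homotopic Z \<pi> E f b a"
  unfolding fiber_homotopic_def by (rule homotopic_with_symD)

lemma fiber_homotopic_trans [trans]:
  "fiber_homotopic Z \<pi> E f a b \<Longrightarrow> fiber_homotopic Z \<pi> E f b c \<Longrightarrow> fiber_homotopic Z \<pi> E f a c"
  unfolding fiber_homotopic_def by (rule homotopic_with_trans)

lemma fiber_homotopic_cong:
  assumes "fiber_homotopic Z \<pi> E f a b"
    and "\<And>z. z \<in> topspace Z \<Longrightarrow> \<pi> z = \<pi>' z"
    and "\<And>z. z \<in> topspace Z \<Longrightarrow> a z = a' z" "\<And>z. z \<in> topspace Z \<Longrightarrow> b z = b' z"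
  shows "fiber_homotopic Z \<pi>' E f a' b'"
proof -
  obtain H where "continuous_map (prod_topology unit_interval Z) E H"
    and "\<And>z. H (0, z) = a z" "\<And>z. H (1, z) = b z"
    and "\<And>t z. t \<in> {0..1} \<Longrightarrow> z \<in> topspace Z \<Longrightarrow> f (H (t, z)) = \<pi> z"
    using fiber_homotopicE[OF assms(1)] by blast
  then show ?thesis using assms by (intro fiber_homotopicI[of Z E H]) auto
qed

lemma fiber_homotopic_precompose:
  assumes ab: "fiber_homotopic Z \<pi> E f a b" and w: "continuous_map W Z w"
  shows "fiber_homotopic W (\<lambda>x. \<pi> (w x)) E f (\<lambda>x. a (w x)) (\<lambda>x. b (w x))"
  using homotopic_with_compose_continuous_map_right[OF ab[unfolded fiber_homotopic_def] w,
      of "over_base W (\<lambda>x. \<pi> (w x)) f"] continuous_map_image_subset_topspace[OF w]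
  by (auto simp: fiber_homotopic_def o_def over_base_def image_subset_iff)

lemma fiber_homotopic_postcompose:
  assumes ab: "fiber_homotopic Z \<pi> E f a b" and h: "fiber_map E f E' f' h"
  shows "fiber_homotopic Z \<pi> E' f' (\<lambda>x. h (a x)) (\<lambda>x. h (b x))"
proof -
  obtain H where H: "continuous_map (prod_topology unit_interval Z) E H"
    and H01: "\<And>z. H (0, z) = a z" "\<And>z. H (1, z) = b z"
    and fH: "\<And>t z. t \<in> {0..1} \<Longrightarrow> z \<in> topspace Z \<Longrightarrow> f (H (t, z)) = \<pi> z"
    using fiber_homotopicE[OF ab] by blast
  have h: "continuous_map E E' h" "\<And>e. e \<in> topspace E \<Longrightarrow> f' (h e) = f e"
    using h by (auto simp: fiber_map_def over_base_def)
  have "H (t, z) \<in> topspace E" if "t \<in> {0..1}" "z \<in> topspace Z" for t z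
    using continuous_map_image_subset_topspace[OF H] that by (auto simp: image_subset_iff)
  then show ?thesis
    using H01 fH h by (intro fiber_homotopicI[OF continuous_map_comp[OF H h(1)]]) auto
qed

text \<open>
  Maps into a fibre are lifts of a constant map, so homotopies inside a fibre are vertical homotopies.
\<close>
lemma homotopic_into_fibre_iff:
  "homotopic_with (\<lambda>_. True) Z (fibre E f r) a b \<longleftrightarrow> fiber_homotopic Z (\<lambda>_. r) E f a b"
proof
  assume "homotopic_with (\<lambda>_. True) Z (fibre E f r) a b"
  then obtain H where "continuous_map (prod_topology unit_interval Z) (fibre E f r) H"
    "\<forall>z. H (0, z) = a z" "\<forall>z. H (1, z) = b z"
    unfolding homotopic_with_def by blast
  then show "fiber_homotopic Z (\<lambda>_. r) E f a b"
    by (intro fiber_homotopicI[of Z E H]) (auto simp: fibre_def continuous_map_in_subtopology)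
next
  assume ab: "fiber_homotopic Z (\<lambda>_. r) E f a b"
  obtain H where H: "continuous_map (prod_topology unit_interval Z) E H"
    and H01: "\<And>z. H (0, z) = a z" "\<And>z. H (1, z) = b z"
    and fH: "\<And>t z. t \<in> {0..1} \<Longrightarrow> z \<in> topspace Z \<Longrightarrow> f (H (t, z)) = r"
    using fiber_homotopicE[OF ab] by blast
  have "continuous_map (prod_topology unit_interval Z) (fibre E f r) H"
    unfolding fibre_def using H fH by (intro continuous_map_into_subtopology) auto
  then show "homotopic_with (\<lambda>_. True) Z (fibre E f r) a b"
    unfolding homotopic_with_def using H01 by blast
qed

abbreviation over :: "'e topology \<Rightarrow> ('e \<Rightarrow> 'b) \<Rightarrow> 'b set \<Rightarrow> 'e topology"
  where "over E f B \<equiv> subtopology E {e. f e \<in> B}"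

lemma over_eq_closed: "subtopology (over E f B) {e \<in> topspace E. f e \<in> B \<inter> C} = over E f (B \<inter> C)"
proof -
  have "subtopology (over E f B) {e \<in> topspace E. f e \<in> B \<inter> C}
      = subtopology E ({e. f e \<in> B} \<inter> {e \<in> topspace E. f e \<in> B \<inter> C})"
    by (rule subtopology_subtopology)
  also have "{e. f e \<in> B} \<inter> {e \<in> topspace E. f e \<in> B \<inter> C} = topspace E \<inter> {e. f e \<in> B \<inter> C}"
    by auto
  finally show ?thesis by (simp only: subtopology_restrict)
qed

lemma prod_over: "prod_topology T (over E f B) = over (prod_topology T E) (\<lambda>q. f (snd q)) B"
proof -
  have "prod_topology T (over E f B) = subtopology (prod_topology T E) (topspace T \<times> {e. f e \<in> B})"
    by (metis subtopology_Times subtopology_topspace)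
  also have "\<dots> = subtopology (prod_topology T E) (topspace (prod_topology T E) \<inter> {q. f (snd q) \<in> B})"
    by (subst subtopology_restrict[symmetric]) (rule arg_cong[of _ _ "subtopology _"], auto)
  finally show ?thesis by (simp only: subtopology_restrict)
qed

lemma continuous_map_prod_over_mono:
  assumes "continuous_map (prod_topology T (over E f B)) Y h" "C \<subseteq> B"
  shows "continuous_map (prod_topology T (over E f C)) Y h"
proof -
  have "over E f C = subtopology (over E f B) {e. f e \<in> C}"
    using assms(2) by (simp add: subtopology_subtopology Int_absorb1 Collect_mono subset_iff)
  then have "prod_topology T (over E f C)
      = subtopology (prod_topology T (over E f B)) (topspace T \<times> {e. f e \<in> C})"
    by (metis subtopology_Times subtopology_topspace)
  then show ?thesis using continuous_map_from_subtopology[OF assms(1)] by simp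
qed

lemma continuous_map_glue:
  assumes p: "continuous_map T X p"
    and cl: "closedin X X1" "closedin X X2" "X1 \<union> X2 = topspace X"
    and a: "continuous_map (over T p X1) Y a" and b: "continuous_map (over T p X2) Y b"
    and agree: "\<And>x. x \<in> topspace T \<Longrightarrow> p x \<in> X1 \<inter> X2 \<Longrightarrow> a x = b x"
  shows "continuous_map T Y (\<lambda>x. if p x \<in> X2 then b x else a x)"
proof -
  let ?B = "\<lambda>i. if i then X2 else X1" and ?g = "\<lambda>i. if i then b else a"
  have pX: "p x \<in> X1 \<union> X2" if "x \<in> topspace T" for x
    using continuous_map_image_subset_topspace[OF p] that cl(3) by blast
  show ?thesis
  proof (rule pasting_lemma_closed[where I = UNIV and T = "\<lambda>i. {x \<in> topspace T. p x \<in> ?B i}" and f = ?g])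
    fix i :: bool
    show "closedin T {x \<in> topspace T. p x \<in> ?B i}"
      using p cl by (intro closedin_continuous_map_preimage[OF p]) auto
    have "{x \<in> topspace T. p x \<in> ?B i} = topspace T \<inter> {x. p x \<in> ?B i}" by auto
    then have "subtopology T {x \<in> topspace T. p x \<in> ?B i} = over T p (?B i)"
      by (simp only: subtopology_restrict)
    then show "continuous_map (subtopology T {x \<in> topspace T. p x \<in> ?B i}) Y (?g i)"
      using a b by (cases i) simp_all
  next
    fix i j :: bool and x
    assume "x \<in> topspace T \<inter> {x \<in> topspace T. p x \<in> ?B i} \<inter> {x \<in> topspace T. p x \<in> ?B j}"
    then show "?g i x = ?g j x" using agree[of x] by (cases i; cases j) auto
  next
    fix x assume x: "x \<in> topspace T"
    show "\<exists>j. j \<in> UNIV \<and> x \<in> {x \<in> topspace T. p x \<in> ?B j} \<and>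
        (if p x \<in> X2 then b x else a x) = ?g j x"
      using x pX[OF x] by (intro exI[of _ "p x \<in> X2"]) auto
  qed simp
qed

lemma fiber_homotopic_restrict:
  assumes "fiber_homotopic E f E' f' a b"
  shows "fiber_homotopic (over E f B) f E' f' a b"
  using fiber_homotopic_precompose[OF assms, of "over E f B" "\<lambda>x. x"]
  by (simp add: continuous_map_id_subt[unfolded id_def])

lemma fiber_map_restrict:
  "fiber_map E f E' f' a \<Longrightarrow> fiber_map (over E f B) f E' f' a"
  by (auto simp: fiber_map_def over_base_def continuous_map_from_subtopology)

section \<open>Transport along paths\<close>

definition transport :: "('e \<times> (real \<Rightarrow> 'b) \<Rightarrow> real \<Rightarrow> 'e) \<Rightarrow> 'e \<Rightarrow> (real \<Rightarrow> 'b) \<Rightarrow> 'e"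
  where "transport L e \<gamma> = L (e, restrict \<gamma> {0..1}) 1"

lemma transport_cong:
  "(\<And>t. t \<in> {0..1} \<Longrightarrow> \<gamma> t = \<gamma>' t) \<Longrightarrow> transport L e \<gamma> = transport L e \<gamma>'"
  unfolding transport_def by (metis restrict_ext)

text \<open>
  This is the only way in which regularity enters: transport along a path that stands still is the
  identity, not merely homotopic to it.
\<close>
lemma transport_const:
  assumes "regular_lifting_function E X f L" "e \<in> topspace E"
    and "\<And>t. t \<in> {0..1} \<Longrightarrow> \<gamma> t = f e"
  shows "transport L e \<gamma> = e"
proof -
  have "restrict \<gamma> {0..1} = const_path (f e)"
    unfolding const_path_def using assms(3) by (rule restrict_ext)
  then have "L (e, restrict \<gamma> {0..1}) = const_path e"
    using assms(1,2) by (simp add: regular_lifting_function_def)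
  then show ?thesis by (simp add: transport_def const_path_def)
qed

lemma lift_continuous:
  assumes L: "lifting_function E X f L" and y: "continuous_map Z E y"
    and \<gamma>: "continuous_map (prod_topology Z unit_interval) X (\<lambda>p. \<gamma> (fst p) (snd p))"
    and start: "\<And>z. z \<in> topspace Z \<Longrightarrow> \<gamma> z 0 = f (y z)"
  shows "continuous_map (prod_topology Z unit_interval) E
      (\<lambda>p. L (y (fst p), restrict (\<gamma> (fst p)) {0..1}) (snd p))"
    and "\<And>z. z \<in> topspace Z \<Longrightarrow> L (y z, restrict (\<gamma> z) {0..1}) 0 = y z"
    and "\<And>z t. z \<in> topspace Z \<Longrightarrow> t \<in> {0..1} \<Longrightarrow> f (L (y z, restrict (\<gamma> z) {0..1}) t) = \<gamma> z t"
proof -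
  let ?h = "\<lambda>z. restrict (\<gamma> z) {0..1}"
  have h: "continuous_map Z (path_space X) ?h"
    using continuous_map_into_path_space[OF \<gamma>] by simp
  have d: "continuous_map Z (lifting_domain E X f) (\<lambda>z. (y z, ?h z))"
    unfolding lifting_domain_def continuous_map_in_subtopology
    using y h start by (auto intro!: continuous_map_pairedI)
  have Ld: "continuous_map Z (path_space E) (\<lambda>z. L (y z, ?h z))"
    using continuous_map_comp[OF d, of "path_space E" L] L by (simp add: lifting_function_def)
  have "continuous_map (prod_topology Z unit_interval) (prod_topology (path_space E) unit_interval)
          (\<lambda>p. (L (y (fst p), ?h (fst p)), snd p))"
    by (rule continuous_map_pairedI continuous_map_snd continuous_map_comp[OF continuous_map_fst Ld])+
  from continuous_map_comp[OF this continuous_map_path_eval]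
  show "continuous_map (prod_topology Z unit_interval) E (\<lambda>p. L (y (fst p), ?h (fst p)) (snd p))"
    by simp
  fix z assume z: "z \<in> topspace Z"
  then have "(y z, ?h z) \<in> topspace (lifting_domain E X f)"
    using d by (auto simp: continuous_map_def)
  then have "L (y z, ?h z) 0 = y z \<and> (\<forall>t\<in>{0..1}. f (L (y z, ?h z) t) = ?h z t)"
    using L by (auto simp: lifting_function_def)
  then show "L (y z, ?h z) 0 = y z" "\<And>t. t \<in> {0..1} \<Longrightarrow> f (L (y z, ?h z) t) = \<gamma> z t" by auto
qed

lemma transport_fiber_map:
  assumes "lifting_function E X f L" and "continuous_map Z E y"
    and "continuous_map (prod_topology Z unit_interval) X (\<lambda>p. \<gamma> (fst p) (snd p))"
    and "\<And>z. z \<in> topspace Z \<Longrightarrow> \<gamma> z 0 = f (y z)"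
  shows "fiber_map Z (\<lambda>z. \<gamma> z 1) E f (\<lambda>z. transport L (y z) (\<gamma> z))"
proof -
  note lift = lift_continuous[OF assms]
  have "continuous_map Z (prod_topology Z unit_interval) (\<lambda>z. (z, 1))"
    by (intro continuous_map_pairedI) auto
  from continuous_map_comp[OF this lift(1)] lift(3) show ?thesis
    by (auto simp: fiber_map_def over_base_def transport_def)
qed

lemmas transport_continuous = transport_fiber_map[unfolded fiber_map_def, THEN conjunct1]
lemmas transport_over = transport_fiber_map[unfolded fiber_map_def over_base_def, THEN conjunct2, rule_format]

text \<open>
  Follow the given lift up to time \<open>1 - s\<close> and then transport along the rest of the path. At \<open>s = 0\<close>
  the rest is constant, and at \<open>s = 1\<close> it is the whole path.
\<close>
lemma lift_end_homotopic_transport: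
  assumes M: "regular_lifting_function E X f M" and f: "continuous_map E X f"
    and G: "continuous_map (prod_topology Z unit_interval) E (\<lambda>p. G (fst p) (snd p))"
  shows "fiber_homotopic Z (\<lambda>z. f (G z 1)) E f
    (\<lambda>z. G z 1) (\<lambda>z. transport M (G z 0) (\<lambda>t. f (G z t)))"
proof -
  have M': "lifting_function E X f M" using M by (simp add: regular_lifting_function_def)
  \<comment> \<open>the part of the path from time \<open>1 - s\<close> on, reparametrized to the unit interval\<close>
  define \<gamma> where "\<gamma> = (\<lambda>(s, z) t. f (G z (1 - s * (1 - t))))"
  let ?y = "\<lambda>p. G (snd p) (1 - fst p)"
  have u: "continuous_map (prod_topology (prod_topology unit_interval Z) unit_interval) unit_interval
       (\<lambda>p. 1 - fst (fst p) * (1 - snd p))"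
    by (rule continuous_map_unit_intervalI,
        (rule continuous_map_real_intros continuous_map_proj_intros)+)
       (auto simp: mult_unit_interval)
  have y: "continuous_map (prod_topology unit_interval Z) E ?y"
  proof -
    have "continuous_map (prod_topology unit_interval Z) (prod_topology Z unit_interval)
        (\<lambda>p. (snd p, 1 - fst p))"
      by (intro continuous_map_pairedI continuous_map_snd continuous_map_unit_intervalI)
         ((rule continuous_map_real_intros continuous_map_proj_intros)+, auto)
    from continuous_map_comp[OF this G] show ?thesis by simp
  qed
  have \<gamma>: "continuous_map (prod_topology (prod_topology unit_interval Z) unit_interval) X
      (\<lambda>p. \<gamma> (fst p) (snd p))"
  proof -
    have "continuous_map (prod_topology (prod_topology unit_interval Z) unit_interval)
        (prod_topology Z unit_interval) (\<lambda>p. (snd (fst p), 1 - fst (fst p) * (1 - snd p)))"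
      by (rule u continuous_map_proj_intros)+
    from continuous_map_comp[OF continuous_map_comp[OF this G] f]
    show ?thesis by (simp add: \<gamma>_def case_prod_beta)
  qed
  have start: "\<gamma> p 0 = f (?y p)" if "p \<in> topspace (prod_topology unit_interval Z)" for p
    by (simp add: \<gamma>_def case_prod_beta)
  show ?thesis
  proof (rule fiber_homotopicI[OF transport_continuous[OF M' y \<gamma> start]])
    fix z assume z: "z \<in> topspace Z"
    have "(0, z) \<in> topspace (prod_topology unit_interval Z)" using z by simp
    then have "?y (0, z) \<in> topspace E"
      using continuous_map_image_subset_topspace[OF y] by blast
    then show "transport M (?y (0, z)) (\<gamma> (0, z)) = G z 1"
      using transport_const[OF M, of "?y (0, z)" "\<gamma> (0, z)"] by (simp add: \<gamma>_def)
    show "transport M (?y (1, z)) (\<gamma> (1, z)) = transport M (G z 0) (\<lambda>t. f (G z t))"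
      by (simp add: \<gamma>_def)
  next
    fix t :: real and z assume "t \<in> {0..1}" "z \<in> topspace Z"
    then show "f (transport M (?y (t, z)) (\<gamma> (t, z))) = f (G z 1)"
      using transport_over[OF M' y \<gamma> start, of "(t, z)"] by (simp add: \<gamma>_def)
  qed
qed

text \<open>
  Both ends are homotopic to the same transport.
\<close>
lemma lift_ends_homotopic:
  assumes M: "regular_lifting_function E X f M" and f: "continuous_map E X f"
    and G: "continuous_map (prod_topology Z unit_interval) E (\<lambda>p. G (fst p) (snd p))"
    and G': "continuous_map (prod_topology Z unit_interval) E (\<lambda>p. G' (fst p) (snd p))"
    and start: "\<And>z. z \<in> topspace Z \<Longrightarrow> G z 0 = G' z 0"
    and same: "\<And>z t. z \<in> topspace Z \<Longrightarrow> t \<in> {0..1} \<Longrightarrow> f (G z t) = f (G' z t)"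
  shows "fiber_homotopic Z (\<lambda>z. f (G z 1)) E f (\<lambda>z. G z 1) (\<lambda>z. G' z 1)"
proof -
  have "transport M (G z 0) (\<lambda>t. f (G z t)) = transport M (G' z 0) (\<lambda>t. f (G' z t))"
    if "z \<in> topspace Z" for z
    using start[OF that] same[OF that] by (metis transport_cong)
  with fiber_homotopic_cong[OF lift_end_homotopic_transport[OF M f G'],
      of "\<lambda>z. f (G z 1)" "\<lambda>z. G' z 1" "\<lambda>z. transport M (G z 0) (\<lambda>t. f (G z t))"] same
  have "fiber_homotopic Z (\<lambda>z. f (G z 1)) E f
    (\<lambda>z. G' z 1) (\<lambda>z. transport M (G z 0) (\<lambda>t. f (G z t)))" by simp
  from fiber_homotopic_trans[OF lift_end_homotopic_transport[OF M f G] fiber_homotopic_sym[OF this]]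
  show ?thesis .
qed

lemma transport_independent:
  assumes M: "regular_lifting_function E X f M" and f: "continuous_map E X f"
    and L: "lifting_function E X f L" and y: "continuous_map Z E y"
    and \<gamma>: "continuous_map (prod_topology Z unit_interval) X (\<lambda>p. \<gamma> (fst p) (snd p))"
    and start: "\<And>z. z \<in> topspace Z \<Longrightarrow> \<gamma> z 0 = f (y z)"
  shows "fiber_homotopic Z (\<lambda>z. \<gamma> z 1) E f
    (\<lambda>z. transport L (y z) (\<gamma> z)) (\<lambda>z. transport M (y z) (\<gamma> z))"
proof -
  have M': "lifting_function E X f M" using M by (simp add: regular_lifting_function_def)
  note L = lift_continuous[OF L y \<gamma> start] and M' = lift_continuous[OF M' y \<gamma> start]
  show ?thesis
    unfolding transport_def
    by (rule fiber_homotopic_cong[OF lift_ends_homotopic[OF M f L(1) M'(1)]])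
       (simp_all only: L(2,3) M'(2,3) atLeastAtMost_iff order.refl zero_le_one simp_thms)
qed

lemma transport_homotopic_start:
  assumes L: "lifting_function E X f L" and ab: "fiber_homotopic Z \<pi> E f a b"
    and \<gamma>: "continuous_map (prod_topology Z unit_interval) X (\<lambda>p. \<gamma> (fst p) (snd p))"
    and start: "\<And>z. z \<in> topspace Z \<Longrightarrow> \<gamma> z 0 = \<pi> z"
  shows "fiber_homotopic Z (\<lambda>z. \<gamma> z 1) E f
    (\<lambda>z. transport L (a z) (\<gamma> z)) (\<lambda>z. transport L (b z) (\<gamma> z))"
proof -
  obtain H where H: "continuous_map (prod_topology unit_interval Z) E H"
    and H01: "\<And>z. H (0, z) = a z" "\<And>z. H (1, z) = b z"
    and fH: "\<And>t z. t \<in> {0..1} \<Longrightarrow> z \<in> topspace Z \<Longrightarrow> f (H (t, z)) = \<pi> z"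
    using fiber_homotopicE[OF ab] by blast
  have "continuous_map (prod_topology (prod_topology unit_interval Z) unit_interval)
        (prod_topology Z unit_interval) (\<lambda>p. (snd (fst p), snd p))"
    by (rule continuous_map_proj_intros)+
  from continuous_map_comp[OF this \<gamma>]
  have \<gamma>': "continuous_map (prod_topology (prod_topology unit_interval Z) unit_interval) X
      (\<lambda>p. (\<lambda>q. \<gamma> (snd q)) (fst p) (snd p))" by simp
  have start': "(\<lambda>q. \<gamma> (snd q)) p 0 = f (H p)" if "p \<in> topspace (prod_topology unit_interval Z)" for p
    using that start fH by auto
  show ?thesis
    using transport_over[OF L H \<gamma>' start'] H01
    by (intro fiber_homotopicI[OF transport_continuous[OF L H \<gamma>' start']]) auto
qed

text \<open>
  Go forth and back along the initial part of the path only, and shrink that part to a point.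
\<close>
lemma transport_back_homotopic_id:
  assumes M: "regular_lifting_function E X f M" and y: "continuous_map Z E y"
    and \<gamma>: "continuous_map (prod_topology Z unit_interval) X (\<lambda>p. \<gamma> (fst p) (snd p))"
    and start: "\<And>z. z \<in> topspace Z \<Longrightarrow> \<gamma> z 0 = f (y z)"
  shows "fiber_homotopic Z (\<lambda>z. f (y z)) E f
    (\<lambda>z. transport M (transport M (y z) (\<gamma> z)) (\<lambda>t. \<gamma> z (1 - t))) y"
proof -
  have M': "lifting_function E X f M" using M by (simp add: regular_lifting_function_def)
  let ?W = "prod_topology unit_interval Z"
  define \<delta> where "\<delta> = (\<lambda>(s, z) t. \<gamma> z (s * t))"
  define \<epsilon> where "\<epsilon> = (\<lambda>(s, z) t. \<gamma> z (s * (1 - t)))"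
  let ?y = "\<lambda>p. y (snd p)"
  have cy: "continuous_map ?W E ?y" by (rule continuous_map_comp[OF continuous_map_snd y])
  have u: "continuous_map (prod_topology ?W unit_interval) unit_interval (\<lambda>p. fst (fst p) * snd p)"
    by (rule continuous_map_unit_intervalI,
        (rule continuous_map_real_intros continuous_map_proj_intros)+)
       (auto simp: mult_unit_interval)
  have v: "continuous_map (prod_topology ?W unit_interval) unit_interval (\<lambda>p. fst (fst p) * (1 - snd p))"
    by (rule continuous_map_unit_intervalI,
        (rule continuous_map_real_intros continuous_map_proj_intros)+)
       (auto simp: mult_unit_interval)
  have \<delta>: "continuous_map (prod_topology ?W unit_interval) X (\<lambda>p. \<delta> (fst p) (snd p))"
  proof -
    have "continuous_map (prod_topology ?W unit_interval)
        (prod_topology Z unit_interval) (\<lambda>p. (snd (fst p), fst (fst p) * snd p))"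
      by (rule u continuous_map_proj_intros)+
    from continuous_map_comp[OF this \<gamma>] show ?thesis by (simp add: \<delta>_def case_prod_beta)
  qed
  have \<epsilon>: "continuous_map (prod_topology ?W unit_interval) X (\<lambda>p. \<epsilon> (fst p) (snd p))"
  proof -
    have "continuous_map (prod_topology ?W unit_interval)
        (prod_topology Z unit_interval) (\<lambda>p. (snd (fst p), fst (fst p) * (1 - snd p)))"
      by (rule v continuous_map_proj_intros)+
    from continuous_map_comp[OF this \<gamma>] show ?thesis by (simp add: \<epsilon>_def case_prod_beta)
  qed
  have start1: "\<delta> p 0 = f (?y p)" if "p \<in> topspace ?W" for p
    using that start by (auto simp: \<delta>_def)
  let ?x = "\<lambda>p. transport M (?y p) (\<delta> p)"
  have cx: "continuous_map ?W E ?x" by (rule transport_continuous[OF M' cy \<delta> start1])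
  have fx: "f (?x p) = \<delta> p 1" if "p \<in> topspace ?W" for p
    by (rule transport_over[OF M' cy \<delta> start1 that])
  have start2: "\<epsilon> p 0 = f (?x p)" if "p \<in> topspace ?W" for p
    using fx[OF that] by (simp add: \<delta>_def \<epsilon>_def case_prod_beta)
  have ye: "y z \<in> topspace E" if "z \<in> topspace Z" for z
    using continuous_map_image_subset_topspace[OF y] that by blast
  show ?thesis
  proof (rule fiber_homotopic_sym, rule fiber_homotopicI[OF transport_continuous[OF M' cx \<epsilon> start2]])
    fix z assume z: "z \<in> topspace Z"
    have "?x (0, z) = y z"
      using transport_const[OF M ye[OF z], of "\<delta> (0, z)"] start[OF z] by (simp add: \<delta>_def)
    then show "transport M (?x (0, z)) (\<epsilon> (0, z)) = y z"
      using transport_const[OF M ye[OF z], of "\<epsilon> (0, z)"] start[OF z] by (simp add: \<epsilon>_def)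
    show "transport M (?x (1, z)) (\<epsilon> (1, z)) =
        transport M (transport M (y z) (\<gamma> z)) (\<lambda>t. \<gamma> z (1 - t))"
      by (simp add: \<delta>_def \<epsilon>_def)
  next
    fix t :: real and z assume "t \<in> {0..1}" "z \<in> topspace Z"
    then show "f (transport M (?x (t, z)) (\<epsilon> (t, z))) = f (y z)"
      using transport_over[OF M' cx \<epsilon> start2, of "(t, z)"] start by (simp add: \<epsilon>_def)
  qed
qed

text \<open>
  Concatenation of paths in a space that is a topology rather than a type of a topological class.
\<close>
definition path_concat :: "(real \<Rightarrow> 'b) \<Rightarrow> (real \<Rightarrow> 'b) \<Rightarrow> real \<Rightarrow> 'b"
  where "path_concat \<alpha> \<beta> t = (if t \<le> 1/2 then \<alpha> (2 * t) else \<beta> (2 * t - 1))"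

lemma path_concat_continuous:
  assumes \<alpha>: "continuous_map (prod_topology Z unit_interval) X (\<lambda>p. \<alpha> (fst p) (snd p))"
    and \<beta>: "continuous_map (prod_topology Z unit_interval) X (\<lambda>p. \<beta> (fst p) (snd p))"
    and meet: "\<And>z. z \<in> topspace Z \<Longrightarrow> \<alpha> z 1 = \<beta> z 0"
  shows "continuous_map (prod_topology Z unit_interval) X
    (\<lambda>p. path_concat (\<alpha> (fst p)) (\<beta> (fst p)) (snd p))"
  unfolding path_concat_def
proof -
  let ?W = "prod_topology Z unit_interval"
  have s: "continuous_map ?W euclideanreal snd"
    by (rule continuous_map_into_fulltopology[OF continuous_map_snd])
  show "continuous_map ?W X (\<lambda>p. if snd p \<le> 1/2 then \<alpha> (fst p) (2 * snd p) else \<beta> (fst p) (2 * snd p - 1))"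
  proof (rule continuous_map_cases_le[OF s])
    let ?S = "subtopology ?W {p \<in> topspace ?W. snd p \<le> 1 / 2}"
    have "continuous_map ?S unit_interval (\<lambda>p. 2 * snd p)"
      by (intro continuous_map_unit_intervalI continuous_map_real_mult_left
          continuous_map_from_subtopology s) auto
    then have "continuous_map ?S ?W (\<lambda>p. (fst p, 2 * snd p))"
      by (rule continuous_map_pairedI[OF continuous_map_from_subtopology[OF continuous_map_fst]])
    from continuous_map_comp[OF this \<alpha>]
    show "continuous_map ?S X (\<lambda>p. \<alpha> (fst p) (2 * snd p))" by simp
  next
    let ?S = "subtopology ?W {p \<in> topspace ?W. 1 / 2 \<le> snd p}"
    have "continuous_map ?S unit_interval (\<lambda>p. 2 * snd p - 1)"
      by (intro continuous_map_unit_intervalI continuous_map_diff continuous_map_real_mult_left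
          continuous_map_from_subtopology s) auto
    then have "continuous_map ?S ?W (\<lambda>p. (fst p, 2 * snd p - 1))"
      by (rule continuous_map_pairedI[OF continuous_map_from_subtopology[OF continuous_map_fst]])
    from continuous_map_comp[OF this \<beta>]
    show "continuous_map ?S X (\<lambda>p. \<beta> (fst p) (2 * snd p - 1))" by simp
  next
    fix p assume p: "p \<in> topspace ?W" and half: "snd p = 1 / 2"
    have "2 * snd p = 1" "2 * snd p - 1 = 0" using half by simp_all
    then show "\<alpha> (fst p) (2 * snd p) = \<beta> (fst p) (2 * snd p - 1)"
      using meet p by auto
  qed simp
qed

text \<open>
  Following the two lifts in succession is a lift of the concatenated path. The lifting functions on
  the two sides may differ, because only ends of lifts with the same start are compared.
\<close>
lemma transport_concat:
  assumes M: "regular_lifting_function E X f M" and f: "continuous_map E X f"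
    and L: "lifting_function E X f L" and y: "continuous_map Z E y"
    and \<alpha>: "continuous_map (prod_topology Z unit_interval) X (\<lambda>p. \<alpha> (fst p) (snd p))"
    and \<beta>: "continuous_map (prod_topology Z unit_interval) X (\<lambda>p. \<beta> (fst p) (snd p))"
    and start: "\<And>z. z \<in> topspace Z \<Longrightarrow> \<alpha> z 0 = f (y z)"
    and meet: "\<And>z. z \<in> topspace Z \<Longrightarrow> \<alpha> z 1 = \<beta> z 0"
  shows "fiber_homotopic Z (\<lambda>z. \<beta> z 1) E f
    (\<lambda>z. transport L (y z) (path_concat (\<alpha> z) (\<beta> z)))
    (\<lambda>z. transport M (transport M (y z) (\<alpha> z)) (\<beta> z))"
proof -
  have M': "lifting_function E X f M" using M by (simp add: regular_lifting_function_def)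
  have start': "path_concat (\<alpha> z) (\<beta> z) 0 = f (y z)" if "z \<in> topspace Z" for z
    using start[OF that] by (simp add: path_concat_def)
  have G: "continuous_map (prod_topology Z unit_interval) E
      (\<lambda>p. L (y (fst p), restrict (path_concat (\<alpha> (fst p)) (\<beta> (fst p))) {0..1}) (snd p))"
    "\<And>z. z \<in> topspace Z \<Longrightarrow> L (y z, restrict (path_concat (\<alpha> z) (\<beta> z)) {0..1}) 0 = y z"
    "\<And>z t. z \<in> topspace Z \<Longrightarrow> t \<in> {0..1} \<Longrightarrow>
      f (L (y z, restrict (path_concat (\<alpha> z) (\<beta> z)) {0..1}) t) = path_concat (\<alpha> z) (\<beta> z) t"
    by (rule lift_continuous[OF L y path_concat_continuous[OF \<alpha> \<beta> meet] start']; assumption)+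
  let ?x = "\<lambda>z. transport M (y z) (\<alpha> z)"
  let ?a = "\<lambda>z. M (y z, restrict (\<alpha> z) {0..1})" and ?b = "\<lambda>z. M (?x z, restrict (\<beta> z) {0..1})"
  have A: "continuous_map (prod_topology Z unit_interval) E (\<lambda>p. ?a (fst p) (snd p))"
    "\<And>z. z \<in> topspace Z \<Longrightarrow> ?a z 0 = y z"
    "\<And>z t. z \<in> topspace Z \<Longrightarrow> t \<in> {0..1} \<Longrightarrow> f (?a z t) = \<alpha> z t"
    by (rule lift_continuous[OF M' y \<alpha> start]; assumption)+
  have x: "continuous_map Z E ?x" by (rule transport_continuous[OF M' y \<alpha> start])
  have fx: "\<beta> z 0 = f (?x z)" if "z \<in> topspace Z" for z
    using transport_over[OF M' y \<alpha> start that] meet[OF that] by simp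
  have B: "continuous_map (prod_topology Z unit_interval) E (\<lambda>p. ?b (fst p) (snd p))"
    "\<And>z. z \<in> topspace Z \<Longrightarrow> ?b z 0 = ?x z"
    "\<And>z t. z \<in> topspace Z \<Longrightarrow> t \<in> {0..1} \<Longrightarrow> f (?b z t) = \<beta> z t"
    by (rule lift_continuous[OF M' x \<beta> fx]; assumption)+
  have AB: "?a z 1 = ?b z 0" if "z \<in> topspace Z" for z
    unfolding B(2)[OF that] by (simp add: transport_def)
  note G' = path_concat_continuous[OF A(1) B(1) AB]
  have "fiber_homotopic Z (\<lambda>z. f (L (y z, restrict (path_concat (\<alpha> z) (\<beta> z)) {0..1}) 1)) E f
      (\<lambda>z. L (y z, restrict (path_concat (\<alpha> z) (\<beta> z)) {0..1}) 1) (\<lambda>z. path_concat (?a z) (?b z) 1)"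
  proof (rule lift_ends_homotopic[OF M f G(1) G'])
    fix z assume z: "z \<in> topspace Z"
    have "path_concat (?a z) (?b z) 0 = y z"
      unfolding path_concat_def by (simp add: A(2)[OF z] del: restrict_apply)
    then show "L (y z, restrict (path_concat (\<alpha> z) (\<beta> z)) {0..1}) 0 = path_concat (?a z) (?b z) 0"
      unfolding G(2)[OF z] by (rule sym)
    fix t :: real assume t: "t \<in> {0..1}"
    have "f (path_concat (?a z) (?b z) t) = path_concat (\<alpha> z) (\<beta> z) t"
      using A(3)[OF z, of "2 * t"] B(3)[OF z, of "2 * t - 1"] t
      unfolding path_concat_def by (cases "t \<le> 1/2") (simp_all del: restrict_apply)
    then show "f (L (y z, restrict (path_concat (\<alpha> z) (\<beta> z)) {0..1}) t) = f (path_concat (?a z) (?b z) t)"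
      unfolding G(3)[OF z t] by (rule sym)
  qed
  then show ?thesis
  proof (rule fiber_homotopic_cong)
    fix z assume z: "z \<in> topspace Z"
    show "f (L (y z, restrict (path_concat (\<alpha> z) (\<beta> z)) {0..1}) 1) = \<beta> z 1"
      unfolding G(3)[OF z, of 1, simplified] by (simp add: path_concat_def)
    show "path_concat (?a z) (?b z) 1 = transport M (?x z) (\<beta> z)"
      by (simp add: path_concat_def transport_def del: restrict_apply)
  qed (simp add: transport_def)
qed

lemma transport_restrict: "transport L e (restrict \<gamma> {0..1}) = transport L e \<gamma>"
  by (rule transport_cong) simp

section \<open>Neighbourhood deformations and vertical homotopy extension\<close>

text \<open>
  Data exhibiting \<open>A\<close> as a closed cofibration in \<open>Z\<close>, in the form due to Strom: the map
  \<open>(z, t) \<mapsto> (D (z, t), max 0 (t - u z))\<close> retracts \<open>Z \<times> I\<close> onto \<open>Z \<times> {0} \<union> A \<times> I\<close>.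
\<close>
definition ndr_data :: "'a topology \<Rightarrow> 'a set \<Rightarrow> ('a \<times> real \<Rightarrow> 'a) \<Rightarrow> ('a \<Rightarrow> real) \<Rightarrow> bool"
  where "ndr_data Z A D u \<longleftrightarrow>
    closedin Z A \<and> continuous_map (prod_topology Z unit_interval) Z D \<and>
    continuous_map Z euclideanreal u \<and>
    (\<forall>z \<in> topspace Z. D (z, 0) = z \<and> 0 \<le> u z) \<and>
    (\<forall>z \<in> A. u z = 0 \<and> (\<forall>t \<in> {0..1}. D (z, t) = z)) \<and>
    (\<forall>z \<in> topspace Z. \<forall>t \<in> {0..1}. u z \<le> t \<longrightarrow> D (z, t) \<in> A)"

lemma ndr_data_subtopology:
  assumes N: "ndr_data X A D u" and B: "B \<subseteq> topspace X"
    and pres: "\<And>x t. x \<in> B \<Longrightarrow> t \<in> {0..1} \<Longrightarrow> D (x, t) \<in> B"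
  shows "ndr_data (subtopology X B) (B \<inter> A) D u"
proof -
  have "continuous_map (subtopology (prod_topology X unit_interval) (B \<times> {0..1})) X D"
    using N by (simp add: ndr_data_def continuous_map_from_subtopology)
  then have "continuous_map (prod_topology (subtopology X B) unit_interval) X D"
    by (simp add: subtopology_Times subtopology_subtopology)
  then have "continuous_map (prod_topology (subtopology X B) unit_interval) (subtopology X B) D"
    by (rule continuous_map_into_subtopology) (use pres in auto)
  moreover have "closedin (subtopology X B) (B \<inter> A)"
    using N by (simp add: ndr_data_def closedin_subtopology_Int_closed)
  moreover have "continuous_map (subtopology X B) euclideanreal u"
    using N by (simp add: ndr_data_def continuous_map_from_subtopology)
  ultimately show ?thesis
    using N B pres unfolding ndr_data_def by (auto simp: subset_iff)
qed

lemma ndr_data_homeomorphic: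
  assumes h: "homeomorphic_maps T X \<phi> \<psi>" and N: "ndr_data T A D u"
  shows "ndr_data X (\<phi> ` A) (\<lambda>(x, t). \<phi> (D (\<psi> x, t))) (\<lambda>x. u (\<psi> x))"
proof -
  have c: "continuous_map T X \<phi>" "continuous_map X T \<psi>"
    and inv: "\<And>x. x \<in> topspace T \<Longrightarrow> \<psi> (\<phi> x) = x" "\<And>y. y \<in> topspace X \<Longrightarrow> \<phi> (\<psi> y) = y"
    using h by (auto simp: homeomorphic_maps_def)
  have A: "closedin T A" and D: "continuous_map (prod_topology T unit_interval) T D"
    and u: "continuous_map T euclideanreal u"
    using N by (auto simp: ndr_data_def)
  have \<psi>T: "\<And>x. x \<in> topspace X \<Longrightarrow> \<psi> x \<in> topspace T"
    using continuous_map_image_subset_topspace[OF c(2)] by blast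
  have AT: "\<And>a. a \<in> A \<Longrightarrow> a \<in> topspace T" using closedin_subset[OF A] by blast
  have "continuous_map (prod_topology X unit_interval) (prod_topology T unit_interval) (\<lambda>p. (\<psi> (fst p), snd p))"
    by (rule continuous_map_pairedI continuous_map_snd continuous_map_comp[OF continuous_map_fst c(2)])+
  from continuous_map_comp[OF continuous_map_comp[OF this D] c(1)]
  have "continuous_map (prod_topology X unit_interval) X (\<lambda>(x, t). \<phi> (D (\<psi> x, t)))"
    by (simp add: case_prod_unfold)
  moreover have "closedin X (\<phi> ` A)"
    using A homeomorphic_map_closedness_eq[OF homeomorphic_maps_map[THEN iffD1, OF h, THEN conjunct1]] by blast
  ultimately show ?thesis
    using N inv \<psi>T AT continuous_map_comp[OF c(2) u] by (auto simp: ndr_data_def)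
qed

text \<open>
  The deformation of the base lifts by transport along its tracks. A regular lifting function keeps
  the points over \<open>A\<close> fixed.
\<close>
lemma ndr_data_total_space:
  assumes N: "ndr_data (subtopology X B) A D u"
    and M: "regular_lifting_function E X f M" and f: "continuous_map E X f"
  shows "ndr_data (over E f B) {e \<in> topspace E. f e \<in> A}
    (\<lambda>(e, t). transport M e (\<lambda>s. D (f e, t * s))) (\<lambda>e. u (f e))"
proof -
  have M': "lifting_function E X f M" using M by (simp add: regular_lifting_function_def)
  have A: "closedin (subtopology X B) A"
    and D: "continuous_map (prod_topology (subtopology X B) unit_interval) (subtopology X B) D"
    and u: "continuous_map (subtopology X B) euclideanreal u"
    using N by (auto simp: ndr_data_def)
  have AB: "A \<subseteq> topspace X \<inter> B" using closedin_subset[OF A] by simp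
  have fB: "continuous_map (over E f B) (subtopology X B) f"
    by (intro continuous_map_into_subtopology continuous_map_from_subtopology f) auto
  let ?W = "prod_topology (over E f B) unit_interval"
  define \<gamma> where "\<gamma> = (\<lambda>(e, t) s. D (f e, t * s))"
  have "continuous_map (prod_topology ?W unit_interval) unit_interval (\<lambda>p. snd (fst p) * snd p)"
    by (rule continuous_map_unit_intervalI,
        (rule continuous_map_real_intros continuous_map_proj_intros)+)
       (auto simp: mult_unit_interval)
  then have "continuous_map (prod_topology ?W unit_interval) (prod_topology (subtopology X B) unit_interval)
      (\<lambda>p. (f (fst (fst p)), snd (fst p) * snd p))"
    by (intro continuous_map_pairedI continuous_map_comp[OF _ fB])
       (rule continuous_map_proj_intros)+
  from continuous_map_comp[OF this D]
  have \<gamma>: "continuous_map (prod_topology ?W unit_interval) X (\<lambda>p. \<gamma> (fst p) (snd p))"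
    by (auto simp: \<gamma>_def case_prod_beta intro: continuous_map_into_fulltopology)
  have y: "continuous_map ?W E fst"
    by (rule continuous_map_into_fulltopology[OF continuous_map_fst])
  have D0: "D (x, 0) = x" "0 \<le> u x" if "x \<in> topspace X" "x \<in> B" for x
    using N that by (auto simp: ndr_data_def)
  have fX: "f e \<in> topspace X" if "e \<in> topspace E" for e
    using continuous_map_image_subset_topspace[OF f] that by blast
  have start: "\<gamma> p 0 = f (fst p)" if "p \<in> topspace ?W" for p
    using that D0 fX by (auto simp: \<gamma>_def)
  have over: "f (transport M e (\<gamma> (e, t))) = D (f e, t)"
    if "e \<in> topspace E" "f e \<in> B" "t \<in> {0..1}" for e t
    using transport_over[OF M' y \<gamma> start, of "(e, t)"] that by (simp add: \<gamma>_def)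
  have DB: "D (x, t) \<in> B" if "x \<in> topspace X" "x \<in> B" "t \<in> {0..1}" for x t
    using continuous_map_image_subset_topspace[OF D] that by (auto simp: image_subset_iff)
  have in_E: "transport M e (\<gamma> (e, t)) \<in> topspace E"
    if "e \<in> topspace E" "f e \<in> B" "t \<in> {0..1}" for e t
    using continuous_map_image_subset_topspace[OF transport_continuous[OF M' y \<gamma> start]] that
    by (auto simp: image_subset_iff)
  have eq: "(\<lambda>(e, t). transport M e (\<lambda>s. D (f e, t * s))) = (\<lambda>p. transport M (fst p) (\<gamma> p))"
    by (auto simp: \<gamma>_def)
  show ?thesis
    unfolding ndr_data_def
  proof (intro conjI ballI impI)
    have "closedin (over E f B) {e \<in> topspace (over E f B). f e \<in> A}"
      using fB A by (rule closedin_continuous_map_preimage)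
    also have "{e \<in> topspace (over E f B). f e \<in> A} = {e \<in> topspace E. f e \<in> A}"
      using AB by auto
    finally show "closedin (over E f B) {e \<in> topspace E. f e \<in> A}" .
    have "(\<lambda>p. transport M (fst p) (\<gamma> p)) \<in> topspace ?W \<rightarrow> {e. f e \<in> B}"
      using over DB fX by auto
    then show "continuous_map ?W (over E f B) (\<lambda>(e, t). transport M e (\<lambda>s. D (f e, t * s)))"
      unfolding eq
      by (intro continuous_map_into_subtopology transport_continuous[OF M' y \<gamma> start])
    show "continuous_map (over E f B) euclideanreal (\<lambda>e. u (f e))"
      by (rule continuous_map_comp[OF fB u])
  next
    fix e assume "e \<in> topspace (over E f B)"
    then have e: "e \<in> topspace E" "f e \<in> B" by auto
    show "(case (e, 0) of (e, t) \<Rightarrow> transport M e (\<lambda>s. D (f e, t * s))) = e"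
      using transport_const[OF M e(1)] D0 fX e by simp
    show "0 \<le> u (f e)" using D0 fX e by simp
    fix t :: real assume t: "t \<in> {0..1}" "u (f e) \<le> t"
    then have "D (f e, t) \<in> A" using N e fX by (auto simp: ndr_data_def)
    then show "(case (e, t) of (e, t) \<Rightarrow> transport M e (\<lambda>s. D (f e, t * s))) \<in> {e \<in> topspace E. f e \<in> A}"
      using over[OF e t(1)] in_E[OF e t(1)] by (simp add: \<gamma>_def)
  next
    fix e assume e: "e \<in> {e \<in> topspace E. f e \<in> A}"
    then show "u (f e) = 0" using N by (simp add: ndr_data_def)
    fix t :: real assume t: "t \<in> {0..1}"
    have "D (f e, t * s) = f e" if "s \<in> {0..1}" for s
      using N e t that mult_unit_interval[of t s] by (auto simp: ndr_data_def)
    then show "(case (e, t) of (e, t) \<Rightarrow> transport M e (\<lambda>s. D (f e, t * s))) = e"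
      using transport_const[OF M, of e] e by simp
  qed
qed

lemma ndr_data_prod:
  assumes N: "ndr_data Z A D u"
  shows "ndr_data (prod_topology unit_interval Z) ({0..1} \<times> A)
    (\<lambda>(p, t). (fst p, D (snd p, t))) (\<lambda>p. u (snd p))"
proof -
  have D: "continuous_map (prod_topology Z unit_interval) Z D" and A: "closedin Z A"
    and u: "continuous_map Z euclideanreal u"
    using N by (auto simp: ndr_data_def)
  have "continuous_map (prod_topology (prod_topology unit_interval Z) unit_interval)
      (prod_topology unit_interval Z) (\<lambda>q. (fst (fst q), D (snd (fst q), snd q)))"
    by (intro continuous_map_pairedI continuous_map_comp[OF _ D])
       (rule continuous_map_proj_intros)+
  moreover have "closedin (prod_topology unit_interval Z) ({0..1} \<times> A)"
    using A by (simp add: closedin_prod_Times_iff)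
  ultimately show ?thesis
    using N continuous_map_comp[OF continuous_map_snd u]
    by (auto simp: ndr_data_def case_prod_unfold)
qed

text \<open>
  Extending \<open>k\<close> and \<open>h\<close> through the retraction of \<open>Z \<times> I\<close> onto \<open>Z \<times> {0} \<union> A \<times> I\<close> gives a homotopy
  that need not be vertical: its value at \<open>(t, z)\<close> lies over the image of \<open>D (z, t)\<close> instead of that of
  \<open>z\<close>. Transport along the track of \<open>D\<close>, run backwards, corrects this; where the track is constant,
  at \<open>t = 0\<close> and over \<open>A\<close>, a regular lifting function changes nothing.
\<close>
proposition vertical_homotopy_extension:
  assumes N: "ndr_data Z A D u"
    and M: "regular_lifting_function E X f M" and f: "continuous_map E X f"
    and k: "continuous_map Z E k"
    and h: "continuous_map (prod_topology unit_interval (subtopology Z A)) E h"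
    and h0: "\<And>a. a \<in> A \<Longrightarrow> h (0, a) = k a"
    and fh: "\<And>t a. t \<in> {0..1} \<Longrightarrow> a \<in> A \<Longrightarrow> f (h (t, a)) = f (k a)"
  obtains H where "continuous_map (prod_topology unit_interval Z) E H"
    and "\<And>z. z \<in> topspace Z \<Longrightarrow> H (0, z) = k z"
    and "\<And>t a. t \<in> {0..1} \<Longrightarrow> a \<in> A \<Longrightarrow> H (t, a) = h (t, a)"
    and "\<And>t z. t \<in> {0..1} \<Longrightarrow> z \<in> topspace Z \<Longrightarrow> f (H (t, z)) = f (k z)"
proof -
  have M': "lifting_function E X f M" using M by (simp add: regular_lifting_function_def)
  have D: "continuous_map (prod_topology Z unit_interval) Z D" and A: "closedin Z A"
    and u: "continuous_map Z euclideanreal u"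
    and D0: "\<And>z. z \<in> topspace Z \<Longrightarrow> D (z, 0) = z" "\<And>z. z \<in> topspace Z \<Longrightarrow> 0 \<le> u z"
    and DA: "\<And>a. a \<in> A \<Longrightarrow> u a = 0" "\<And>a t. a \<in> A \<Longrightarrow> t \<in> {0..1} \<Longrightarrow> D (a, t) = a"
    and Du: "\<And>z t. z \<in> topspace Z \<Longrightarrow> t \<in> {0..1} \<Longrightarrow> u z \<le> t \<Longrightarrow> D (z, t) \<in> A"
    using N by (auto simp: ndr_data_def)
  have AZ: "A \<subseteq> topspace Z" using closedin_subset[OF A] .
  let ?W = "prod_topology unit_interval Z"
  \<comment> \<open>the composite of \<open>k \<union> h\<close> with the retraction, and the track of \<open>D\<close> run backwards from it\<close>
  define y where "y = (\<lambda>p. if fst p \<le> u (snd p) then k (D (snd p, fst p))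
                            else h (fst p - u (snd p), D (snd p, fst p)))"
  define \<gamma> where "\<gamma> = (\<lambda>(t, z) s. f (k (D (z, t * (1 - s)))))"
  have cD: "continuous_map ?W Z (\<lambda>p. D (snd p, fst p))"
    by (rule continuous_map_comp[OF _ D]) (rule continuous_map_proj_intros)+
  have cfst: "continuous_map ?W euclideanreal fst"
    by (rule continuous_map_into_fulltopology[OF continuous_map_fst])
  have cu: "continuous_map ?W euclideanreal (\<lambda>p. u (snd p))"
    by (rule continuous_map_comp[OF continuous_map_snd u])
  have y: "continuous_map ?W E y"
    unfolding y_def
  proof (rule continuous_map_cases_le[OF cfst cu])
    show "continuous_map (subtopology ?W {p \<in> topspace ?W. fst p \<le> u (snd p)}) E (\<lambda>p. k (D (snd p, fst p)))"
      by (intro continuous_map_from_subtopology continuous_map_comp[OF cD k])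
    let ?S = "subtopology ?W {p \<in> topspace ?W. u (snd p) \<le> fst p}"
    have "continuous_map ?S unit_interval (\<lambda>p. fst p - u (snd p))"
      using D0 by (intro continuous_map_unit_intervalI continuous_map_diff
          continuous_map_from_subtopology cfst cu) fastforce
    moreover have "continuous_map ?S (subtopology Z A) (\<lambda>p. D (snd p, fst p))"
      using Du by (intro continuous_map_into_subtopology continuous_map_from_subtopology cD) auto
    ultimately have "continuous_map ?S (prod_topology unit_interval (subtopology Z A))
        (\<lambda>p. (fst p - u (snd p), D (snd p, fst p)))"
      by (rule continuous_map_pairedI)
    then show "continuous_map ?S E (\<lambda>p. h (fst p - u (snd p), D (snd p, fst p)))"
      by (rule continuous_map_comp[OF _ h])
    show "k (D (snd p, fst p)) = h (fst p - u (snd p), D (snd p, fst p))"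
      if "p \<in> topspace ?W" "fst p = u (snd p)" for p
      using that Du h0 by auto
  qed
  have "continuous_map (prod_topology ?W unit_interval) unit_interval (\<lambda>p. fst (fst p) * (1 - snd p))"
    by (rule continuous_map_unit_intervalI,
        (rule continuous_map_real_intros continuous_map_proj_intros)+)
       (auto simp: mult_unit_interval)
  then have "continuous_map (prod_topology ?W unit_interval) (prod_topology Z unit_interval)
      (\<lambda>p. (snd (fst p), fst (fst p) * (1 - snd p)))"
    by (intro continuous_map_pairedI) (rule continuous_map_proj_intros)+
  from continuous_map_comp[OF continuous_map_comp[OF continuous_map_comp[OF this D] k] f]
  have \<gamma>: "continuous_map (prod_topology ?W unit_interval) X (\<lambda>p. \<gamma> (fst p) (snd p))"
    by (simp add: \<gamma>_def case_prod_beta)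
  have start: "\<gamma> p 0 = f (y p)" if "p \<in> topspace ?W" for p
  proof -
    have "0 \<le> u (snd p)" using that D0 by auto
    then show ?thesis
      using that fh[of "fst p - u (snd p)" "D (snd p, fst p)"] Du[of "snd p" "fst p"]
      by (auto simp: \<gamma>_def y_def)
  qed
  let ?H = "\<lambda>p. transport M (y p) (\<gamma> p)"
  show ?thesis
  proof (rule that[of ?H])
    show "continuous_map ?W E ?H" by (rule transport_continuous[OF M' y \<gamma> start])
    show "f (?H (t, z)) = f (k z)" if "t \<in> {0..1}" "z \<in> topspace Z" for t z
      using transport_over[OF M' y \<gamma> start, of "(t, z)"] that D0 by (simp add: \<gamma>_def)
    have yE: "y p \<in> topspace E" if "p \<in> topspace ?W" for p
      using continuous_map_image_subset_topspace[OF y] that by blast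
    show "?H (0, z) = k z" if z: "z \<in> topspace Z" for z
    proof -
      have "y (0, z) = k z" using z D0 by (simp add: y_def)
      then show ?thesis
        using transport_const[OF M yE[of "(0, z)"], of "\<gamma> (0, z)"] z D0 by (simp add: \<gamma>_def)
    qed
    show "?H (t, a) = h (t, a)" if "t \<in> {0..1}" "a \<in> A" for t a
    proof -
      have ya: "y (t, a) = h (t, a)" using that DA h0 by (auto simp: y_def)
      have aZ: "a \<in> topspace Z" using that AZ by blast
      have "\<gamma> (t, a) s = f (y (t, a))" if "s \<in> {0..1}" for s
        using \<open>t \<in> {0..1}\<close> \<open>a \<in> A\<close> that DA fh mult_unit_interval[of t "1 - s"]
        by (simp add: ya \<gamma>_def)
      then show ?thesis
        using transport_const[OF M yE[of "(t, a)"], of "\<gamma> (t, a)"] that aZ ya by simp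
    qed
  qed
qed

section \<open>Subcomplexes have neighbourhood deformations\<close>

definition peak :: "('v \<Rightarrow> real) \<Rightarrow> real"
  where "peak \<beta> = Sup (range \<beta>)"

text \<open>
  The least \<open>c \<ge> 0\<close> for which the vertices with barycentric coordinate above \<open>c\<close> span a simplex of \<open>L\<close>
  or are none at all. It vanishes on the realization of \<open>L\<close>.
\<close>
definition excess :: "'v set set \<Rightarrow> 'v set set \<Rightarrow> ('v \<Rightarrow> real) \<Rightarrow> real"
  where "excess K L \<beta> = Sup (insert 0 ((\<lambda>s. Min (\<beta> ` s)) ` (K - L)))"

text \<open>
  Truncating the barycentric coordinates at height \<open>c\<close> and rescaling moves a point towards the
  vertices with its largest coordinates; if \<open>excess K L \<beta>\<close> is below the largest coordinate,
  cutting at that height lands in the realization of \<open>L\<close>. In terms of the barycentric subdivision this is the usual retraction of a regular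
  neighbourhood of \<open>L\<close>. It stays within every simplex that contains the point, so it respects all subcomplexes.
\<close>
definition cut :: "('v \<Rightarrow> real) \<Rightarrow> real \<Rightarrow> 'v \<Rightarrow> real"
  where "cut \<beta> c = (\<lambda>v. max 0 (\<beta> v - c) / (\<Sum>w | \<beta> w \<noteq> 0. max 0 (\<beta> w - c)))"

context
  fixes K :: "'v set set"
  assumes K: "abstract_simplicial_complex K"
begin

interpretation R: Metric_space "realization K" realization_dist
  using K by (rule Metric_space_realization)

lemma simplexD: "s \<in> K \<Longrightarrow> finite s" "s \<in> K \<Longrightarrow> s \<noteq> {}"
  "s \<in> K \<Longrightarrow> t \<subseteq> s \<Longrightarrow> t \<noteq> {} \<Longrightarrow> t \<in> K"
  using K unfolding abstract_simplicial_complex_def by blast+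

lemma realizationD:
  assumes "\<beta> \<in> realization K"
  shows "finite {v. \<beta> v \<noteq> 0}" "{v. \<beta> v \<noteq> 0} \<in> K" "0 \<le> \<beta> v" "\<beta> v \<le> 1"
    "(\<Sum>v | \<beta> v \<noteq> 0. \<beta> v) = 1"
proof -
  show "{v. \<beta> v \<noteq> 0} \<in> K" "(\<Sum>v | \<beta> v \<noteq> 0. \<beta> v) = 1" "0 \<le> \<beta> v" "\<beta> v \<le> 1"
    using assms by (auto simp: realization_def image_subset_iff)
  then show "finite {v. \<beta> v \<noteq> 0}" using simplexD(1) by blast
qed

lemma realization_ex_pos:
  assumes "\<beta> \<in> realization K"
  obtains v where "\<beta> v > 0"
proof -
  obtain v where "\<beta> v \<noteq> 0" using simplexD(2)[OF realizationD(2)[OF assms]] by blast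
  then show ?thesis using realizationD(3)[OF assms, of v] that[of v] by simp
qed

lemma less_peak_ex:
  assumes "\<beta> \<in> realization K" "c < peak \<beta>"
  obtains v where "c < \<beta> v"
proof -
  have "bdd_above (range \<beta>)" using realizationD(4)[OF assms(1)] by (auto intro!: bdd_aboveI[of _ 1])
  then show ?thesis
    using assms(2) that unfolding peak_def by (auto simp: less_cSup_iff)
qed

lemma coordinate_dist_le:
  assumes "\<alpha> \<in> realization K" "\<beta> \<in> realization K"
  shows "\<bar>\<alpha> v - \<beta> v\<bar> \<le> realization_dist \<alpha> \<beta>"
proof (cases "\<alpha> v \<noteq> 0 \<or> \<beta> v \<noteq> 0")
  case True
  have "finite {v. \<alpha> v \<noteq> 0 \<or> \<beta> v \<noteq> 0}"
    using realizationD(1)[OF assms(1)] realizationD(1)[OF assms(2)]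
    unfolding Collect_disj_eq by (rule finite_UnI)
  then have "(\<alpha> v - \<beta> v)\<^sup>2 \<le> (\<Sum>v | \<alpha> v \<noteq> 0 \<or> \<beta> v \<noteq> 0. (\<alpha> v - \<beta> v)\<^sup>2)"
    using True by (intro member_le_sum) auto
  then show ?thesis
    unfolding realization_dist_def by (intro real_le_rsqrt) simp
next
  case False
  then show ?thesis using R.nonneg[of \<alpha> \<beta>] by simp
qed

lemma peak_bounds:
  assumes "\<beta> \<in> realization K"
  shows "\<beta> v \<le> peak \<beta>" "0 < peak \<beta>" "peak \<beta> \<le> 1"
proof -
  have bdd: "bdd_above (range \<beta>)" using realizationD(4)[OF assms] by (auto intro!: bdd_aboveI[of _ 1])
  show le: "\<beta> v \<le> peak \<beta>" for v
    unfolding peak_def using bdd by (intro cSup_upper) auto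
  show "peak \<beta> \<le> 1"
    unfolding peak_def using realizationD(4)[OF assms] by (intro cSup_least) auto
  obtain v where "\<beta> v > 0" using realization_ex_pos[OF assms] .
  then show "0 < peak \<beta>" using le[of v] by linarith
qed

lemma bdd_above_excess:
  assumes "\<beta> \<in> realization K"
  shows "bdd_above (insert 0 ((\<lambda>s. Min (\<beta> ` s)) ` (K - L)))"
proof (rule bdd_aboveI[of _ 1])
  fix x assume "x \<in> insert 0 ((\<lambda>s. Min (\<beta> ` s)) ` (K - L))"
  then consider "x = 0" | s where "s \<in> K" "x = Min (\<beta> ` s)" by blast
  then show "x \<le> 1"
  proof cases
    case 2
    then have "finite s" "s \<noteq> {}" using simplexD by auto
    then obtain v where "v \<in> s" by blast
    then have "Min (\<beta> ` s) \<le> \<beta> v" using \<open>finite s\<close> by simp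
    then show ?thesis using 2 realizationD(4)[OF assms, of v] by linarith
  qed simp
qed

lemma excess_nonneg: "\<beta> \<in> realization K \<Longrightarrow> 0 \<le> excess K L \<beta>"
  unfolding excess_def by (intro cSup_upper bdd_above_excess) auto

lemma Min_le_excess: "\<beta> \<in> realization K \<Longrightarrow> s \<in> K \<Longrightarrow> s \<notin> L \<Longrightarrow> Min (\<beta> ` s) \<le> excess K L \<beta>"
  unfolding excess_def by (intro cSup_upper bdd_above_excess) auto

lemma excess_Lipschitz:
  assumes \<alpha>: "\<alpha> \<in> realization K" and \<beta>: "\<beta> \<in> realization K"
  shows "excess K L \<alpha> \<le> excess K L \<beta> + realization_dist \<alpha> \<beta>"
  unfolding excess_def[of K L \<alpha>]
proof (rule cSup_least)
  fix x assume "x \<in> insert 0 ((\<lambda>s. Min (\<alpha> ` s)) ` (K - L))"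
  then consider "x = 0" | s where "s \<in> K" "s \<notin> L" "x = Min (\<alpha> ` s)" by blast
  then show "x \<le> excess K L \<beta> + realization_dist \<alpha> \<beta>"
  proof cases
    case 1
    then show ?thesis using excess_nonneg[OF \<beta>] R.nonneg by simp
  next
    case 2
    then have s: "finite s" "s \<noteq> {}" using simplexD by auto
    then have "Min (\<beta> ` s) \<in> \<beta> ` s" by (intro Min_in) auto
    then obtain v where v: "v \<in> s" "\<beta> v = Min (\<beta> ` s)" by auto
    have "x \<le> \<alpha> v" using 2 s v by simp
    also have "\<dots> \<le> \<beta> v + realization_dist \<alpha> \<beta>"
      using coordinate_dist_le[OF \<alpha> \<beta>, of v] by linarith
    finally show ?thesis using Min_le_excess[OF \<beta> 2(1,2)] v by linarith
  qed
qed simp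

lemma peak_Lipschitz:
  assumes \<alpha>: "\<alpha> \<in> realization K" and \<beta>: "\<beta> \<in> realization K"
  shows "peak \<alpha> \<le> peak \<beta> + realization_dist \<alpha> \<beta>"
  unfolding peak_def[of \<alpha>]
proof (rule cSup_least)
  fix x assume "x \<in> range \<alpha>"
  then obtain v where "x = \<alpha> v" by blast
  then show "x \<le> peak \<beta> + realization_dist \<alpha> \<beta>"
    using coordinate_dist_le[OF \<alpha> \<beta>, of v] peak_bounds(1)[OF \<beta>, of v] by linarith
qed simp

lemma topspace_realization_topology [simp]: "topspace (realization_topology K) = realization K"
  by (simp add: realization_topology_def)

lemma Lipschitz_continuous_realization:
  fixes g :: "('v \<Rightarrow> real) \<Rightarrow> real"
  assumes "\<And>\<alpha> \<beta>. \<alpha> \<in> realization K \<Longrightarrow> \<beta> \<in> realization K \<Longrightarrow> g \<alpha> \<le> g \<beta> + realization_dist \<alpha> \<beta>"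
  shows "continuous_map (realization_topology K) euclideanreal g"
  unfolding continuous_map_atin topspace_realization_topology
proof
  fix \<beta> assume \<beta>: "\<beta> \<in> realization K"
  have "limitin R.mtopology (\<lambda>x. x) \<beta> (atin R.mtopology \<beta>)"
    using continuous_map_id[of R.mtopology] \<beta> unfolding continuous_map_atin by (simp add: id_def)
  then have *: "\<forall>\<^sub>F x in atin R.mtopology \<beta>. x \<in> realization K \<and> realization_dist x \<beta> < \<epsilon>"
    if "\<epsilon> > 0" for \<epsilon>
    using that by (simp add: R.limitin_metric)
  have "(g \<longlongrightarrow> g \<beta>) (atin R.mtopology \<beta>)"
  proof (rule tendstoI)
    fix \<epsilon> :: real assume "\<epsilon> > 0"
    show "\<forall>\<^sub>F x in atin R.mtopology \<beta>. dist (g x) (g \<beta>) < \<epsilon>"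
      using *[OF \<open>\<epsilon> > 0\<close>]
    proof eventually_elim
      case (elim x)
      then show ?case
        using assms[of x \<beta>] assms[of \<beta> x] \<beta> R.commute[of x \<beta>] by (simp add: dist_real_def abs_less_iff)
    qed
  qed
  then show "limitin euclideanreal g (g \<beta>) (atin (realization_topology K) \<beta>)"
    by (simp add: realization_topology_def)
qed

text \<open>
  Local finiteness makes every point of the realization have a neighbourhood of points supported on
  one finite set of vertices, so continuity can be tested coordinate by coordinate.
\<close>
lemma finite_star: "finite (\<Union>{s \<in> K. v \<in> s})"
proof -
  have star: "\<forall>v \<in> \<Union>K. finite {s \<in> K. v \<in> s}"
    using K unfolding abstract_simplicial_complex_def by (rule conjunct2)
  have "finite {s \<in> K. v \<in> s}"
  proof (cases "v \<in> \<Union>K")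
    case True
    then show ?thesis by (rule bspec[OF star])
  next
    case False
    then have "{s \<in> K. v \<in> s} = {}" by blast
    then show ?thesis by (simp only: finite.emptyI)
  qed
  then show ?thesis using simplexD(1) by (intro finite_Union) auto
qed

lemma limitin_realization_coordinatewise:
  assumes \<beta>: "\<beta> \<in> realization K" and H: "\<And>z. z \<in> S \<Longrightarrow> H z \<in> realization K"
    and S: "eventually (\<lambda>z. z \<in> S) F"
    and lim: "\<And>v. ((\<lambda>z. H z v) \<longlongrightarrow> \<beta> v) F"
  shows "limitin (realization_topology K) H \<beta> F"
  unfolding realization_topology_def R.limitin_metric
proof (intro conjI allI impI)
  show "\<beta> \<in> realization K" by fact
  fix \<epsilon> :: real assume "\<epsilon> > 0"
  obtain v where v: "\<beta> v > 0" using realization_ex_pos[OF \<beta>] .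
  define V where "V = \<Union>{s \<in> K. v \<in> s}"
  have V: "finite V" unfolding V_def by (rule finite_star)
  have supp: "{w. \<alpha> w \<noteq> 0} \<subseteq> V" if "\<alpha> \<in> realization K" "\<alpha> v > 0" for \<alpha>
    using realizationD(2)[OF that(1)] that(2) unfolding V_def by fastforce
  have "((\<lambda>z. \<Sum>w\<in>V. \<bar>H z w - \<beta> w\<bar>) \<longlongrightarrow> (\<Sum>w\<in>V. \<bar>\<beta> w - \<beta> w\<bar>)) F"
    by (intro tendsto_intros lim)
  then have "\<forall>\<^sub>F z in F. (\<Sum>w\<in>V. \<bar>H z w - \<beta> w\<bar>) < \<epsilon>"
    using \<open>\<epsilon> > 0\<close> by (intro order_tendstoD(2)) auto
  moreover have "\<forall>\<^sub>F z in F. H z v > 0"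
    using lim[of v] v by (rule order_tendstoD(1))
  ultimately show "\<forall>\<^sub>F z in F. H z \<in> realization K \<and> realization_dist (H z) \<beta> < \<epsilon>"
    using S
  proof eventually_elim
    case (elim z)
    then have Hz: "H z \<in> realization K" using H by simp
    have sub: "{w. H z w \<noteq> 0 \<or> \<beta> w \<noteq> 0} \<subseteq> V" using supp[OF Hz] supp[OF \<beta>] elim v by auto
    have "realization_dist (H z) \<beta> = L2_set (\<lambda>w. H z w - \<beta> w) {w. H z w \<noteq> 0 \<or> \<beta> w \<noteq> 0}"
      by (simp add: realization_dist_def L2_set_def)
    also have "\<dots> \<le> (\<Sum>w | H z w \<noteq> 0 \<or> \<beta> w \<noteq> 0. \<bar>H z w - \<beta> w\<bar>)"
      by (rule L2_set_le_sum_abs)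
    also have "\<dots> \<le> (\<Sum>w\<in>V. \<bar>H z w - \<beta> w\<bar>)"
      using V sub by (intro sum_mono2) auto
    finally show ?case using Hz elim by simp
  qed
qed

lemma sum_excess_pos:
  assumes \<beta>: "\<beta> \<in> realization K" and c: "c < peak \<beta>" and that: "0 \<le> c"
  shows "0 < (\<Sum>w | \<beta> w \<noteq> 0. max 0 (\<beta> w - c))"
proof -
  obtain v where v: "c < \<beta> v" using less_peak_ex[OF \<beta> c] .
  show ?thesis
    using v that realizationD(1)[OF \<beta>] by (intro sum_pos2[of _ v]) auto
qed

lemma cut_in_realization:
  assumes \<beta>: "\<beta> \<in> realization K" and c: "0 \<le> c" "c < peak \<beta>"
    and T: "{v. c < \<beta> v} \<in> T"
  shows "cut \<beta> c \<in> realization T"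
proof -
  let ?N = "\<Sum>w | \<beta> w \<noteq> 0. max 0 (\<beta> w - c)"
  have N: "?N > 0" using sum_excess_pos[OF \<beta> c(2,1)] .
  have fin: "finite {v. \<beta> v \<noteq> 0}" using realizationD(1)[OF \<beta>] .
  have supp: "{v. cut \<beta> c v \<noteq> 0} = {v. c < \<beta> v}"
    using N by (auto simp: cut_def)
  have le: "max 0 (\<beta> v - c) \<le> ?N" for v
  proof (cases "\<beta> v \<noteq> 0")
    case True
    then show ?thesis using fin by (intro member_le_sum) auto
  next
    case False
    then show ?thesis using c N by simp
  qed
  have "(\<Sum>v | cut \<beta> c v \<noteq> 0. cut \<beta> c v) = (\<Sum>v | \<beta> v \<noteq> 0. cut \<beta> c v)"
    using fin c unfolding supp by (intro sum.mono_neutral_left) (auto simp: cut_def)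
  also have "\<dots> = 1"
    using N by (simp add: cut_def flip: sum_divide_distrib)
  finally show ?thesis
    using T N le by (auto simp: realization_def supp) (auto simp: cut_def divide_le_eq_1)
qed

lemma cut_preserves_subcomplex:
  assumes T: "subcomplex T K" and \<beta>: "\<beta> \<in> realization T" and c: "0 \<le> c" "c < peak \<beta>"
  shows "cut \<beta> c \<in> realization T"
proof -
  have \<beta>K: "\<beta> \<in> realization K" using T \<beta> by (auto simp: realization_def subcomplex_def)
  obtain v where v: "c < \<beta> v" using less_peak_ex[OF \<beta>K c(2)] .
  have "{v. \<beta> v \<noteq> 0} \<in> T" using \<beta> by (simp add: realization_def)
  moreover have "{v. c < \<beta> v} \<subseteq> {v. \<beta> v \<noteq> 0}" using c by auto
  moreover have "{v. c < \<beta> v} \<noteq> {}" using v by blast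
  ultimately have "{v. c < \<beta> v} \<in> T"
    using T unfolding subcomplex_def abstract_simplicial_complex_def by blast
  then show ?thesis using cut_in_realization[OF \<beta>K c] by blast
qed

lemma subcomplex_refl: "subcomplex K K" using K by (simp add: subcomplex_def)

lemma cut_excess_in_subcomplex:
  assumes \<beta>: "\<beta> \<in> realization K" and lt: "excess K L \<beta> < peak \<beta>"
  shows "cut \<beta> (excess K L \<beta>) \<in> realization L"
proof (rule cut_in_realization[OF \<beta> excess_nonneg[OF \<beta>] lt])
  let ?c = "excess K L \<beta>" and ?s = "{v. excess K L \<beta> < \<beta> v}"
  have c: "0 \<le> ?c" by (rule excess_nonneg[OF \<beta>])
  obtain v where v: "?c < \<beta> v" using less_peak_ex[OF \<beta> lt] .
  have sub: "?s \<subseteq> {v. \<beta> v \<noteq> 0}" using c by auto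
  then have "?s \<in> K"
    using v by (intro simplexD(3)[OF realizationD(2)[OF \<beta>]]) auto
  moreover have "?c < Min (\<beta> ` ?s)"
    using v finite_subset[OF sub realizationD(1)[OF \<beta>]] by (subst Min_gr_iff) auto
  ultimately show "?s \<in> L"
    using Min_le_excess[OF \<beta>, of ?s L] by linarith
qed

lemma excess_eq_0:
  assumes L: "subcomplex L K" and \<beta>: "\<beta> \<in> realization L"
  shows "excess K L \<beta> = 0"
proof (rule antisym)
  have \<beta>K: "\<beta> \<in> realization K" using L \<beta> by (auto simp: realization_def subcomplex_def)
  show "excess K L \<beta> \<le> 0"
    unfolding excess_def
  proof (rule cSup_least)
    fix x assume "x \<in> insert 0 ((\<lambda>s. Min (\<beta> ` s)) ` (K - L))"
    then consider "x = 0" | s where "s \<in> K" "s \<notin> L" "x = Min (\<beta> ` s)" by blast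
    then show "x \<le> 0"
    proof cases
      case 2
      then have s: "finite s" "s \<noteq> {}" using simplexD by auto
      have "\<not> s \<subseteq> {v. \<beta> v \<noteq> 0}"
        using \<beta> L 2 s unfolding subcomplex_def abstract_simplicial_complex_def realization_def by blast
      then obtain v where "v \<in> s" "\<beta> v = 0" by blast
      then show ?thesis using 2 s by (metis Min_le finite_imageI imageI)
    qed simp
  qed simp
  show "0 \<le> excess K L \<beta>" using excess_nonneg[OF \<beta>K] .
qed

lemma cut_0: "\<beta> \<in> realization K \<Longrightarrow> cut \<beta> 0 = \<beta>"
proof -
  assume \<beta>: "\<beta> \<in> realization K"
  then have "max 0 (\<beta> v) = \<beta> v" for v using realizationD(3)[OF \<beta>, of v] by simp
  then show ?thesis using realizationD(5)[OF \<beta>] by (simp add: cut_def)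
qed

lemma limitin_cut:
  assumes lim: "limitin (realization_topology K) B \<beta> F" and S: "\<forall>\<^sub>F z in F. z \<in> S"
    and B: "\<And>z. z \<in> S \<Longrightarrow> B z \<in> realization K \<and> 0 \<le> C z \<and> C z < peak (B z)"
    and C: "(C \<longlongrightarrow> c) F" and c: "0 \<le> c" "c < peak \<beta>"
  shows "limitin (realization_topology K) (\<lambda>z. cut (B z) (C z)) (cut \<beta> c) F"
proof -
  have \<beta>: "\<beta> \<in> realization K" using lim by (simp add: limitin_def)
  have limv: "((\<lambda>z. B z v) \<longlongrightarrow> \<beta> v) F" for v
  proof -
    have "continuous_map (realization_topology K) euclideanreal (\<lambda>\<beta>. \<beta> v)"
    proof (rule Lipschitz_continuous_realization)
      fix \<alpha> \<beta> assume "\<alpha> \<in> realization K" "\<beta> \<in> realization K"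
      from coordinate_dist_le[OF this, of v] show "\<alpha> v \<le> \<beta> v + realization_dist \<alpha> \<beta>" by linarith
    qed
    then show ?thesis
      using continuous_map_limit[OF _ lim, of euclideanreal "\<lambda>\<beta>. \<beta> v"] by (simp add: o_def)
  qed
  obtain v where v: "\<beta> v > 0" using realization_ex_pos[OF \<beta>] .
  define V where "V = \<Union>{s \<in> K. v \<in> s}"
  have V: "finite V" unfolding V_def by (rule finite_star)
  have supp: "{w. \<alpha> w \<noteq> 0} \<subseteq> V" if "\<alpha> \<in> realization K" "\<alpha> v > 0" for \<alpha>
    using realizationD(2)[OF that(1)] that(2) unfolding V_def by fastforce
  have eq: "(\<Sum>w | \<alpha> w \<noteq> 0. max 0 (\<alpha> w - d)) = (\<Sum>w\<in>V. max 0 (\<alpha> w - d))"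
    if "\<alpha> \<in> realization K" "\<alpha> v > 0" "0 \<le> d" for \<alpha> d
    using V supp[OF that(1,2)] that(3) by (intro sum.mono_neutral_left) auto
  have "((\<lambda>z. \<Sum>w\<in>V. max 0 (B z w - C z)) \<longlongrightarrow> (\<Sum>w\<in>V. max 0 (\<beta> w - c))) F"
    by (intro tendsto_intros limv C)
  moreover have "\<forall>\<^sub>F z in F. (\<Sum>w\<in>V. max 0 (B z w - C z)) = (\<Sum>w | B z w \<noteq> 0. max 0 (B z w - C z))"
    using order_tendstoD(1)[OF limv[of v] v] S
    by eventually_elim (use eq B in auto)
  ultimately have N: "((\<lambda>z. \<Sum>w | B z w \<noteq> 0. max 0 (B z w - C z)) \<longlongrightarrow> (\<Sum>w | \<beta> w \<noteq> 0. max 0 (\<beta> w - c))) F"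
    by (subst eq[OF \<beta> v c(1)]) (rule Lim_transform_eventually)
  have "((\<lambda>z. cut (B z) (C z) w) \<longlongrightarrow> cut \<beta> c w) F" for w
    unfolding cut_def using sum_excess_pos[OF \<beta> c(2,1)] by (intro tendsto_intros limv C N) auto
  then show ?thesis
    using cut_preserves_subcomplex[OF subcomplex_refl] \<beta> c B S
    by (intro limitin_realization_coordinatewise[where S=S]) auto
qed

text \<open>
  Points are cut at a height that grows with \<open>t\<close> until it reaches the excess, but never beyond half
  the largest coordinate, since cutting at the full height leaves nothing. Compatibility with all other
  subcomplexes is what lets the deformation be restricted to \<open>X1\<close> later.
\<close>
proposition ndr_data_realization:
  assumes L: "subcomplex L K" and cl: "closedin (realization_topology K) (realization L)"
  obtains D u where "ndr_data (realization_topology K) (realization L) D u"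
    and "\<And>T \<beta> t. subcomplex T K \<Longrightarrow> \<beta> \<in> realization T \<Longrightarrow> t \<in> {0..1} \<Longrightarrow> D (\<beta>, t) \<in> realization T"
proof -
  define C where "C = (\<lambda>(\<beta>, t). min t (min (excess K L \<beta>) (peak \<beta> / 2)))"
  define D where "D = (\<lambda>(\<beta>, t). cut \<beta> (C (\<beta>, t)))"
  \<comment> \<open>If \<open>u \<beta> \<le> t\<close>, then the excess is at most half the peak and, as the peak is at most \<open>1\<close>, at most \<open>t\<close>;
    so the point is cut exactly at its excess.\<close>
  define u where "u = (\<lambda>\<beta>. 2 * excess K L \<beta> / peak \<beta>)"
  let ?T = "realization_topology K"
  have Cb: "0 \<le> C (\<beta>, t)" "C (\<beta>, t) < peak \<beta>" if "\<beta> \<in> realization K" "t \<in> {0..1}" for \<beta> t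
    using excess_nonneg[OF that(1), of L] peak_bounds(2)[OF that(1)] that(2) by (auto simp: C_def)
  have pres: "D (\<beta>, t) \<in> realization T"
    if "subcomplex T K" "\<beta> \<in> realization T" "t \<in> {0..1}" for T \<beta> t
  proof -
    have "\<beta> \<in> realization K" using that by (auto simp: realization_def subcomplex_def)
    from Cb[OF this that(3)] show ?thesis
      unfolding D_def using cut_preserves_subcomplex[OF that(1,2)] by simp
  qed
  have ce: "continuous_map ?T euclideanreal (excess K L)"
    by (rule Lipschitz_continuous_realization) (rule excess_Lipschitz)
  have cp: "continuous_map ?T euclideanreal peak"
    by (rule Lipschitz_continuous_realization) (rule peak_Lipschitz)
  have cfst: "continuous_map (prod_topology ?T unit_interval) ?T fst" by (rule continuous_map_fst)
  have csnd: "continuous_map (prod_topology ?T unit_interval) euclideanreal snd"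
    using continuous_map_snd continuous_map_into_fulltopology by blast
  have cC: "continuous_map (prod_topology ?T unit_interval) euclideanreal C"
    unfolding C_def case_prod_beta
    using continuous_map_compose[OF cfst ce] continuous_map_compose[OF cfst cp] csnd
    by (intro continuous_map_real_min continuous_map_real_divide) (auto simp: o_def)
  have cD: "continuous_map (prod_topology ?T unit_interval) ?T D"
    unfolding continuous_map_atin
  proof
    fix z assume z: "z \<in> topspace (prod_topology ?T unit_interval)"
    let ?F = "atin (prod_topology ?T unit_interval) z"
    have "limitin ?T (\<lambda>z. cut (fst z) (C z)) (cut (fst z) (C z)) ?F"
    proof (rule limitin_cut)
      show "limitin ?T fst (fst z) ?F" using cfst z unfolding continuous_map_atin by blast
      show "\<forall>\<^sub>F y in ?F. y \<in> topspace (prod_topology ?T unit_interval)"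
        unfolding eventually_atin using openin_topspace z by blast
      show "(C \<longlongrightarrow> C z) ?F"
        using cC z unfolding continuous_map_atin limitin_canonical_iff by blast
      show "0 \<le> C z" "C z < peak (fst z)" using Cb z by auto
    qed (use Cb in auto)
    moreover have "D = (\<lambda>z. cut (fst z) (C z))" by (auto simp: D_def fun_eq_iff)
    ultimately show "limitin ?T D (D z) ?F" by simp
  qed
  have "ndr_data ?T (realization L) D u"
    unfolding ndr_data_def
  proof (intro conjI ballI impI)
    show "continuous_map ?T euclideanreal u"
      unfolding u_def
      by (intro continuous_map_real_divide continuous_map_real_mult_left ce cp)
         (metis peak_bounds(2) less_irrefl topspace_realization_topology)
  next
    fix \<beta> assume \<beta>: "\<beta> \<in> topspace ?T"
    then show "D (\<beta>, 0) = \<beta>"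
      using excess_nonneg[of \<beta> L] peak_bounds(2)[of \<beta>] by (simp add: D_def C_def cut_0)
    show "0 \<le> u \<beta>"
      using \<beta> excess_nonneg[of \<beta> L] peak_bounds(2)[of \<beta>] by (simp add: u_def)
    fix t :: real assume t: "t \<in> {0..1}" and ut: "u \<beta> \<le> t"
    have p: "0 < peak \<beta>" "peak \<beta> \<le> 1" using \<beta> peak_bounds by auto
    have le: "excess K L \<beta> \<le> t * peak \<beta> / 2" using ut p by (simp add: u_def field_simps)
    have tp: "t * peak \<beta> \<le> peak \<beta>" "t * peak \<beta> \<le> t"
      using t p by (auto simp: mult_left_le_one_le mult_left_le)
    have "excess K L \<beta> \<le> t" "excess K L \<beta> \<le> peak \<beta> / 2"
      using le tp t by auto
    then have "C (\<beta>, t) = excess K L \<beta>" "excess K L \<beta> < peak \<beta>"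
      using p by (auto simp: C_def)
    then show "D (\<beta>, t) \<in> realization L"
      using cut_excess_in_subcomplex[of \<beta> L] \<beta> by (simp add: D_def)
  next
    fix \<beta> assume \<beta>: "\<beta> \<in> realization L"
    then have \<beta>K: "\<beta> \<in> realization K" using L by (auto simp: realization_def subcomplex_def)
    show "u \<beta> = 0" using excess_eq_0[OF L \<beta>] by (simp add: u_def)
    fix t :: real assume "t \<in> {0..1}"
    then have "C (\<beta>, t) = 0"
      using excess_eq_0[OF L \<beta>] peak_bounds(2)[OF \<beta>K] by (simp add: C_def)
    then show "D (\<beta>, t) = \<beta>" by (simp add: D_def cut_0[OF \<beta>K])
  qed (use cl cD in auto)
  then show ?thesis using pres that by blast
qed

end

section \<open>Gluing over a closed cover by two sets\<close>

text \<open>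
  The deformation lives on \<open>X1\<close> alone: homotopies are only ever extended from the intersection over
  \<open>X1\<close>, while over \<open>X2\<close> they are given in advance.
\<close>
locale ndr_cover =
  fixes X :: "'b topology" and X1 X2 :: "'b set" and D :: "'b \<times> real \<Rightarrow> 'b" and u :: "'b \<Rightarrow> real"
  assumes closed: "closedin X X1" "closedin X X2"
    and cover: "X1 \<union> X2 = topspace X"
    and ndr: "ndr_data (subtopology X X1) (X1 \<inter> X2) D u"
begin

lemma fiber_homotopic_glue:
  assumes f: "continuous_map E X f"
    and A: "continuous_map (prod_topology unit_interval (over E f X1)) E' HA"
    and B: "continuous_map (prod_topology unit_interval (over E f X2)) E' HB"
    and agree: "\<And>t e. t \<in> {0..1} \<Longrightarrow> e \<in> topspace E \<Longrightarrow> f e \<in> X1 \<inter> X2 \<Longrightarrow> HA (t, e) = HB (t, e)"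
    and over: "\<And>t e. t \<in> {0..1} \<Longrightarrow> e \<in> topspace E \<Longrightarrow> f e \<in> X1 \<Longrightarrow> f' (HA (t, e)) = f e"
      "\<And>t e. t \<in> {0..1} \<Longrightarrow> e \<in> topspace E \<Longrightarrow> f e \<in> X2 \<Longrightarrow> f' (HB (t, e)) = f e"
  shows "fiber_homotopic E f E' f' (\<lambda>e. if f e \<in> X2 then HB (0, e) else HA (0, e))
           (\<lambda>e. if f e \<in> X2 then HB (1, e) else HA (1, e))"
proof (rule fiber_homotopicI)
  show "continuous_map (prod_topology unit_interval E) E'
      (\<lambda>q. if f (snd q) \<in> X2 then HB q else HA q)"
  proof (rule continuous_map_glue[OF continuous_map_comp[OF continuous_map_snd f] closed cover])
    show "continuous_map (over (prod_topology unit_interval E) (\<lambda>q. f (snd q)) X1) E' HA"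
      using A by (simp only: prod_over)
    show "continuous_map (over (prod_topology unit_interval E) (\<lambda>q. f (snd q)) X2) E' HB"
      using B by (simp only: prod_over)
  qed (use agree in auto)
  show "f' (if f (snd (t, e)) \<in> X2 then HB (t, e) else HA (t, e)) = f e"
    if "t \<in> {0..1}" "e \<in> topspace E" for t e
  proof -
    have "f e \<in> X1 \<union> X2"
      using continuous_map_image_subset_topspace[OF f] that cover by blast
    then show ?thesis using over that by auto
  qed
qed auto

lemma fiber_map_glue:
  assumes f: "continuous_map E X f"
    and a: "fiber_map (over E f X1) f E' f' a" and b: "fiber_map (over E f X2) f E' f' b"
    and agree: "\<And>e. e \<in> topspace E \<Longrightarrow> f e \<in> X1 \<inter> X2 \<Longrightarrow> a e = b e"
  shows "fiber_map E f E' f' (\<lambda>e. if f e \<in> X2 then b e else a e)"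
proof -
  have "f e \<in> X1 \<union> X2" if "e \<in> topspace E" for e
    using continuous_map_image_subset_topspace[OF f] that cover by blast
  then show ?thesis
    using continuous_map_glue[OF f closed cover, of E' a b] agree a b
    by (auto simp: fiber_map_def over_base_def)
qed

lemma homotopy_extension_over:
  assumes M: "regular_lifting_function E X f M" and f: "continuous_map E X f"
    and M': "regular_lifting_function E' X f' M'" and f': "continuous_map E' X f'"
    and k: "fiber_map (over E f X1) f E' f' k"
    and h: "continuous_map (prod_topology unit_interval (over E f (X1 \<inter> X2))) E' h"
    and h0: "\<And>e. e \<in> topspace E \<Longrightarrow> f e \<in> X1 \<inter> X2 \<Longrightarrow> h (0, e) = k e"
    and fh: "\<And>t e. t \<in> {0..1} \<Longrightarrow> e \<in> topspace E \<Longrightarrow> f e \<in> X1 \<inter> X2 \<Longrightarrow> f' (h (t, e)) = f e"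
  obtains H where "continuous_map (prod_topology unit_interval (over E f X1)) E' H"
    and "\<And>e. e \<in> topspace E \<Longrightarrow> f e \<in> X1 \<Longrightarrow> H (0, e) = k e"
    and "\<And>t e. t \<in> {0..1} \<Longrightarrow> e \<in> topspace E \<Longrightarrow> f e \<in> X1 \<inter> X2 \<Longrightarrow> H (t, e) = h (t, e)"
    and "\<And>t e. t \<in> {0..1} \<Longrightarrow> e \<in> topspace E \<Longrightarrow> f e \<in> X1 \<Longrightarrow> f' (H (t, e)) = f e"
proof -
  have k': "continuous_map (over E f X1) E' k" "\<And>e. e \<in> topspace E \<Longrightarrow> f e \<in> X1 \<Longrightarrow> f' (k e) = f e"
    using k by (auto simp: fiber_map_def over_base_def)
  obtain H where "continuous_map (prod_topology unit_interval (over E f X1)) E' H"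
    "\<And>z. z \<in> topspace (over E f X1) \<Longrightarrow> H (0, z) = k z"
    "\<And>t a. t \<in> {0..1} \<Longrightarrow> a \<in> {e \<in> topspace E. f e \<in> X1 \<inter> X2} \<Longrightarrow> H (t, a) = h (t, a)"
    "\<And>t z. t \<in> {0..1} \<Longrightarrow> z \<in> topspace (over E f X1) \<Longrightarrow> f' (H (t, z)) = f' (k z)"
  proof (rule vertical_homotopy_extension[OF ndr_data_total_space[OF ndr M f] M' f' k'(1)])
    show "continuous_map (prod_topology unit_interval
        (subtopology (over E f X1) {e \<in> topspace E. f e \<in> X1 \<inter> X2})) E' h"
      using h by (simp only: over_eq_closed)
  qed (use h0 fh k' in auto)
  then show ?thesis using k' by (intro that[of H]) auto
qed

text \<open>
  The given homotopy is used over \<open>X2\<close>, and its restriction to the intersection is extended over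
  \<open>X1\<close>.
\<close>
lemma fiber_map_deform:
  assumes M: "regular_lifting_function E X f M" and f: "continuous_map E X f"
    and M': "regular_lifting_function E' X f' M'" and f': "continuous_map E' X f'"
    and k: "fiber_map E f E' f' k"
    and kb: "fiber_homotopic (over E f X2) f E' f' k b"
  obtains k' where "fiber_homotopic E f E' f' k k'"
    and "\<And>e. e \<in> topspace E \<Longrightarrow> f e \<in> X2 \<Longrightarrow> k' e = b e"
proof -
  obtain h where h: "continuous_map (prod_topology unit_interval (over E f X2)) E' h"
    and h0: "\<And>e. h (0, e) = k e" and h1: "\<And>e. h (1, e) = b e"
    and fh: "\<And>t e. t \<in> {0..1} \<Longrightarrow> e \<in> topspace (over E f X2) \<Longrightarrow> f' (h (t, e)) = f e"
    using fiber_homotopicE[OF kb] by blast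
  have h3: "continuous_map (prod_topology unit_interval (over E f (X1 \<inter> X2))) E' h"
    by (rule continuous_map_prod_over_mono[OF h]) simp
  obtain H where H: "continuous_map (prod_topology unit_interval (over E f X1)) E' H"
    and H0: "\<And>e. e \<in> topspace E \<Longrightarrow> f e \<in> X1 \<Longrightarrow> H (0, e) = k e"
    and Hh: "\<And>t e. t \<in> {0..1} \<Longrightarrow> e \<in> topspace E \<Longrightarrow> f e \<in> X1 \<inter> X2 \<Longrightarrow> H (t, e) = h (t, e)"
    and fH: "\<And>t e. t \<in> {0..1} \<Longrightarrow> e \<in> topspace E \<Longrightarrow> f e \<in> X1 \<Longrightarrow> f' (H (t, e)) = f e"
    using homotopy_extension_over[OF M f M' f' fiber_map_restrict[OF k] h3] h0 fh by auto
  have eX: "f e \<in> X1 \<union> X2" if "e \<in> topspace E" for e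
    using continuous_map_image_subset_topspace[OF f] that cover by blast
  have "fiber_homotopic E f E' f' (\<lambda>e. if f e \<in> X2 then h (0, e) else H (0, e))
           (\<lambda>e. if f e \<in> X2 then h (1, e) else H (1, e))"
    using fh fH Hh by (intro fiber_homotopic_glue f H h) auto
  then have "fiber_homotopic E f E' f' k (\<lambda>e. if f e \<in> X2 then h (1, e) else H (1, e))"
    by (rule fiber_homotopic_cong) (use h0 H0 eX in auto)
  then show ?thesis by (rule that) (simp add: h1)
qed

text \<open>
  The map over \<open>X1\<close> is deformed until it agrees with the other one over the intersection.
\<close>
lemma fiber_map_from_pieces:
  assumes M: "regular_lifting_function E X f M" and f: "continuous_map E X f"
    and M': "regular_lifting_function E' X f' M'" and f': "continuous_map E' X f'"
    and a: "fiber_map (over E f X1) f E' f' a" and b: "fiber_map (over E f X2) f E' f' b"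
    and ab: "fiber_homotopic (over E f (X1 \<inter> X2)) f E' f' a b"
  obtains h where "fiber_map E f E' f' h"
    and "fiber_homotopic (over E f X1) f E' f' h a"
    and "fiber_homotopic (over E f X2) f E' f' h b"
proof -
  obtain h where h: "continuous_map (prod_topology unit_interval (over E f (X1 \<inter> X2))) E' h"
    and h0: "\<And>e. h (0, e) = a e" and h1: "\<And>e. h (1, e) = b e"
    and fh: "\<And>t e. t \<in> {0..1} \<Longrightarrow> e \<in> topspace (over E f (X1 \<inter> X2)) \<Longrightarrow> f' (h (t, e)) = f e"
    using fiber_homotopicE[OF ab] by blast
  obtain H where H: "continuous_map (prod_topology unit_interval (over E f X1)) E' H"
    and H0: "\<And>e. e \<in> topspace E \<Longrightarrow> f e \<in> X1 \<Longrightarrow> H (0, e) = a e"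
    and Hh: "\<And>t e. t \<in> {0..1} \<Longrightarrow> e \<in> topspace E \<Longrightarrow> f e \<in> X1 \<inter> X2 \<Longrightarrow> H (t, e) = h (t, e)"
    and fH: "\<And>t e. t \<in> {0..1} \<Longrightarrow> e \<in> topspace E \<Longrightarrow> f e \<in> X1 \<Longrightarrow> f' (H (t, e)) = f e"
    using homotopy_extension_over[OF M f M' f' a h] h0 fh by auto
  let ?h = "\<lambda>e. if f e \<in> X2 then b e else H (1, e)"
  have aH: "fiber_homotopic (over E f X1) f E' f' a (\<lambda>e. H (1, e))"
    using H H0 fH by (intro fiber_homotopicI[OF H]) auto
  have agree: "H (1, e) = b e" if "e \<in> topspace E" "f e \<in> X1 \<inter> X2" for e
    using Hh[of 1 e] that h1 by simp
  show ?thesis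
  proof (rule that[of ?h])
    show hm: "fiber_map E f E' f' ?h"
      by (rule fiber_map_glue[OF f fiber_homotopic_imp_fiber_map(2)[OF aH] b agree])
    show "fiber_homotopic (over E f X1) f E' f' ?h a"
      using agree by (intro fiber_homotopic_sym[OF fiber_homotopic_cong[OF aH]]) auto
    show "fiber_homotopic (over E f X2) f E' f' ?h b"
      by (rule fiber_homotopic_eq[OF fiber_map_restrict[OF hm]]) auto
  qed
qed

end

text \<open>
  The deformation that belongs to the subcomplex of \<open>X2\<close> preserves \<open>X1\<close>, and its restriction to
  \<open>X1\<close> deforms a neighbourhood of the intersection into the intersection.
\<close>
lemma ndr_cover_subpolyhedra:
  assumes P: "topological_polyhedron X K \<phi>"
    and S1: "subpolyhedron X K \<phi> X1" and S2: "subpolyhedron X K \<phi> X2"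
    and cover: "topspace X = X1 \<union> X2"
  obtains D u where "ndr_cover X X1 X2 D u"
proof -
  have K: "abstract_simplicial_complex K" and hm: "homeomorphic_map (realization_topology K) X \<phi>"
    using P by (auto simp: topological_polyhedron_def)
  obtain \<psi> where \<psi>: "homeomorphic_maps (realization_topology K) X \<phi> \<psi>"
    using hm homeomorphic_map_maps by blast
  obtain T1 where T1: "subcomplex T1 K" "X1 = \<phi> ` realization T1" and cl1: "closedin X X1"
    using S1 by (auto simp: subpolyhedron_def)
  obtain T2 where T2: "subcomplex T2 K" "X2 = \<phi> ` realization T2" and cl2: "closedin X X2"
    using S2 by (auto simp: subpolyhedron_def)
  have sub: "realization T \<subseteq> topspace (realization_topology K)" if "subcomplex T K" for T
    using that topspace_realization_topology[OF K] by (auto simp: realization_def subcomplex_def)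
  have "closedin (realization_topology K) (realization T2)"
    using homeomorphic_map_closedness[OF hm sub[OF T2(1)]] cl2 T2(2) by simp
  from ndr_data_realization[OF K T2(1) this] obtain D u
    where N: "ndr_data (realization_topology K) (realization T2) D u"
      and pres: "\<And>T \<beta> t. subcomplex T K \<Longrightarrow> \<beta> \<in> realization T \<Longrightarrow> t \<in> {0..1} \<Longrightarrow> D (\<beta>, t) \<in> realization T"
    by blast
  let ?D = "\<lambda>(x, t). \<phi> (D (\<psi> x, t))"
  have N': "ndr_data X X2 ?D (\<lambda>x. u (\<psi> x))"
    using ndr_data_homeomorphic[OF \<psi> N] T2(2) by simp
  have "?D (x, t) \<in> X1" if x: "x \<in> X1" and t: "t \<in> {0..1}" for x t
  proof -
    obtain \<beta> where \<beta>: "\<beta> \<in> realization T1" "x = \<phi> \<beta>" using x T1(2) by blast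
    then have "\<psi> x = \<beta>" using \<psi> sub[OF T1(1)] by (auto simp: homeomorphic_maps_def)
    then show ?thesis using pres[OF T1(1) \<beta>(1) t] T1(2) by simp
  qed
  from ndr_data_subtopology[OF N' _ this] cover
  have "ndr_data (subtopology X X1) (X1 \<inter> X2) ?D (\<lambda>x. u (\<psi> x))" by blast
  then show ?thesis
    using cl1 cl2 cover by (intro that) (auto simp: ndr_cover_def)
qed

section \<open>Fiber maps that are homotopic to the identity over both pieces\<close>

context ndr_cover
begin

definition locally_id :: "'e topology \<Rightarrow> ('e \<Rightarrow> 'b) \<Rightarrow> ('e \<Rightarrow> 'e) \<Rightarrow> bool"
  where "locally_id E f p \<longleftrightarrow> fiber_map E f E f p \<and>
    fiber_homotopic (over E f X1) f E f p id \<and> fiber_homotopic (over E f X2) f E f p id"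

text \<open>
  Deform \<open>p\<close> to a map \<open>p'\<close> that is the identity over \<open>X2\<close>, and let \<open>H\<close> be a vertical homotopy over
  \<open>X1\<close> from \<open>p'\<close> to the identity. Over the intersection \<open>H\<close> is a loop of self-maps at the identity,
  which is the obstruction to gluing \<open>H\<close> to the constant homotopy. Extend this loop over \<open>X1\<close> to a
  homotopy \<open>G\<close> that starts at the identity, and let \<open>q\<close> be its end over \<open>X1\<close> and the identity over \<open>X2\<close>. From
  \<open>q \<circ> p'\<close> one returns to the identity by running \<open>G \<circ> p'\<close> backwards and then \<open>H\<close>. Over the
  intersection this is \<open>H\<close> run backwards and forwards, a contractible loop; extending its contraction
  makes the homotopy constant there, so it can be glued to the constant one over \<open>X2\<close>.
\<close>
lemma locally_id_left_inverse:
  assumes M: "regular_lifting_function E X f M" and f: "continuous_map E X f"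
    and p: "locally_id E f p"
  obtains q where "locally_id E f q" and "fiber_homotopic E f E f (\<lambda>e. q (p e)) id"
proof -
  have pm: "fiber_map E f E f p" and p1: "fiber_homotopic (over E f X1) f E f p id"
    and p2: "fiber_homotopic (over E f X2) f E f p id"
    using p by (auto simp: locally_id_def)
  obtain p' where pp': "fiber_homotopic E f E f p p'"
    and p'2: "\<And>e. e \<in> topspace E \<Longrightarrow> f e \<in> X2 \<Longrightarrow> p' e = e"
    using fiber_map_deform[OF M f M f pm p2] by (metis id_apply)
  have p'm: "fiber_map E f E f p'" using fiber_homotopic_imp_fiber_map(2)[OF pp'] .
  have p'1: "fiber_homotopic (over E f X1) f E f p' id"
    using fiber_homotopic_trans[OF fiber_homotopic_sym[OF fiber_homotopic_restrict[OF pp']] p1] .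
  have p'E: "p' e \<in> topspace E" "f (p' e) = f e" if "e \<in> topspace E" for e
    using p'm that continuous_map_image_subset_topspace
    unfolding fiber_map_def over_base_def by blast+
  have eX: "f e \<in> X1 \<union> X2" if "e \<in> topspace E" for e
    using continuous_map_image_subset_topspace[OF f] that cover by blast
  let ?Z = "over E f X1" and ?I = unit_interval
  let ?A = "{e \<in> topspace E. f e \<in> X1 \<inter> X2}"
  obtain H where H: "continuous_map (prod_topology ?I ?Z) E H"
    and H0: "\<And>e. H (0, e) = p' e" and H1': "\<And>e. H (1, e) = id e"
    and fH: "\<And>t e. t \<in> {0..1} \<Longrightarrow> e \<in> topspace ?Z \<Longrightarrow> f (H (t, e)) = f e"
    using fiber_homotopicE[OF p'1] by blast
  have H1: "H (1, e) = e" for e using H1' by simp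
  have H3: "continuous_map (prod_topology ?I (over E f (X1 \<inter> X2))) E H"
    by (rule continuous_map_prod_over_mono[OF H]) simp
  have idm: "fiber_map (over E f B) f E f (\<lambda>e. e)" for B
    by (simp add: fiber_map_def over_base_def continuous_map_id_subt[unfolded id_def])
  obtain G where G: "continuous_map (prod_topology ?I ?Z) E G"
    and G0: "\<And>e. e \<in> topspace E \<Longrightarrow> f e \<in> X1 \<Longrightarrow> G (0, e) = e"
    and GH: "\<And>t e. t \<in> {0..1} \<Longrightarrow> e \<in> topspace E \<Longrightarrow> f e \<in> X1 \<inter> X2 \<Longrightarrow> G (t, e) = H (t, e)"
    and fG: "\<And>t e. t \<in> {0..1} \<Longrightarrow> e \<in> topspace E \<Longrightarrow> f e \<in> X1 \<Longrightarrow> f (G (t, e)) = f e"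
  proof (rule homotopy_extension_over[OF M f M f idm H3])
    show "H (0, e) = e" if "e \<in> topspace E" "f e \<in> X1 \<inter> X2" for e
      using that H0 p'2 by simp
  qed (use fH in auto)
  define q where "q = (\<lambda>e. if f e \<in> X2 then e else G (1, e))"
  have G1: "G (1, e) = e" if "e \<in> topspace E" "f e \<in> X1 \<inter> X2" for e
    using GH[of 1 e] H1 that by simp
  have idG: "fiber_homotopic ?Z f E f id (\<lambda>e. G (1, e))"
    using G0 fG by (intro fiber_homotopicI[OF G]) auto
  have qm: "fiber_map E f E f q"
    unfolding q_def by (rule fiber_map_glue[OF f fiber_homotopic_imp_fiber_map(2)[OF idG] idm G1])
  have q: "locally_id E f q"
    unfolding locally_id_def
  proof (intro conjI qm)
    show "fiber_homotopic ?Z f E f q id"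
      using G1 by (intro fiber_homotopic_sym[OF fiber_homotopic_cong[OF idG]]) (auto simp: q_def)
    show "fiber_homotopic (over E f X2) f E f q id"
      by (rule fiber_homotopic_eq[OF fiber_map_restrict[OF qm]]) (auto simp: q_def)
  qed
  \<comment> \<open>\<open>J\<close> runs \<open>G \<circ> p'\<close> backwards and then \<open>H\<close>, from \<open>q \<circ> p'\<close> to the identity.\<close>
  define J where "J = (\<lambda>y. if fst y \<le> 1/2 then G (1 - 2 * fst y, p' (snd y)) else H (2 * fst y - 1, snd y))"
  let ?W = "prod_topology ?I ?Z"
  have p'Z: "continuous_map ?Z ?Z p'"
    using p'm p'E by (intro continuous_map_into_subtopology continuous_map_from_subtopology)
      (auto simp: fiber_map_def)
  have cfst: "continuous_map ?W euclideanreal fst"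
    by (rule continuous_map_into_fulltopology[OF continuous_map_fst])
  have J: "continuous_map ?W E J"
    unfolding J_def
  proof (rule continuous_map_cases_le[OF cfst])
    let ?S = "subtopology ?W {y \<in> topspace ?W. fst y \<le> 1 / 2}"
    have "continuous_map ?S ?I (\<lambda>y. 1 - 2 * fst y)"
      by (intro continuous_map_unit_intervalI continuous_map_diff continuous_map_real_mult_left
          continuous_map_from_subtopology cfst) auto
    then have "continuous_map ?S ?W (\<lambda>y. (1 - 2 * fst y, p' (snd y)))"
      by (rule continuous_map_pairedI)
         (rule continuous_map_from_subtopology[OF continuous_map_comp[OF continuous_map_snd p'Z]])
    from continuous_map_comp[OF this G]
    show "continuous_map ?S E (\<lambda>y. G (1 - 2 * fst y, p' (snd y)))" .
  next
    let ?S = "subtopology ?W {y \<in> topspace ?W. 1 / 2 \<le> fst y}"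
    have "continuous_map ?S ?I (\<lambda>y. 2 * fst y - 1)"
      by (intro continuous_map_unit_intervalI continuous_map_diff continuous_map_real_mult_left
          continuous_map_from_subtopology cfst) auto
    then have "continuous_map ?S ?W (\<lambda>y. (2 * fst y - 1, snd y))"
      by (rule continuous_map_pairedI) (rule continuous_map_from_subtopology[OF continuous_map_snd])
    from continuous_map_comp[OF this H]
    show "continuous_map ?S E (\<lambda>y. H (2 * fst y - 1, snd y))" .
  next
    fix y assume y: "y \<in> topspace ?W" and half: "fst y = 1 / 2"
    have "1 - 2 * fst y = 0" "2 * fst y - 1 = 0" using half by simp_all
    then show "G (1 - 2 * fst y, p' (snd y)) = H (2 * fst y - 1, snd y)"
      using y G0[of "p' (snd y)"] H0 p'E[of "snd y"] by auto
  qed simp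
  have fJ: "f (J (t, e)) = f e" if "t \<in> {0..1}" "e \<in> topspace E" "f e \<in> X1" for t e
    using that fG[of "1 - 2 * t" "p' e"] fH[of "2 * t - 1" e] p'E by (auto simp: J_def)
  have JA: "J (t, e) = H (\<bar>1 - 2 * t\<bar>, e)" if "t \<in> {0..1}" "e \<in> ?A" for t e
    using that GH[of "1 - 2 * t" e] p'2 by (auto simp: J_def)
  \<comment> \<open>Over the intersection, \<open>J\<close> at time \<open>t\<close> is \<open>H\<close> at time \<open>\<bar>1 - 2 * t\<bar>\<close>. Raising this time to at
    least \<open>s\<close> contracts the loop, with fixed ends, because \<open>H\<close> at time \<open>1\<close> is the identity.\<close>
  define h where "h = (\<lambda>y. H (max (fst y) \<bar>1 - 2 * fst (snd y)\<bar>, snd (snd y)))"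
  have AW: "subtopology ?W ({0..1} \<times> ?A) = prod_topology ?I (over E f (X1 \<inter> X2))"
  proof -
    have "subtopology ?W ({0..1} \<times> ?A) = prod_topology ?I (subtopology ?Z ?A)"
      by (simp add: subtopology_Times subtopology_subtopology)
    then show ?thesis by (simp only: over_eq_closed)
  qed
  obtain V where V: "continuous_map (prod_topology ?I ?W) E V"
    and V0: "\<And>z. z \<in> topspace ?W \<Longrightarrow> V (0, z) = J z"
    and Vh: "\<And>s z. s \<in> {0..1} \<Longrightarrow> z \<in> {0..1} \<times> ?A \<Longrightarrow> V (s, z) = h (s, z)"
    and fV: "\<And>s z. s \<in> {0..1} \<Longrightarrow> z \<in> topspace ?W \<Longrightarrow> f (V (s, z)) = f (J z)"
  proof (rule vertical_homotopy_extension[OF ndr_data_prod[OF ndr_data_total_space[OF ndr M f]] M f J])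
    let ?Y = "prod_topology ?I (prod_topology ?I (over E f (X1 \<inter> X2)))"
    have "continuous_map ?Y ?I (\<lambda>y. max (fst y) \<bar>1 - 2 * fst (snd y)\<bar>)"
      by (rule continuous_map_unit_intervalI,
          (rule continuous_map_real_abs continuous_map_real_intros continuous_map_proj_intros)+) auto
    then have "continuous_map ?Y (prod_topology ?I (over E f (X1 \<inter> X2)))
        (\<lambda>y. (max (fst y) \<bar>1 - 2 * fst (snd y)\<bar>, snd (snd y)))"
      by (rule continuous_map_pairedI) (rule continuous_map_proj_intros)+
    from continuous_map_comp[OF this H3]
    show "continuous_map (prod_topology ?I (subtopology ?W ({0..1} \<times> ?A))) E h"
      unfolding h_def AW .
    show "h (0, z) = J z" if "z \<in> {0..1} \<times> ?A" for z
      using that JA by (auto simp: h_def)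
    show "f (h (s, z)) = f (J z)" if "s \<in> {0..1}" "z \<in> {0..1} \<times> ?A" for s z
    proof -
      have "max s \<bar>1 - 2 * fst z\<bar> \<in> {0..1}" using that by auto
      then show ?thesis
        using that fJ fH[of "max s \<bar>1 - 2 * fst z\<bar>" "snd z"] by (auto simp: h_def)
    qed
  qed blast
  have VA: "V (s, t, e) = e" if "s \<in> {0..1}" "t \<in> {0..1}" "e \<in> ?A" "s = 1 \<or> t = 0 \<or> t = 1" for s t e
  proof -
    have "max s \<bar>1 - 2 * t\<bar> = 1" using that by auto
    then show ?thesis using Vh[of s "(t, e)"] that H1 by (simp add: h_def)
  qed
  have fV': "f (V (s, t, e)) = f e" if "s \<in> {0..1}" "t \<in> {0..1}" "e \<in> topspace E" "f e \<in> X1" for s t e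
    using fV[of s "(t, e)"] fJ that by simp
  \<comment> \<open>On three sides of the square \<open>(s, t)\<close>, namely \<open>t = 0\<close>, \<open>s = 1\<close> and \<open>t = 1\<close>, the map \<open>V\<close> is the
    identity over the intersection. The path along them leads from \<open>q \<circ> p'\<close> to the identity.\<close>
  have glue_id: "fiber_homotopic E f E f (\<lambda>e. if f e \<in> X2 then e else V (\<sigma> 0, \<tau> 0, e))
      (\<lambda>e. if f e \<in> X2 then e else V (\<sigma> 1, \<tau> 1, e))"
    if c: "continuous_map ?I ?I \<sigma>" "continuous_map ?I ?I \<tau>"
      and edge: "\<And>t. t \<in> {0..1} \<Longrightarrow> \<sigma> t = 1 \<or> \<tau> t = 0 \<or> \<tau> t = 1" for \<sigma> \<tau>
  proof -
    have in01: "\<sigma> t \<in> {0..1}" "\<tau> t \<in> {0..1}" if "t \<in> {0..1}" for t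
      using c that by (auto simp: continuous_map_def)
    have "continuous_map ?W (prod_topology ?I ?W) (\<lambda>y. (\<sigma> (fst y), \<tau> (fst y), snd y))"
      by (rule continuous_map_pairedI continuous_map_snd continuous_map_comp[OF continuous_map_fst c(1)]
          continuous_map_comp[OF continuous_map_fst c(2)])+
    from continuous_map_comp[OF this V]
    have A: "continuous_map ?W E (\<lambda>y. V (\<sigma> (fst y), \<tau> (fst y), snd y))" .
    have B: "continuous_map (prod_topology ?I (over E f X2)) E snd"
      by (rule continuous_map_into_fulltopology[OF continuous_map_snd])
    show ?thesis
      by (rule fiber_homotopic_glue[OF f A B, of f, unfolded fst_conv snd_conv])
         (use VA fV' in01 edge in auto)
  qed
  have c01: "continuous_map ?I ?I (\<lambda>t. t)" "continuous_map ?I ?I (\<lambda>t. 1 - t)"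
    "continuous_map ?I ?I (\<lambda>t. 0)" "continuous_map ?I ?I (\<lambda>t. 1)"
    by (auto intro!: continuous_intros)
  have chain: "fiber_homotopic E f E f (\<lambda>e. if f e \<in> X2 then e else V (0, 0, e))
      (\<lambda>e. if f e \<in> X2 then e else V (0, 1, e))"
    (is "fiber_homotopic E f E f ?P0 ?P3")
  proof -
    let ?P1 = "\<lambda>e. if f e \<in> X2 then e else V (1, 0, e)"
      and ?P2 = "\<lambda>e. if f e \<in> X2 then e else V (1, 1, e)"
    have "fiber_homotopic E f E f ?P0 ?P1"
      using glue_id[OF c01(1) c01(3)] by simp
    also have "fiber_homotopic E f E f ?P1 ?P2"
      using glue_id[OF c01(4) c01(1)] by simp
    also have "fiber_homotopic E f E f ?P2 ?P3"
      using glue_id[OF c01(2) c01(4), unfolded diff_zero diff_self] by simp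
    finally show ?thesis .
  qed
  have qp': "fiber_homotopic E f E f (\<lambda>e. q (p' e)) id"
  proof (rule fiber_homotopic_cong[OF chain])
    fix e assume e: "e \<in> topspace E"
    show "(if f e \<in> X2 then e else V (0, 0, e)) = q (p' e)"
      using e eX[OF e] p'2 p'E V0[of "(0, e)"] by (auto simp: q_def J_def)
    show "(if f e \<in> X2 then e else V (0, 1, e)) = id e"
      using e eX[OF e] H1 V0[of "(1, e)"] by (auto simp: J_def)
  qed simp
  have "fiber_homotopic E f E f (\<lambda>e. q (p e)) (\<lambda>e. q (p' e))"
    by (rule fiber_homotopic_postcompose[OF pp' qm])
  from q fiber_homotopic_trans[OF this qp'] show ?thesis by (rule that)
qed

text \<open>
  A left inverse has a left inverse itself, which must then be homotopic to \<open>p\<close>.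
\<close>
lemma locally_id_invertible:
  assumes M: "regular_lifting_function E X f M" and f: "continuous_map E X f"
    and p: "locally_id E f p"
  obtains q where "fiber_map E f E f q" "fiber_homotopic E f E f (\<lambda>e. q (p e)) id"
    "fiber_homotopic E f E f (\<lambda>e. p (q e)) id"
proof -
  obtain q where q: "locally_id E f q" and qp: "fiber_homotopic E f E f (\<lambda>e. q (p e)) id"
    using locally_id_left_inverse[OF M f p] .
  obtain q' where q'q: "fiber_homotopic E f E f (\<lambda>e. q' (q e)) id" and q': "locally_id E f q'"
    using locally_id_left_inverse[OF M f q] .
  have m: "fiber_map E f E f p" "fiber_map E f E f q" "fiber_map E f E f q'"
    using p q q' by (auto simp: locally_id_def)
  have pc: "continuous_map E E p" "\<And>e. e \<in> topspace E \<Longrightarrow> f (p e) = f e"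
    and qc: "continuous_map E E q" "\<And>e. e \<in> topspace E \<Longrightarrow> f (q e) = f e"
    using m by (auto simp: fiber_map_def over_base_def)
  have "fiber_homotopic E f E f (\<lambda>e. q' (q (p e))) (\<lambda>e. q' e)"
    using fiber_homotopic_postcompose[OF qp m(3)] by simp
  moreover have "fiber_homotopic E f E f (\<lambda>e. q' (q (p e))) p"
    using fiber_homotopic_cong[OF fiber_homotopic_precompose[OF q'q pc(1)]] pc(2) by simp
  ultimately have "fiber_homotopic E f E f p (\<lambda>e. q' e)"
    using fiber_homotopic_trans[OF fiber_homotopic_sym] by blast
  from fiber_homotopic_precompose[OF this qc(1)]
  have "fiber_homotopic E f E f (\<lambda>e. p (q e)) (\<lambda>e. q' (q e))"
    by (rule fiber_homotopic_cong) (use qc(2) in auto)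
  from m(2) qp fiber_homotopic_trans[OF this q'q] show ?thesis by (rule that)
qed

text \<open>
  Invertibility of both composites provides \<open>h\<close> with a left and a right inverse, which then agree up
  to vertical homotopy.
\<close>
lemma fiber_homotopy_equivalent_if_locally_inverse:
  assumes M1: "regular_lifting_function E1 X f1 M1" and f1: "continuous_map E1 X f1"
    and M2: "regular_lifting_function E2 X f2 M2" and f2: "continuous_map E2 X f2"
    and h: "fiber_map E1 f1 E2 f2 h" and k: "fiber_map E2 f2 E1 f1 k"
    and kh: "locally_id E1 f1 (\<lambda>e. k (h e))" and hk: "locally_id E2 f2 (\<lambda>e. h (k e))"
  shows "fiber_homotopy_equivalent E1 f1 E2 f2"
proof -
  obtain q where q: "fiber_map E1 f1 E1 f1 q"
    and qkh: "fiber_homotopic E1 f1 E1 f1 (\<lambda>e. q (k (h e))) id"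
    using locally_id_invertible[OF M1 f1 kh] by blast
  obtain q' where q': "fiber_map E2 f2 E2 f2 q'"
    and hkq': "fiber_homotopic E2 f2 E2 f2 (\<lambda>e. h (k (q' e))) id"
    using locally_id_invertible[OF M2 f2 hk] by blast
  note maps = h k q q'
  define k' where "k' = (\<lambda>e. q (k e))"
  have k': "fiber_map E2 f2 E1 f1 k'" and kq': "fiber_map E2 f2 E1 f1 (\<lambda>e. k (q' e))"
    using maps continuous_map_comp[of E2 E1 k E1 q] continuous_map_comp[of E2 E2 q' E1 k]
    by (auto simp: k'_def fiber_map_def over_base_def continuous_map_def Pi_iff)
  have "fiber_homotopic E2 f2 E1 f1 (\<lambda>e. k' (h (k (q' e)))) (\<lambda>e. k' e)"
    using fiber_homotopic_postcompose[OF hkq' k'] by simp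
  moreover have "fiber_homotopic E2 f2 E1 f1 (\<lambda>e. k' (h (k (q' e)))) (\<lambda>e. k (q' e))"
  proof -
    have "continuous_map E2 E1 (\<lambda>e. k (q' e))" "\<And>e. e \<in> topspace E2 \<Longrightarrow> f1 (k (q' e)) = f2 e"
      using kq' by (auto simp: fiber_map_def over_base_def)
    from fiber_homotopic_cong[OF fiber_homotopic_precompose[OF qkh this(1)]] this(2)
    show ?thesis by (simp add: k'_def)
  qed
  ultimately have "fiber_homotopic E2 f2 E1 f1 (\<lambda>e. k' e) (\<lambda>e. k (q' e))"
    using fiber_homotopic_trans[OF fiber_homotopic_sym] by blast
  from fiber_homotopic_trans[OF fiber_homotopic_postcompose[OF this h] hkq']
  have "fiber_homotopic E2 f2 E2 f2 (\<lambda>e. h (k' e)) id" .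
  then show ?thesis
    unfolding fiber_homotopy_equivalent_def o_def
    using h k' qkh by (auto simp: k'_def)
qed

end

section \<open>Fiber homotopy equivalence implies conjugacy\<close>

lemma topspace_loop_space: "topspace (loop_space X r) = {\<alpha> \<in> paths X. \<alpha> 0 = r \<and> \<alpha> 1 = r}"
  by (auto simp: loop_space_def)

lemma continuous_map_loop_eval:
  assumes "continuous_map T (loop_space X r) w"
  shows "continuous_map (prod_topology T unit_interval) X (\<lambda>p. w (fst p) (snd p))"
proof -
  have "continuous_map T (path_space X) w"
    using assms unfolding loop_space_def by (rule continuous_map_into_fulltopology)
  then have "continuous_map (prod_topology T unit_interval) (prod_topology (path_space X) unit_interval)
      (\<lambda>p. (w (fst p), snd p))"
    by (intro continuous_map_pairedI continuous_map_snd continuous_map_comp[OF continuous_map_fst])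
  from continuous_map_comp[OF this continuous_map_path_eval] show ?thesis by simp
qed

lemma Lf_function_eq_transport:
  assumes "\<alpha> \<in> topspace (loop_space X r)"
  shows "Lf_function L (\<alpha>, e) = transport L e \<alpha>"
proof -
  have "restrict \<alpha> {0..1} = \<alpha>"
    using assms by (auto simp: topspace_loop_space paths_def extensional_restrict)
  then show ?thesis by (simp add: Lf_function_def transport_def)
qed

lemma fiber_homotopic_into_fibre_postcompose:
  assumes ab: "fiber_homotopic Z (\<lambda>_. r) E f a b"
    and g: "continuous_map (fibre E f r) (fibre E' f' r) g"
  shows "fiber_homotopic Z (\<lambda>_. r) E' f' (\<lambda>z. g (a z)) (\<lambda>z. g (b z))"
  using homotopic_with_compose_continuous_map_left[OF ab[folded homotopic_into_fibre_iff] g,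
      of "\<lambda>_. True"]
  by (simp add: homotopic_into_fibre_iff o_def)

lemma continuous_map_into_fibre_iff:
  "continuous_map Z (fibre E f r) y \<longleftrightarrow> fiber_map Z (\<lambda>_. r) E f y"
  by (auto simp: fibre_def continuous_map_in_subtopology fiber_map_def over_base_def)

text \<open>
  The fiber map \<open>k\<close> sends lifts of a loop to lifts of the same loop, so \<open>k\<close> applied to the transport
  of \<open>h e\<close> is homotopic to the transport of \<open>k (h e)\<close>, and \<open>k (h e)\<close> can be moved to \<open>e\<close> inside the
  fibre.
\<close>
lemma Lf_conjugate_if_fiber_homotopy_equivalent:
  assumes f1: "continuous_map E1 X f1" and M1: "regular_lifting_function E1 X f1 M1"
    and L1: "lifting_function E1 X f1 L1" and L2: "lifting_function E2 X f2 L2"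
    and eqv: "fiber_homotopy_equivalent E1 f1 E2 f2"
  shows "Lf_conjugate X r E1 f1 L1 E2 f2 L2"
proof -
  have M1': "lifting_function E1 X f1 M1" using M1 by (simp add: regular_lifting_function_def)
  obtain h k where h: "fiber_map E1 f1 E2 f2 h" and k: "fiber_map E2 f2 E1 f1 k"
    and kh: "fiber_homotopic E1 f1 E1 f1 (k \<circ> h) id"
    and hk: "fiber_homotopic E2 f2 E2 f2 (h \<circ> k) id"
    using eqv by (auto simp: fiber_homotopy_equivalent_def)
  have hc: "continuous_map E1 E2 h" "\<And>e. e \<in> topspace E1 \<Longrightarrow> f2 (h e) = f1 e"
    and kc: "continuous_map E2 E1 k" "\<And>e. e \<in> topspace E2 \<Longrightarrow> f1 (k e) = f2 e"
    using h k by (auto simp: fiber_map_def over_base_def)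
  let ?F1 = "fibre E1 f1 r" and ?F2 = "fibre E2 f2 r"
  have F: "continuous_map ?F1 E1 (\<lambda>e. e)" "continuous_map ?F2 E2 (\<lambda>e. e)"
    by (simp_all add: fibre_def continuous_map_id_subt[unfolded id_def])
  have Ftop: "topspace ?F1 = {e \<in> topspace E1. f1 e = r}" "topspace ?F2 = {e \<in> topspace E2. f2 e = r}"
    by (auto simp: fibre_def)
  have hF: "continuous_map ?F1 ?F2 h" and kF: "continuous_map ?F2 ?F1 k"
    using continuous_map_comp[OF F(1) hc(1)] hc(2) continuous_map_comp[OF F(2) kc(1)] kc(2)
    by (simp_all add: continuous_map_into_fibre_iff fiber_map_def over_base_def Ftop)
  have "homotopy_inverses ?F1 ?F2 h k"
    unfolding homotopy_inverses_def homotopic_into_fibre_iff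
    using hF kF fiber_homotopic_cong[OF fiber_homotopic_precompose[OF kh F(1)]]
      fiber_homotopic_cong[OF fiber_homotopic_precompose[OF hk F(2)]]
    by (simp add: Ftop)
  moreover
  let ?Z = "prod_topology (loop_space X r) ?F1"
  have fstZ: "continuous_map ?Z (loop_space X r) fst" by (rule continuous_map_fst)
  note \<gamma> = continuous_map_loop_eval[OF fstZ]
  have y: "continuous_map ?Z E1 snd" by (rule continuous_map_comp[OF continuous_map_snd F(1)])
  have ends: "fst z 0 = r" "fst z 1 = r" "snd z \<in> topspace E1" "f1 (snd z) = r"
    if "z \<in> topspace ?Z" for z
    using that by (auto simp: topspace_loop_space Ftop)
  have a: "fiber_homotopic ?Z (\<lambda>_. r) E1 f1 (\<lambda>z. transport L1 (snd z) (fst z))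
      (\<lambda>z. transport M1 (snd z) (fst z))"
    using fiber_homotopic_cong[OF transport_independent[OF M1 f1 L1 y \<gamma>]] ends by simp
  have khy: "fiber_homotopic ?Z (\<lambda>_. r) E1 f1 (\<lambda>z. k (h (snd z))) snd"
    using fiber_homotopic_cong[OF fiber_homotopic_precompose[OF kh y]] ends by simp
  have b: "fiber_homotopic ?Z (\<lambda>_. r) E1 f1 (\<lambda>z. transport M1 (k (h (snd z))) (fst z))
      (\<lambda>z. transport M1 (snd z) (fst z))"
    using fiber_homotopic_cong[OF transport_homotopic_start[OF M1' khy \<gamma>]] ends by simp
  have hy: "continuous_map ?Z E2 (\<lambda>z. h (snd z))" by (rule continuous_map_comp[OF y hc(1)])
  have hstart: "fst z 0 = f2 (h (snd z))" if "z \<in> topspace ?Z" for z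
    using ends[OF that] hc(2) by simp
  have lift2: "continuous_map (prod_topology ?Z unit_interval) E2
      (\<lambda>p. L2 (h (snd (fst p)), restrict (fst (fst p)) {0..1}) (snd p))"
    "\<And>z. z \<in> topspace ?Z \<Longrightarrow> L2 (h (snd z), restrict (fst z) {0..1}) 0 = h (snd z)"
    "\<And>z t. z \<in> topspace ?Z \<Longrightarrow> t \<in> {0..1} \<Longrightarrow>
      f2 (L2 (h (snd z), restrict (fst z) {0..1}) t) = fst z t"
    by (rule lift_continuous[OF L2 hy \<gamma> hstart]; assumption)+
  define G where "G = (\<lambda>z t. k (L2 (h (snd z), restrict (fst z) {0..1}) t))"
  have G: "continuous_map (prod_topology ?Z unit_interval) E1 (\<lambda>p. G (fst p) (snd p))"
    unfolding G_def by (rule continuous_map_comp[OF lift2(1) kc(1)])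
  have inE2: "L2 (h (snd z), restrict (fst z) {0..1}) t \<in> topspace E2"
    if "z \<in> topspace ?Z" "t \<in> {0..1}" for z t
    using continuous_map_image_subset_topspace[OF lift2(1)] that by (auto simp: image_subset_iff)
  have G0: "G z 0 = k (h (snd z))" if "z \<in> topspace ?Z" for z
    unfolding G_def by (simp only: lift2(2)[OF that])
  have fG: "f1 (G z t) = fst z t" if "z \<in> topspace ?Z" "t \<in> {0..1}" for z t
    unfolding G_def by (simp only: kc(2)[OF inE2[OF that]] lift2(3)[OF that])
  have "fiber_homotopic ?Z (\<lambda>_. r) E1 f1 (\<lambda>z. G z 1) (\<lambda>z. transport M1 (k (h (snd z))) (fst z))"
  proof (rule fiber_homotopic_cong[OF lift_end_homotopic_transport[OF M1 f1 G]])
    fix z assume z: "z \<in> topspace ?Z"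
    show "f1 (G z 1) = r" using fG[OF z, of 1] ends[OF z] by simp
    show "transport M1 (G z 0) (\<lambda>t. f1 (G z t)) = transport M1 (k (h (snd z))) (fst z)"
      unfolding G0[OF z] by (rule transport_cong) (rule fG[OF z])
  qed simp
  from fiber_homotopic_trans[OF a fiber_homotopic_sym[OF fiber_homotopic_trans[OF this b]]]
  have "fiber_homotopic ?Z (\<lambda>_. r) E1 f1 (Lf_function L1) (k \<circ> Lf_function L2 \<circ> map_prod id h)"
    by (rule fiber_homotopic_cong)
       (auto simp: Lf_function_eq_transport[of _ X r] G_def transport_def simp del: restrict_apply)
  ultimately show ?thesis
    unfolding Lf_conjugate_def homotopic_into_fibre_iff by blast
qed

section \<open>Conjugacy implies fiber homotopy equivalence\<close>

definition contraction_in :: "'b topology \<Rightarrow> 'b set \<Rightarrow> 'b \<Rightarrow> ('b \<times> real \<Rightarrow> 'b) \<Rightarrow> bool"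
  where "contraction_in X B r R \<longleftrightarrow>
    continuous_map (prod_topology (subtopology X B) unit_interval) X R \<and>
    (\<forall>x \<in> B. R (x, 0) = x \<and> R (x, 1) = r)"

text \<open>
  Conjugation of \<open>g\<close> by transport along the tracks of \<open>R\<close>; it turns a map of the fibres over the
  centre of the contraction into a fiber map over the contracted piece.
\<close>
definition spread ::
    "('e1 \<times> (real \<Rightarrow> 'b) \<Rightarrow> real \<Rightarrow> 'e1) \<Rightarrow> ('e2 \<times> (real \<Rightarrow> 'b) \<Rightarrow> real \<Rightarrow> 'e2) \<Rightarrow>
     ('e1 \<Rightarrow> 'b) \<Rightarrow> ('b \<times> real \<Rightarrow> 'b) \<Rightarrow> ('e1 \<Rightarrow> 'e2) \<Rightarrow> 'e1 \<Rightarrow> 'e2"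
  where "spread M1 M2 f1 R g e =
    transport M2 (g (transport M1 e (\<lambda>t. R (f1 e, t)))) (\<lambda>t. R (f1 e, 1 - t))"

lemma contraction_paths:
  assumes R: "contraction_in X B r R" and f: "continuous_map E X f" and C: "C \<subseteq> B"
  shows "continuous_map (prod_topology (over E f C) unit_interval) X (\<lambda>p. R (f (fst p), snd p))"
    and "continuous_map (prod_topology (over E f C) unit_interval) X (\<lambda>p. R (f (fst p), 1 - snd p))"
proof -
  have Rc: "continuous_map (prod_topology (subtopology X B) unit_interval) X R"
    using R by (simp add: contraction_in_def)
  let ?W = "prod_topology (over E f C) unit_interval"
  have "continuous_map (over E f C) (subtopology X B) f"
    using C by (intro continuous_map_into_subtopology continuous_map_from_subtopology f) auto
  then have p: "continuous_map ?W (subtopology X B) (\<lambda>p. f (fst p))"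
    by (rule continuous_map_comp[OF continuous_map_fst])
  from continuous_map_comp[OF continuous_map_pairedI[OF p continuous_map_snd] Rc]
  show "continuous_map ?W X (\<lambda>p. R (f (fst p), snd p))" .
  have "continuous_map ?W unit_interval (\<lambda>p. 1 - snd p)"
    by (rule continuous_map_unit_intervalI,
        (rule continuous_map_real_intros continuous_map_proj_intros)+) auto
  from continuous_map_comp[OF continuous_map_pairedI[OF p this] Rc]
  show "continuous_map ?W X (\<lambda>p. R (f (fst p), 1 - snd p))" .
qed

lemma transport_to_fibre:
  assumes M: "lifting_function E X f M" and f: "continuous_map E X f"
    and R: "contraction_in X B r R" and C: "C \<subseteq> B"
  shows "fiber_map (over E f C) (\<lambda>_. r) E f (\<lambda>e. transport M e (\<lambda>t. R (f e, t)))"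
proof -
  have "continuous_map (over E f C) E (\<lambda>e. e)"
    by (simp add: continuous_map_id_subt[unfolded id_def])
  then have "fiber_map (over E f C) (\<lambda>e. R (f e, 1)) E f (\<lambda>e. transport M e (\<lambda>t. R (f e, t)))"
    by (rule transport_fiber_map[OF M _ contraction_paths(1)[OF R f C]])
       (use R C in \<open>auto simp: contraction_in_def\<close>)
  then show ?thesis using R C by (auto simp: fiber_map_def over_base_def contraction_in_def)
qed

lemma spread_fiber_map:
  assumes M1: "lifting_function E1 X f1 M1" and f1: "continuous_map E1 X f1"
    and M2: "lifting_function E2 X f2 M2"
    and R: "contraction_in X B r R" and C: "C \<subseteq> B"
    and g: "continuous_map (fibre E1 f1 r) (fibre E2 f2 r) g"
  shows "fiber_map (over E1 f1 C) f1 E2 f2 (spread M1 M2 f1 R g)"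
proof -
  let ?y = "\<lambda>e. g (transport M1 e (\<lambda>t. R (f1 e, t)))"
  have "continuous_map (over E1 f1 C) (fibre E2 f2 r) ?y"
    using transport_to_fibre[OF M1 f1 R C] g
    unfolding continuous_map_into_fibre_iff[symmetric] by (rule continuous_map_comp)
  then have y: "continuous_map (over E1 f1 C) E2 ?y"
    and fy: "\<And>e. e \<in> topspace (over E1 f1 C) \<Longrightarrow> f2 (?y e) = r"
    unfolding continuous_map_into_fibre_iff by (auto simp: fiber_map_def over_base_def)
  have "fiber_map (over E1 f1 C) (\<lambda>e. R (f1 e, 1 - 1)) E2 f2 (spread M1 M2 f1 R g)"
    unfolding spread_def
    by (rule transport_fiber_map[OF M2 y contraction_paths(2)[OF R f1 C]])
       (use R C fy in \<open>auto simp: contraction_in_def\<close>)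
  then show ?thesis using R C by (auto simp: fiber_map_def over_base_def contraction_in_def)
qed

text \<open>
  The two inner transports run back and forth along the same track and cancel, \<open>g' \<circ> g\<close> disappears,
  and then the two outer transports cancel.
\<close>
lemma spread_inverse:
  assumes M1: "regular_lifting_function E1 X f1 M1" and f1: "continuous_map E1 X f1"
    and M2: "regular_lifting_function E2 X f2 M2" and f2: "continuous_map E2 X f2"
    and R: "contraction_in X B r R"
    and g: "continuous_map (fibre E1 f1 r) (fibre E2 f2 r) g"
    and g': "continuous_map (fibre E2 f2 r) (fibre E1 f1 r) g'"
    and g'g: "homotopic_with (\<lambda>_. True) (fibre E1 f1 r) (fibre E1 f1 r) (g' \<circ> g) id"
  shows "fiber_homotopic (over E1 f1 B) f1 E1 f1
    (\<lambda>e. spread M2 M1 f2 R g' (spread M1 M2 f1 R g e)) id"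
proof -
  have M1': "lifting_function E1 X f1 M1" and M2': "lifting_function E2 X f2 M2"
    using M1 M2 by (simp_all add: regular_lifting_function_def)
  let ?Z = "over E1 f1 B"
  define \<rho> where "\<rho> = (\<lambda>e t. R (f1 e, t))"
  define \<rho>' where "\<rho>' = (\<lambda>e t. R (f1 e, 1 - t))"
  define x where "x = (\<lambda>e. transport M1 e (\<rho> e))"
  let ?y = "\<lambda>e. g (x e)"
  note paths = contraction_paths[OF R f1 order.refl]
  have c\<rho>: "continuous_map (prod_topology ?Z unit_interval) X (\<lambda>p. \<rho> (fst p) (snd p))"
    using paths(1) by (simp add: \<rho>_def)
  have c\<rho>': "continuous_map (prod_topology ?Z unit_interval) X (\<lambda>p. \<rho>' (fst p) (snd p))"
    using paths(2) by (simp add: \<rho>'_def)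
  have ends: "\<rho> e 0 = f1 e" "\<rho> e 1 = r" "\<rho>' e 0 = r" "\<rho>' e 1 = f1 e" if "e \<in> topspace ?Z" for e
    using that R by (auto simp: \<rho>_def \<rho>'_def contraction_in_def)
  have rev: "(\<lambda>t. \<rho>' e (1 - t)) = \<rho> e" "(\<lambda>t. \<rho> e (1 - t)) = \<rho>' e" for e
    by (simp_all add: \<rho>_def \<rho>'_def)
  have xF: "continuous_map ?Z (fibre E1 f1 r) x"
    using transport_to_fibre[OF M1' f1 R order.refl]
    by (simp add: continuous_map_into_fibre_iff x_def \<rho>_def)
  have yF: "continuous_map ?Z (fibre E2 f2 r) ?y" by (rule continuous_map_comp[OF xF g])
  then have y: "continuous_map ?Z E2 ?y" and fy: "\<And>e. e \<in> topspace ?Z \<Longrightarrow> f2 (?y e) = r"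
    unfolding continuous_map_into_fibre_iff by (auto simp: fiber_map_def over_base_def)
  let ?c = "spread M1 M2 f1 R g"
  have c: "?c e = transport M2 (?y e) (\<rho>' e)" for e
    by (simp add: spread_def x_def \<rho>_def \<rho>'_def)
  have fc: "f2 (?c e) = f1 e" if "e \<in> topspace ?Z" for e
    using spread_fiber_map[OF M1' f1 M2' R order.refl g] that
    by (simp add: fiber_map_def over_base_def)
  have idZ: "continuous_map ?Z E1 (\<lambda>e. e)" by (simp add: continuous_map_id_subt[unfolded id_def])
  have "fiber_homotopic ?Z (\<lambda>e. f2 (?y e)) E2 f2
      (\<lambda>e. transport M2 (transport M2 (?y e) (\<rho>' e)) (\<lambda>t. \<rho>' e (1 - t))) ?y"
    by (rule transport_back_homotopic_id[OF M2 y c\<rho>']) (use ends fy in auto)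
  then have "fiber_homotopic ?Z (\<lambda>_. r) E2 f2 (\<lambda>e. transport M2 (?c e) (\<rho> e)) ?y"
    by (rule fiber_homotopic_cong) (use fy in \<open>auto simp: c rev\<close>)
  then have "fiber_homotopic ?Z (\<lambda>_. r) E1 f1 (\<lambda>e. g' (transport M2 (?c e) (\<rho> e))) (\<lambda>e. g' (?y e))"
    by (rule fiber_homotopic_into_fibre_postcompose[OF _ g'])
  also have "fiber_homotopic ?Z (\<lambda>_. r) E1 f1 (\<lambda>e. g' (?y e)) x"
    using fiber_homotopic_precompose[OF g'g[unfolded homotopic_into_fibre_iff] xF] by simp
  finally have "fiber_homotopic ?Z (\<lambda>e. \<rho>' e 1) E1 f1
      (\<lambda>e. transport M1 (g' (transport M2 (?c e) (\<rho> e))) (\<rho>' e)) (\<lambda>e. transport M1 (x e) (\<rho>' e))"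
    by (rule transport_homotopic_start[OF M1' _ c\<rho>']) (use ends in auto)
  then have "fiber_homotopic ?Z f1 E1 f1
      (\<lambda>e. transport M1 (g' (transport M2 (?c e) (\<rho> e))) (\<rho>' e)) (\<lambda>e. transport M1 (x e) (\<rho>' e))"
    by (rule fiber_homotopic_cong) (use ends in auto)
  also have "fiber_homotopic ?Z f1 E1 f1 (\<lambda>e. transport M1 (x e) (\<rho>' e)) (\<lambda>e. e)"
    using transport_back_homotopic_id[OF M1 idZ c\<rho>] ends by (simp add: x_def rev)
  finally show ?thesis
    by (rule fiber_homotopic_cong)
       (auto simp: fc spread_def[of M2 M1] \<rho>_def \<rho>'_def)
qed

text \<open>
  Write \<open>\<sigma>\<close> and \<open>\<rho>\<close> for the tracks of \<open>R2\<close> and \<open>R1\<close> and \<open>\<omega>\<close> for the loop at \<open>r\<close> that runs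
  back along \<open>\<sigma>\<close> and then along \<open>\<rho>\<close>. Up to homotopy, transport along \<open>\<rho>\<close> is transport along \<open>\<sigma>\<close>
  followed by transport around \<open>\<omega>\<close>, in both fibrations; conjugacy moves \<open>g\<close> past the transport around \<open>\<omega>\<close>.
\<close>
lemma spread_independent_of_contraction:
  assumes M1: "regular_lifting_function E1 X f1 M1" and f1: "continuous_map E1 X f1"
    and M2: "regular_lifting_function E2 X f2 M2" and f2: "continuous_map E2 X f2"
    and L1: "lifting_function E1 X f1 L1" and L2: "lifting_function E2 X f2 L2"
    and R1: "contraction_in X X1 r R1" and R2: "contraction_in X X2 r R2"
    and g: "continuous_map (fibre E1 f1 r) (fibre E2 f2 r) g"
    and conj: "fiber_homotopic (prod_topology (loop_space X r) (fibre E1 f1 r)) (\<lambda>_. r) E2 f2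
       (\<lambda>z. g (transport L1 (snd z) (fst z))) (\<lambda>z. transport L2 (g (snd z)) (fst z))"
  shows "fiber_homotopic (over E1 f1 (X1 \<inter> X2)) f1 E2 f2
     (spread M1 M2 f1 R1 g) (spread M1 M2 f1 R2 g)"
proof -
  have M1': "lifting_function E1 X f1 M1" and M2': "lifting_function E2 X f2 M2"
    using M1 M2 by (simp_all add: regular_lifting_function_def)
  let ?Z = "over E1 f1 (X1 \<inter> X2)"
  define \<rho> where "\<rho> = (\<lambda>e t. R1 (f1 e, t))"
  define \<rho>' where "\<rho>' = (\<lambda>e t. R1 (f1 e, 1 - t))"
  define \<sigma> where "\<sigma> = (\<lambda>e t. R2 (f1 e, t))"
  define \<sigma>' where "\<sigma>' = (\<lambda>e t. R2 (f1 e, 1 - t))"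
  note paths1 = contraction_paths[OF R1 f1 Int_lower1[of X1 X2]]
  note paths2 = contraction_paths[OF R2 f1 Int_lower2[of X1 X2]]
  have c\<rho>: "continuous_map (prod_topology ?Z unit_interval) X (\<lambda>p. \<rho> (fst p) (snd p))"
    using paths1(1) by (simp add: \<rho>_def)
  have c\<rho>': "continuous_map (prod_topology ?Z unit_interval) X (\<lambda>p. \<rho>' (fst p) (snd p))"
    using paths1(2) by (simp add: \<rho>'_def)
  have c\<sigma>: "continuous_map (prod_topology ?Z unit_interval) X (\<lambda>p. \<sigma> (fst p) (snd p))"
    using paths2(1) by (simp add: \<sigma>_def)
  have c\<sigma>': "continuous_map (prod_topology ?Z unit_interval) X (\<lambda>p. \<sigma>' (fst p) (snd p))"
    using paths2(2) by (simp add: \<sigma>'_def)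
  have ends: "\<rho> e 0 = f1 e" "\<rho> e 1 = r" "\<rho>' e 0 = r" "\<rho>' e 1 = f1 e"
    "\<sigma> e 0 = f1 e" "\<sigma> e 1 = r" "\<sigma>' e 0 = r" "\<sigma>' e 1 = f1 e" if "e \<in> topspace ?Z" for e
    using that R1 R2 by (auto simp: \<rho>_def \<rho>'_def \<sigma>_def \<sigma>'_def contraction_in_def)
  have rev: "(\<lambda>t. \<sigma> e (1 - t)) = \<sigma>' e" "(\<lambda>t. \<rho> e (1 - t)) = \<rho>' e" for e
    by (simp_all add: \<rho>_def \<rho>'_def \<sigma>_def \<sigma>'_def)
  have idZ: "continuous_map ?Z E1 (\<lambda>e. e)" by (simp add: continuous_map_id_subt[unfolded id_def])
  define y where "y = (\<lambda>e. transport M1 e (\<sigma> e))"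
  define x where "x = (\<lambda>e. transport M1 e (\<rho> e))"
  have yF: "continuous_map ?Z (fibre E1 f1 r) y"
    using transport_to_fibre[OF M1' f1 R2 Int_lower2]
    by (simp add: continuous_map_into_fibre_iff y_def \<sigma>_def)
  then have y: "continuous_map ?Z E1 y" and fy: "\<And>e. e \<in> topspace ?Z \<Longrightarrow> f1 (y e) = r"
    unfolding continuous_map_into_fibre_iff by (auto simp: fiber_map_def over_base_def)
  have "continuous_map ?Z (fibre E2 f2 r) (\<lambda>e. g (y e))" by (rule continuous_map_comp[OF yF g])
  then have gy: "continuous_map ?Z E2 (\<lambda>e. g (y e))"
    and fgy: "\<And>e. e \<in> topspace ?Z \<Longrightarrow> f2 (g (y e)) = r"
    unfolding continuous_map_into_fibre_iff by (auto simp: fiber_map_def over_base_def)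
  let ?c1 = "spread M1 M2 f1 R1 g" and ?c2 = "spread M1 M2 f1 R2 g"
  have c1: "?c1 e = transport M2 (g (x e)) (\<rho>' e)" and c2: "?c2 e = transport M2 (g (y e)) (\<sigma>' e)" for e
    by (simp_all add: spread_def x_def y_def \<rho>_def \<rho>'_def \<sigma>_def \<sigma>'_def)
  have c2m: "continuous_map ?Z E2 ?c2" and fc2: "\<And>e. e \<in> topspace ?Z \<Longrightarrow> f2 (?c2 e) = f1 e"
    using spread_fiber_map[OF M1' f1 M2' R2 Int_lower2 g]
    by (auto simp: fiber_map_def over_base_def)
  define \<omega> where "\<omega> = (\<lambda>e. restrict (path_concat (\<sigma>' e) (\<rho> e)) {0..1})"
  have meet: "\<sigma>' e 1 = \<rho> e 0" if "e \<in> topspace ?Z" for e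
    using ends[OF that] by simp
  have \<omega>: "continuous_map ?Z (loop_space X r) \<omega>"
    unfolding loop_space_def
  proof (rule continuous_map_into_subtopology)
    show "continuous_map ?Z (path_space X) \<omega>"
      using continuous_map_into_path_space[OF path_concat_continuous[OF c\<sigma>' c\<rho> meet]]
      by (simp add: \<omega>_def restrict_def)
    show "\<omega> \<in> topspace ?Z \<rightarrow> {\<alpha>. \<alpha> 0 = r \<and> \<alpha> 1 = r}"
      using ends by (auto simp: \<omega>_def path_concat_def)
  qed
  have "fiber_homotopic ?Z (\<lambda>e. \<rho> e 1) E1 f1
      (\<lambda>e. transport L1 (y e) (path_concat (\<sigma>' e) (\<rho> e)))
      (\<lambda>e. transport M1 (transport M1 (y e) (\<sigma>' e)) (\<rho> e))"
    by (rule transport_concat[OF M1 f1 L1 y c\<sigma>' c\<rho>]) (use ends fy in auto)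
  also have "fiber_homotopic ?Z (\<lambda>e. \<rho> e 1) E1 f1
      (\<lambda>e. transport M1 (transport M1 (y e) (\<sigma>' e)) (\<rho> e)) x"
  proof -
    have "fiber_homotopic ?Z f1 E1 f1 (\<lambda>e. transport M1 (y e) (\<sigma>' e)) (\<lambda>e. e)"
      using transport_back_homotopic_id[OF M1 idZ c\<sigma>] ends by (simp add: y_def rev)
    from transport_homotopic_start[OF M1' this c\<rho>] ends show ?thesis by (simp add: x_def)
  qed
  finally have "fiber_homotopic ?Z (\<lambda>_. r) E1 f1 (\<lambda>e. transport L1 (y e) (\<omega> e)) x"
    by (rule fiber_homotopic_cong) (use ends in \<open>auto simp: \<omega>_def transport_restrict\<close>)
  from fiber_homotopic_into_fibre_postcompose[OF fiber_homotopic_sym[OF this] g]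
  have "fiber_homotopic ?Z (\<lambda>_. r) E2 f2 (\<lambda>e. g (x e)) (\<lambda>e. g (transport L1 (y e) (\<omega> e)))" .
  also have "fiber_homotopic ?Z (\<lambda>_. r) E2 f2 (\<lambda>e. g (transport L1 (y e) (\<omega> e)))
      (\<lambda>e. transport L2 (g (y e)) (\<omega> e))"
    using fiber_homotopic_precompose[OF conj continuous_map_pairedI[OF \<omega> yF]] by simp
  also have "fiber_homotopic ?Z (\<lambda>_. r) E2 f2 (\<lambda>e. transport L2 (g (y e)) (\<omega> e))
      (\<lambda>e. transport M2 (?c2 e) (\<rho> e))"
  proof -
    have "fiber_homotopic ?Z (\<lambda>e. \<rho> e 1) E2 f2
        (\<lambda>e. transport L2 (g (y e)) (path_concat (\<sigma>' e) (\<rho> e)))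
        (\<lambda>e. transport M2 (transport M2 (g (y e)) (\<sigma>' e)) (\<rho> e))"
      by (rule transport_concat[OF M2 f2 L2 gy c\<sigma>' c\<rho>]) (use ends fgy in auto)
    then show ?thesis
      by (rule fiber_homotopic_cong) (use ends in \<open>auto simp: \<omega>_def transport_restrict c2\<close>)
  qed
  finally have "fiber_homotopic ?Z (\<lambda>e. \<rho>' e 1) E2 f2
      ?c1 (\<lambda>e. transport M2 (transport M2 (?c2 e) (\<rho> e)) (\<rho>' e))"
    unfolding c1 by (rule transport_homotopic_start[OF M2' _ c\<rho>']) (use ends in auto)
  then have "fiber_homotopic ?Z f1 E2 f2
      ?c1 (\<lambda>e. transport M2 (transport M2 (?c2 e) (\<rho> e)) (\<rho>' e))"
    by (rule fiber_homotopic_cong) (use ends in auto)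
  also have "fiber_homotopic ?Z f1 E2 f2
      (\<lambda>e. transport M2 (transport M2 (?c2 e) (\<rho> e)) (\<rho>' e)) ?c2"
  proof -
    have "fiber_homotopic ?Z (\<lambda>e. f2 (?c2 e)) E2 f2
        (\<lambda>e. transport M2 (transport M2 (?c2 e) (\<rho> e)) (\<lambda>t. \<rho> e (1 - t))) ?c2"
      by (rule transport_back_homotopic_id[OF M2 c2m c\<rho>]) (use ends fc2 in auto)
    then show ?thesis by (rule fiber_homotopic_cong) (use fc2 in \<open>auto simp: rev\<close>)
  qed
  finally show ?thesis .
qed

text \<open>
  Since \<open>g\<close> and \<open>g'\<close> are homotopy inverse, conjugacy is symmetric: both of them commute with transport around
  loops up to homotopy.
\<close>
lemma Lf_conjugate_transport:
  assumes L1: "lifting_function E1 X f1 L1" and L2: "lifting_function E2 X f2 L2"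
    and conj: "Lf_conjugate X r E1 f1 L1 E2 f2 L2"
  obtains g g' where "homotopy_inverses (fibre E1 f1 r) (fibre E2 f2 r) g g'"
    and "fiber_homotopic (prod_topology (loop_space X r) (fibre E1 f1 r)) (\<lambda>_. r) E2 f2
       (\<lambda>z. g (transport L1 (snd z) (fst z))) (\<lambda>z. transport L2 (g (snd z)) (fst z))"
    and "fiber_homotopic (prod_topology (loop_space X r) (fibre E2 f2 r)) (\<lambda>_. r) E1 f1
       (\<lambda>z. g' (transport L2 (snd z) (fst z))) (\<lambda>z. transport L1 (g' (snd z)) (fst z))"
proof -
  let ?F1 = "fibre E1 f1 r" and ?F2 = "fibre E2 f2 r"
  let ?Z1 = "prod_topology (loop_space X r) ?F1" and ?Z2 = "prod_topology (loop_space X r) ?F2"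
  obtain g g' where inv: "homotopy_inverses ?F1 ?F2 g g'"
    and hom: "fiber_homotopic ?Z1 (\<lambda>_. r) E1 f1 (Lf_function L1) (g' \<circ> Lf_function L2 \<circ> map_prod id g)"
    using conj unfolding Lf_conjugate_def homotopic_into_fibre_iff by blast
  have g: "continuous_map ?F1 ?F2 g" and g': "continuous_map ?F2 ?F1 g'"
    and g'g: "fiber_homotopic ?F1 (\<lambda>_. r) E1 f1 (g' \<circ> g) id"
    and gg': "fiber_homotopic ?F2 (\<lambda>_. r) E2 f2 (g \<circ> g') id"
    using inv by (auto simp: homotopy_inverses_def homotopic_into_fibre_iff)
  have main: "fiber_homotopic ?Z1 (\<lambda>_. r) E1 f1 (\<lambda>z. transport L1 (snd z) (fst z))
      (\<lambda>z. g' (transport L2 (g (snd z)) (fst z)))"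
    using hom by (rule fiber_homotopic_cong) (auto simp: Lf_function_eq_transport[of _ X r])
  have \<Theta>2: "continuous_map (prod_topology (loop_space X r) Y) ?F2 (\<lambda>z. transport L2 (y (snd z)) (fst z))"
    if y: "continuous_map Y ?F2 y" for Y :: "'z topology" and y
  proof -
    let ?Z = "prod_topology (loop_space X r) Y"
    have "continuous_map ?Z ?F2 (\<lambda>z. y (snd z))" by (rule continuous_map_comp[OF continuous_map_snd y])
    then have yZ: "continuous_map ?Z E2 (\<lambda>z. y (snd z))"
      and fy: "\<And>z. z \<in> topspace ?Z \<Longrightarrow> f2 (y (snd z)) = r"
      unfolding continuous_map_into_fibre_iff by (auto simp: fiber_map_def over_base_def)
    have "fiber_map ?Z (\<lambda>z. fst z 1) E2 f2 (\<lambda>z. transport L2 (y (snd z)) (fst z))"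
      by (rule transport_fiber_map[OF L2 yZ continuous_map_loop_eval[OF continuous_map_fst]])
         (use fy in \<open>auto simp: topspace_loop_space\<close>)
    then show ?thesis
      unfolding continuous_map_into_fibre_iff
      by (auto simp: fiber_map_def over_base_def topspace_loop_space)
  qed
  have 1: "fiber_homotopic ?Z1 (\<lambda>_. r) E2 f2
       (\<lambda>z. g (transport L1 (snd z) (fst z))) (\<lambda>z. transport L2 (g (snd z)) (fst z))"
    using fiber_homotopic_trans[OF fiber_homotopic_into_fibre_postcompose[OF main g]
        fiber_homotopic_precompose[OF gg' \<Theta>2[OF g], unfolded o_def id_def]] .
  have "continuous_map ?Z2 ?Z1 (\<lambda>z. (fst z, g' (snd z)))"
    by (intro continuous_map_pairedI continuous_map_fst continuous_map_comp[OF continuous_map_snd g'])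
  from fiber_homotopic_precompose[OF main this]
  have "fiber_homotopic ?Z2 (\<lambda>_. r) E1 f1 (\<lambda>z. transport L1 (g' (snd z)) (fst z))
      (\<lambda>z. g' (transport L2 (g (g' (snd z))) (fst z)))" by simp
  also have "fiber_homotopic ?Z2 (\<lambda>_. r) E1 f1 (\<lambda>z. g' (transport L2 (g (g' (snd z))) (fst z)))
      (\<lambda>z. g' (transport L2 (snd z) (fst z)))"
  proof (rule fiber_homotopic_into_fibre_postcompose[OF _ g'])
    have "fiber_homotopic ?Z2 (\<lambda>_. r) E2 f2 (\<lambda>z. g (g' (snd z))) snd"
      using fiber_homotopic_precompose[OF gg' continuous_map_snd] by simp
    then have "fiber_homotopic ?Z2 (\<lambda>z. fst z 1) E2 f2
        (\<lambda>z. transport L2 (g (g' (snd z))) (fst z)) (\<lambda>z. transport L2 (snd z) (fst z))"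
      by (rule transport_homotopic_start[OF L2 _ continuous_map_loop_eval[OF continuous_map_fst]])
         (auto simp: topspace_loop_space)
    then show "fiber_homotopic ?Z2 (\<lambda>_. r) E2 f2
        (\<lambda>z. transport L2 (g (g' (snd z))) (fst z)) (\<lambda>z. transport L2 (snd z) (fst z))"
      by (rule fiber_homotopic_cong) (auto simp: topspace_loop_space)
  qed
  finally have 2: "fiber_homotopic ?Z2 (\<lambda>_. r) E1 f1
       (\<lambda>z. g' (transport L2 (snd z) (fst z))) (\<lambda>z. transport L1 (g' (snd z)) (fst z))"
    by (rule fiber_homotopic_sym)
  from inv 1 2 show ?thesis by (rule that)
qed

context ndr_cover
begin

lemma spread_global:
  assumes M1: "regular_lifting_function E1 X f1 M1" and f1: "continuous_map E1 X f1"
    and M2: "regular_lifting_function E2 X f2 M2" and f2: "continuous_map E2 X f2"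
    and L1: "lifting_function E1 X f1 L1" and L2: "lifting_function E2 X f2 L2"
    and R1: "contraction_in X X1 r R1" and R2: "contraction_in X X2 r R2"
    and g: "continuous_map (fibre E1 f1 r) (fibre E2 f2 r) g"
    and conj: "fiber_homotopic (prod_topology (loop_space X r) (fibre E1 f1 r)) (\<lambda>_. r) E2 f2
       (\<lambda>z. g (transport L1 (snd z) (fst z))) (\<lambda>z. transport L2 (g (snd z)) (fst z))"
  obtains h where "fiber_map E1 f1 E2 f2 h"
    and "fiber_homotopic (over E1 f1 X1) f1 E2 f2 h (spread M1 M2 f1 R1 g)"
    and "fiber_homotopic (over E1 f1 X2) f1 E2 f2 h (spread M1 M2 f1 R2 g)"
proof -
  have M: "lifting_function E1 X f1 M1" "lifting_function E2 X f2 M2"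
    using M1 M2 by (simp_all add: regular_lifting_function_def)
  show ?thesis
    using fiber_map_from_pieces[OF M1 f1 M2 f2
        spread_fiber_map[OF M(1) f1 M(2) R1 order.refl g]
        spread_fiber_map[OF M(1) f1 M(2) R2 order.refl g]
        spread_independent_of_contraction[OF M1 f1 M2 f2 L1 L2 R1 R2 g conj]] that by blast
qed

lemma composite_homotopic_id_over:
  assumes h: "fiber_map E1 f1 E2 f2 h" and k: "fiber_map E2 f2 E1 f1 k"
    and ha: "fiber_homotopic (over E1 f1 B) f1 E2 f2 h a"
    and kb: "fiber_homotopic (over E2 f2 B) f2 E1 f1 k b"
    and ba: "fiber_homotopic (over E1 f1 B) f1 E1 f1 (\<lambda>e. b (a e)) id"
  shows "fiber_homotopic (over E1 f1 B) f1 E1 f1 (\<lambda>e. k (h e)) id"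
proof -
  have a: "fiber_map (over E1 f1 B) f1 E2 f2 a" using fiber_homotopic_imp_fiber_map(2)[OF ha] .
  then have ac: "continuous_map (over E1 f1 B) (over E2 f2 B) a"
    and fa: "\<And>e. e \<in> topspace (over E1 f1 B) \<Longrightarrow> f2 (a e) = f1 e"
    by (auto simp: fiber_map_def over_base_def intro!: continuous_map_into_subtopology)
  have "fiber_homotopic (over E1 f1 B) f1 E1 f1 (\<lambda>e. k (a e)) (\<lambda>e. b (a e))"
    by (rule fiber_homotopic_cong[OF fiber_homotopic_precompose[OF kb ac] fa]) auto
  from fiber_homotopic_trans[OF fiber_homotopic_trans[OF fiber_homotopic_postcompose[OF ha k] this] ba]
  show ?thesis .
qed

proposition fiber_homotopy_equivalent_if_Lf_conjugate:
  assumes M1: "regular_lifting_function E1 X f1 M1" and f1: "continuous_map E1 X f1"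
    and M2: "regular_lifting_function E2 X f2 M2" and f2: "continuous_map E2 X f2"
    and L1: "lifting_function E1 X f1 L1" and L2: "lifting_function E2 X f2 L2"
    and R1: "contraction_in X X1 r R1" and R2: "contraction_in X X2 r R2"
    and conj: "Lf_conjugate X r E1 f1 L1 E2 f2 L2"
  shows "fiber_homotopy_equivalent E1 f1 E2 f2"
proof -
  obtain g g' where inv: "homotopy_inverses (fibre E1 f1 r) (fibre E2 f2 r) g g'"
    and 1: "fiber_homotopic (prod_topology (loop_space X r) (fibre E1 f1 r)) (\<lambda>_. r) E2 f2
       (\<lambda>z. g (transport L1 (snd z) (fst z))) (\<lambda>z. transport L2 (g (snd z)) (fst z))"
    and 2: "fiber_homotopic (prod_topology (loop_space X r) (fibre E2 f2 r)) (\<lambda>_. r) E1 f1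
       (\<lambda>z. g' (transport L2 (snd z) (fst z))) (\<lambda>z. transport L1 (g' (snd z)) (fst z))"
    using Lf_conjugate_transport[OF L1 L2 conj] by blast
  have g: "continuous_map (fibre E1 f1 r) (fibre E2 f2 r) g"
    and g': "continuous_map (fibre E2 f2 r) (fibre E1 f1 r) g'"
    and g'g: "homotopic_with (\<lambda>_. True) (fibre E1 f1 r) (fibre E1 f1 r) (g' \<circ> g) id"
    and gg': "homotopic_with (\<lambda>_. True) (fibre E2 f2 r) (fibre E2 f2 r) (g \<circ> g') id"
    using inv by (auto simp: homotopy_inverses_def)
  obtain h where h: "fiber_map E1 f1 E2 f2 h"
    and h1: "fiber_homotopic (over E1 f1 X1) f1 E2 f2 h (spread M1 M2 f1 R1 g)"
    and h2: "fiber_homotopic (over E1 f1 X2) f1 E2 f2 h (spread M1 M2 f1 R2 g)"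
    using spread_global[OF M1 f1 M2 f2 L1 L2 R1 R2 g 1] .
  obtain k where k: "fiber_map E2 f2 E1 f1 k"
    and k1: "fiber_homotopic (over E2 f2 X1) f2 E1 f1 k (spread M2 M1 f2 R1 g')"
    and k2: "fiber_homotopic (over E2 f2 X2) f2 E1 f1 k (spread M2 M1 f2 R2 g')"
    using spread_global[OF M2 f2 M1 f1 L2 L1 R1 R2 g' 2] .
  have comp: "fiber_map E1 f1 E1 f1 (\<lambda>e. k (h e))" "fiber_map E2 f2 E2 f2 (\<lambda>e. h (k e))"
    using h k continuous_map_comp[of E1 E2 h E1 k] continuous_map_comp[of E2 E1 k E2 h]
    by (auto simp: fiber_map_def over_base_def continuous_map_def Pi_iff)
  have "locally_id E1 f1 (\<lambda>e. k (h e))"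
    unfolding locally_id_def
    using comp(1) composite_homotopic_id_over[OF h k h1 k1 spread_inverse[OF M1 f1 M2 f2 R1 g g' g'g]]
      composite_homotopic_id_over[OF h k h2 k2 spread_inverse[OF M1 f1 M2 f2 R2 g g' g'g]] by blast
  moreover have "locally_id E2 f2 (\<lambda>e. h (k e))"
    unfolding locally_id_def
    using comp(2) composite_homotopic_id_over[OF k h k1 h1 spread_inverse[OF M2 f2 M1 f1 R1 g' g gg']]
      composite_homotopic_id_over[OF k h k2 h2 spread_inverse[OF M2 f2 M1 f1 R2 g' g gg']] by blast
  ultimately show ?thesis
    by (rule fiber_homotopy_equivalent_if_locally_inverse[OF M1 f1 M2 f2 h k])
qed

end

theorem theorem1p2:
  fixes X :: "'b topology" and E1 :: "'e1 topology" and E2 :: "'e2 topology"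
    and f1 :: "'e1 \<Rightarrow> 'b" and f2 :: "'e2 \<Rightarrow> 'b"
    and L1 :: "'e1 \<times> (real \<Rightarrow> 'b) \<Rightarrow> real \<Rightarrow> 'e1" and L2 :: "'e2 \<times> (real \<Rightarrow> 'b) \<Rightarrow> real \<Rightarrow> 'e2"
    and K :: "'v set set" and \<phi> :: "('v \<Rightarrow> real) \<Rightarrow> 'b"
    and X1 X2 :: "'b set" and r :: 'b
  assumes "Hausdorff_space E1" and "Hausdorff_space E2" and "Hausdorff_space X"
    and "topological_polyhedron X K \<phi>"
    and "regular_fibration E1 X f1" and "regular_fibration E2 X f2"
    and "lifting_function E1 X f1 L1" and "lifting_function E2 X f2 L2"
    and "topspace X = X1 \<union> X2"
    and "subpolyhedron X K \<phi> X1" and "subpolyhedron X K \<phi> X2"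
    and "r \<in> X1 \<inter> X2"
    and "\<exists>R1. continuous_map (prod_topology (subtopology X X1) unit_interval) X R1 \<and>
              (\<forall>x \<in> X1. R1 (x, 0) = x \<and> R1 (x, 1) = r) \<and> (\<forall>t \<in> {0..1}. R1 (r, t) = r)"
    and "\<exists>R2. continuous_map (prod_topology (subtopology X X2) unit_interval) (subtopology X X2) R2 \<and>
              (\<forall>x \<in> X2. R2 (x, 0) = x \<and> R2 (x, 1) = r)"
    and "subpolyhedron X K \<phi> (X1 \<inter> X2)"
  shows "fiber_homotopy_equivalent E1 f1 E2 f2 \<longleftrightarrow> Lf_conjugate X r E1 f1 L1 E2 f2 L2"
proof
  obtain M1 where M1: "regular_lifting_function E1 X f1 M1" and f1: "continuous_map E1 X f1"
    using assms(5) by (auto simp: regular_fibration_def hurewicz_fibration_def)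
  obtain M2 where M2: "regular_lifting_function E2 X f2 M2" and f2: "continuous_map E2 X f2"
    using assms(6) by (auto simp: regular_fibration_def hurewicz_fibration_def)
  note L = \<open>lifting_function E1 X f1 L1\<close> \<open>lifting_function E2 X f2 L2\<close>
  show "Lf_conjugate X r E1 f1 L1 E2 f2 L2" if "fiber_homotopy_equivalent E1 f1 E2 f2"
    using Lf_conjugate_if_fiber_homotopy_equivalent[OF f1 M1 L that] .
  obtain R1 where R1: "contraction_in X X1 r R1"
    using assms(13) by (auto simp: contraction_in_def)
  obtain R2 where R2: "contraction_in X X2 r R2"
    using assms(14) by (auto simp: contraction_in_def intro: continuous_map_into_fulltopology)
  obtain D u where "ndr_cover X X1 X2 D u"
    using ndr_cover_subpolyhedra[OF assms(4,10,11,9)] .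
  then show "fiber_homotopy_equivalent E1 f1 E2 f2" if "Lf_conjugate X r E1 f1 L1 E2 f2 L2"
    using ndr_cover.fiber_homotopy_equivalent_if_Lf_conjugate[OF _ M1 f1 M2 f2 L R1 R2 that] by blast
qed

end
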